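(* Let $\Omega\subseteq\mathbb{R}^N$ satisfy the standing assumptions below and suppose $\lambda_\ell(\Omega)<\mathcal{E}(\Omega)$ for some integer $\ell\ge1$. Then for every $j=1,\dots,\ell$ there exist $\beta_j\in(0,1)$ and constants $C_{1,j},C_{2,j}>0$ such that every eigenfunction $u_j$ associated with $\lambda_j(\Omega)$ (i.e. every nonzero $u_j\in W^{1,2}_0(\Omega)$ with $\int_\Omega\langle\nabla u_j,\nabla\varphi\rangle=\lambda_j(\Omega)\int_\Omega u_j\varphi$ for all $\varphi\in W^{1,2}_0(\Omega)$) satisfies \[ \|u_j\|_{L^2(\Omega\setminus\Omega_R)}\le C_{1,j}\|u_j\|_{L^2(\Omega)}\beta_j^R\quad\text{for every }R>0, \] \[ |u_j(x)|\le C_{2,j}\|u_j\|_{L^2(\Omega)}\beta_j^R\quad\text{for every }R>0\text{ and a.e. }x\in\Omega\text{ with }|x|>R, \] and moreover \[ \|u_j\|_{L^\infty(\Omega)}\le C_3\,\lambda_j(\Omega)^{N/4}\|u_j\|_{L^2(\Omega)} \] for a constant $C_3>0$ depending only on $N$.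
   Context: Standing assumptions: $N\ge2$ and $\Omega=\Omega_0\cup\bigcup_{i=1}^k\mathcal{C}_i$ with $k\ge1$, where (A1) $\Omega_0\subseteq\mathbb{R}^N$ is a bounded open set (possibly empty); (A2) for each $i$, $\mathcal{C}_i=\mathbf{R}_i(E_i\times(0,+\infty))+\mathbf{t}_i$, where $E_i\subseteq\mathbb{R}^{N-1}$ is open, bounded and connected, $\mathbf{R}_i$ is an $N\times N$ orthogonal matrix and $\mathbf{t}_i\in\mathbb{R}^N$; (A3) there is $\varrho_0>0$ with $(\mathcal{C}_i\cap\mathcal{C}_j)\setminus B_{\varrho_0}(0)=\emptyset$ for $i\neq j$. For $r>0$ set $Q^i_r=\mathbf{R}_i((-r,r)^N)+\mathbf{t}_i$, $\Omega^i_r=\Omega_0\cup(Q^i_r\cap\mathcal{C}_i)$, $\Omega_r=\bigcup_{i=1}^k\Omega^i_r$. For an open set $A$, $W^{1,2}_0(A)$ is the closure of $C^\infty_0(A)$ in $W^{1,2}(A)$, $\mathcal{S}_2(A)=\{\varphi\in W^{1,2}_0(A):\|\varphi\|_{L^2(A)}=1\}$ and \[ \lambda_j(A)=\inf\Big\{\max_{\varphi\in F\cap\mathcal{S}_2(A)}\int_A|\nabla\varphi|^2dx:\ F\subseteq W^{1,2}_0(A)\text{ subspace},\ \dim F=j\Big\}. \] $\lambda_1(E_i)$ is the first Dirichlet eigenvalue of $E_i\subseteq\mathbb{R}^{N-1}$ and $\mathcal{E}(\Omega)=\min\{\lambda_1(E_1),\dots,\lambda_1(E_k)\}$. *)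

theory Defs
  imports "HOL-Analysis.Analysis"
begin

fun pderivs :: "'b::euclidean_space list \<Rightarrow> ('b \<Rightarrow> real) \<Rightarrow> 'b \<Rightarrow> real" where
  "pderivs [] f = f"
| "pderivs (v # vs) f = (\<lambda>x. frechet_derivative (pderivs vs f) (at x) v)"

definition smooth :: "('b::euclidean_space \<Rightarrow> real) \<Rightarrow> bool" where
  "smooth f \<longleftrightarrow> (\<forall>ds. set ds \<subseteq> Basis \<longrightarrow> (\<forall>x. pderivs ds f differentiable (at x)))"

definition test_fun :: "'b::euclidean_space set \<Rightarrow> ('b \<Rightarrow> real) \<Rightarrow> bool" where
  "test_fun A f \<longleftrightarrow> smooth f \<and> compact (closure {x. f x \<noteq> 0}) \<and> closure {x. f x \<noteq> 0} \<subseteq> A"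

definition grad :: "('b::euclidean_space \<Rightarrow> real) \<Rightarrow> 'b \<Rightarrow> 'b" where
  "grad f x = (\<Sum>b\<in>Basis. frechet_derivative f (at x) b *\<^sub>R b)"

definition L2 :: "'b::euclidean_space set \<Rightarrow> ('b \<Rightarrow> real) \<Rightarrow> bool" where
  "L2 A u \<longleftrightarrow> (\<lambda>x. indicator A x * u x) \<in> borel_measurable lebesgue
     \<and> set_integrable lebesgue A (\<lambda>x. (u x)\<^sup>2)"

definition L2v :: "'b::euclidean_space set \<Rightarrow> ('b \<Rightarrow> 'b) \<Rightarrow> bool" where
  "L2v A g \<longleftrightarrow> (\<lambda>x. indicator A x *\<^sub>R g x) \<in> borel_measurable lebesgue
     \<and> set_integrable lebesgue A (\<lambda>x. (norm (g x))\<^sup>2)"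

definition L2norm :: "'b::euclidean_space set \<Rightarrow> ('b \<Rightarrow> real) \<Rightarrow> real" where
  "L2norm A u = sqrt (LINT x:A|lebesgue. (u x)\<^sup>2)"

definition weak_grad :: "'b::euclidean_space set \<Rightarrow> ('b \<Rightarrow> real) \<Rightarrow> ('b \<Rightarrow> 'b) \<Rightarrow> bool" where
  "weak_grad A u g \<longleftrightarrow> L2 A u \<and> L2v A g \<and>
     (\<forall>\<phi>. test_fun A \<phi> \<longrightarrow> (\<forall>b\<in>Basis.
        (LINT x:A|lebesgue. u x * frechet_derivative \<phi> (at x) b)
          = - (LINT x:A|lebesgue. (g x \<bullet> b) * \<phi> x)))"

definition W0 :: "'b::euclidean_space set \<Rightarrow> ('b \<Rightarrow> real) \<Rightarrow> bool" where
  "W0 A u \<longleftrightarrow> (\<exists>g. weak_grad A u g \<and>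
     (\<exists>\<phi>s. (\<forall>n. test_fun A (\<phi>s n)) \<and>
        ((\<lambda>n. LINT x:A|lebesgue. (\<phi>s n x - u x)\<^sup>2 + (norm (grad (\<phi>s n) x - g x))\<^sup>2)
           \<longlonglongrightarrow> 0)))"

definition wgrad :: "'b::euclidean_space set \<Rightarrow> ('b \<Rightarrow> real) \<Rightarrow> 'b \<Rightarrow> 'b" where
  "wgrad A u = (SOME g. weak_grad A u g)"

definition energy :: "'b::euclidean_space set \<Rightarrow> ('b \<Rightarrow> real) \<Rightarrow> real" where
  "energy A u = (LINT x:A|lebesgue. (norm (wgrad A u x))\<^sup>2)"

definition subspaces_dim :: "'b::euclidean_space set \<Rightarrow> nat \<Rightarrow> ('b \<Rightarrow> real) set set" where
  "subspaces_dim A j = {{(\<lambda>x. \<Sum>i<j. c i * us i x) | c. True} | us.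
      (\<forall>i<j. W0 A (us i)) \<and>
      (\<forall>c. (AE x in lebesgue. x \<in> A \<longrightarrow> (\<Sum>i<j. c i * us i x) = 0) \<longrightarrow> (\<forall>i<j. c i = 0))}"

definition dir_eig :: "nat \<Rightarrow> 'b::euclidean_space set \<Rightarrow> real" where
  "dir_eig j A = Inf {Sup {energy A v | v. v \<in> F \<and> (LINT x:A|lebesgue. (v x)\<^sup>2) = 1}
                       | F. F \<in> subspaces_dim A j}"

definition eigenfunction :: "'b::euclidean_space set \<Rightarrow> real \<Rightarrow> ('b \<Rightarrow> real) \<Rightarrow> bool" where
  "eigenfunction A lam u \<longleftrightarrow> W0 A u \<and> \<not> (AE x in lebesgue. x \<in> A \<longrightarrow> u x = 0) \<and>
     (\<forall>\<phi>. W0 A \<phi> \<longrightarrow>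
        (LINT x:A|lebesgue. wgrad A u x \<bullet> wgrad A \<phi> x) = lam * (LINT x:A|lebesgue. u x * \<phi> x))"

section \<open>Geometry: R^N is modelled as 'a \<times> real where 'a plays the role of R^(N-1)\<close>

definition cube :: "real \<Rightarrow> ('a::euclidean_space \<times> real) set" where
  "cube r = {x. \<forall>b\<in>Basis. \<bar>x \<bullet> b\<bar> < r}"

definition cyl :: "(('a::euclidean_space \<times> real) \<Rightarrow> ('a \<times> real)) \<Rightarrow> ('a \<times> real) \<Rightarrow> 'a set \<Rightarrow> ('a \<times> real) set" where
  "cyl Rot t E = (\<lambda>x. Rot x + t) ` (E \<times> {0<..})"

definition cubeQ :: "(('a::euclidean_space \<times> real) \<Rightarrow> ('a \<times> real)) \<Rightarrow> ('a \<times> real) \<Rightarrow> real \<Rightarrow> ('a \<times> real) set" where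
  "cubeQ Rot t r = (\<lambda>x. Rot x + t) ` cube r"

definition \<Omega>_set :: "('a::euclidean_space \<times> real) set \<Rightarrow> nat \<Rightarrow> (nat \<Rightarrow> ('a \<times> real) \<Rightarrow> ('a \<times> real))
     \<Rightarrow> (nat \<Rightarrow> 'a \<times> real) \<Rightarrow> (nat \<Rightarrow> 'a set) \<Rightarrow> ('a \<times> real) set" where
  "\<Omega>_set \<Omega>0 k Rot t E = \<Omega>0 \<union> (\<Union>i\<in>{1..k}. cyl (Rot i) (t i) (E i))"

definition \<Omega>_trunc :: "('a::euclidean_space \<times> real) set \<Rightarrow> nat \<Rightarrow> (nat \<Rightarrow> ('a \<times> real) \<Rightarrow> ('a \<times> real))
     \<Rightarrow> (nat \<Rightarrow> 'a \<times> real) \<Rightarrow> (nat \<Rightarrow> 'a set) \<Rightarrow> real \<Rightarrow> ('a \<times> real) set" where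
  "\<Omega>_trunc \<Omega>0 k Rot t E r = (\<Union>i\<in>{1..k}. \<Omega>0 \<union> (cubeQ (Rot i) (t i) r \<inter> cyl (Rot i) (t i) (E i)))"

end

theory Submission
  imports Defs "HOL-Probability.Probability"
begin

text \<open>The square of an eigenfunction satisfies \<open>- \<Delta> (u\<^sup>2) \<le> 2 \<lambda> u\<^sup>2\<close> weakly on the whole space, as testing
  the equation with \<open>\<phi> u\<close> for a smooth \<open>\<phi> \<ge> 0\<close> shows. Taking heat kernels for \<open>\<phi>\<close>, the integral of
  \<open>u\<^sup>2\<close> against the heat kernel at time \<open>t\<close>, multiplied by \<open>exp (2 \<lambda> t)\<close>, is nondecreasing in \<open>t\<close> and
  therefore dominates \<open>u\<^sup>2\<close> almost everywhere. The time \<open>t = 1 / \<lambda>\<close> gives the bound of the maximum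
  with a constant that depends on the dimension only.

  Far out on a cylinder the Poincare inequality of the cross section, applied to cut-offs of \<open>u\<close>,
  bounds the mass beyond height \<open>R + 1\<close> by a multiple of the mass between \<open>R\<close> and \<open>R + 1\<close>, because
  \<open>\<lambda>\<close> lies below the first eigenvalue of the cross section. Hence the mass beyond \<open>R\<close> decays
  geometrically, and the comparison with the heat kernel at time 1 makes the decay pointwise.\<close>

subsection \<open>Smooth functions\<close>

text \<open>The whole-space inequality for \<open>u\<^sup>2\<close> asks nothing of the boundary:
  membership in \<open>W0\<close> makes \<open>\<phi> * u\<close> admissible for every smooth
  \<open>\<phi>\<close> with bounded values and gradient, and it is the zero extension of
  \<open>u\<close> that is averaged against the heat kernel. Hence \<open>C3\<close> can depend on
  the dimension alone. The decay is shaped by one obstacle: a cut-off that isolates a single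
  cylinder jumps across the lateral boundary of that cylinder. It is harmless only in products with
  test functions of the whole domain, and only if it starts above the bounded region where the
  cylinder meets \<open>\<Omega>0\<close> or other cylinders. The rate \<open>\<beta>\<close> is a
  fourth root of the rate of the mass: for \<open>norm x > R\<close> the heat average is controlled
  by the mass beyond radius \<open>R / 2\<close>, which halves the exponent, and passing from
  \<open>u\<^sup>2\<close> to \<open>u\<close> halves it again. The step from \<open>l\<close> to
  all \<open>j \<le> l\<close> is monotonicity of the variational eigenvalues; as these are an
  \<open>Inf\<close> of \<open>Sup\<close> over sets of reals, nonemptiness and boundedness of all
  the sets involved have to be supplied.\<close>

fun Ck :: "nat \<Rightarrow> ('b::euclidean_space \<Rightarrow> real) \<Rightarrow> bool" where
  "Ck 0 f = (\<forall>x. f differentiable at x)"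
| "Ck (Suc n) f = ((\<forall>x. f differentiable at x) \<and> (\<forall>b\<in>Basis. Ck n (\<lambda>x. frechet_derivative f (at x) b)))"

lemma pderivs_snoc: "pderivs (vs @ [b]) f = pderivs vs (\<lambda>x. frechet_derivative f (at x) b)"
  by (induction vs) auto

text \<open>\<open>pderivs\<close> takes the head of the list as the last derivative, whereas
  \<open>Ck\<close> peels off the first one, so lists are split at their end. In the recursive form,
  closure under products and compositions is an induction on the order with the function left
  arbitrary.\<close>

lemma Ck_iff_pderivs:
  "Ck n f \<longleftrightarrow> (\<forall>ds. length ds \<le> n \<longrightarrow> set ds \<subseteq> Basis \<longrightarrow> (\<forall>x. pderivs ds f differentiable (at x)))"
proof (induction n arbitrary: f)
  case 0
  then show ?case by auto
next
  case (Suc n)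
  show ?case
  proof
    assume L: "Ck (Suc n) f"
    show "\<forall>ds. length ds \<le> Suc n \<longrightarrow> set ds \<subseteq> Basis \<longrightarrow> (\<forall>x. pderivs ds f differentiable (at x))"
    proof (intro allI impI)
      fix ds :: "'a list" and x assume ds: "length ds \<le> Suc n" "set ds \<subseteq> Basis"
      show "pderivs ds f differentiable (at x)"
      proof (cases ds rule: rev_cases)
        case Nil then show ?thesis using L by simp
      next
        case (snoc vs b)
        with ds L Suc.IH[of "\<lambda>x. frechet_derivative f (at x) b"] show ?thesis
          by (auto simp: pderivs_snoc)
      qed
    qed
  next
    assume R: "\<forall>ds. length ds \<le> Suc n \<longrightarrow> set ds \<subseteq> Basis \<longrightarrow> (\<forall>x. pderivs ds f differentiable (at x))"
    have 1: "\<forall>x. f differentiable at x"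
      using R[rule_format, of "[]"] by auto
    have 2: "Ck n (\<lambda>x. frechet_derivative f (at x) b)" if b: "b \<in> Basis" for b
      unfolding Suc.IH
    proof (intro allI impI)
      fix ds :: "'a list" and x assume "length ds \<le> n" "set ds \<subseteq> Basis"
      then show "pderivs ds (\<lambda>x. frechet_derivative f (at x) b) differentiable (at x)"
        using R[rule_format, of "ds @ [b]" x] b by (auto simp: pderivs_snoc)
    qed
    show "Ck (Suc n) f" using 1 2 by auto
  qed
qed

lemma smooth_iff_Ck: "smooth f \<longleftrightarrow> (\<forall>n. Ck n f)"
  unfolding smooth_def Ck_iff_pderivs by auto

lemma Ck_differentiable: "Ck n f \<Longrightarrow> f differentiable at x"
  by (cases n) auto

lemma Ck_SucD: "Ck (Suc n) f \<Longrightarrow> Ck n f"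
  by (induction n arbitrary: f) auto

lemma Ck_SucI:
  assumes "\<And>x. (f has_derivative f' x) (at x)" "\<And>b. b \<in> Basis \<Longrightarrow> Ck n (\<lambda>x. f' x b)"
  shows "Ck (Suc n) f"
proof -
  have "frechet_derivative f (at x) = f' x" for x
    using assms(1) frechet_derivative_at by metis
  then show ?thesis using assms by (auto simp: differentiable_def)
qed

lemma Ck_0I:
  assumes "\<And>x. (f has_derivative f' x) (at x)"
  shows "Ck 0 f"
  using assms by (auto simp: differentiable_def)

lemma Ck_SucE:
  assumes "Ck (Suc n) f"
  shows "(f has_derivative frechet_derivative f (at x)) (at x)"
    "b \<in> Basis \<Longrightarrow> Ck n (\<lambda>x. frechet_derivative f (at x) b)"
  using assms by (auto simp: frechet_derivative_works[symmetric])

lemma Ck_has_derivative: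
  assumes "Ck n f"
  shows "(f has_derivative frechet_derivative f (at x)) (at x)"
  using Ck_differentiable[OF assms] by (simp add: frechet_derivative_works[symmetric])

lemma Ck_const: "Ck n (\<lambda>x. c)"
proof (induction n arbitrary: c)
  case (Suc n)
  then show ?case by (intro Ck_SucI[where f'="\<lambda>_ _. 0"]) auto
qed auto

lemma Ck_add: "Ck n f \<Longrightarrow> Ck n g \<Longrightarrow> Ck n (\<lambda>x. f x + g x)"
proof (induction n arbitrary: f g)
  case (Suc n)
  show ?case
    by (rule Ck_SucI[OF has_derivative_add[OF Ck_SucE(1)[OF Suc.prems(1)] Ck_SucE(1)[OF Suc.prems(2)]]])
       (intro Suc.IH Ck_SucE(2)[OF Suc.prems(1)] Ck_SucE(2)[OF Suc.prems(2)])
qed auto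

lemma Ck_mult: "Ck n f \<Longrightarrow> Ck n g \<Longrightarrow> Ck n (\<lambda>x. f x * g x)"
proof (induction n arbitrary: f g)
  case (Suc n)
  show ?case
    by (rule Ck_SucI[OF has_derivative_mult[OF Ck_SucE(1)[OF Suc.prems(1)] Ck_SucE(1)[OF Suc.prems(2)]]])
       (intro Ck_add Suc.IH Ck_SucE(2)[OF Suc.prems(1)] Ck_SucE(2)[OF Suc.prems(2)]
          Suc.prems[THEN Ck_SucD])
qed auto

lemma Ck_sum: "finite I \<Longrightarrow> (\<And>i. i \<in> I \<Longrightarrow> Ck n (f i)) \<Longrightarrow> Ck n (\<lambda>x. \<Sum>i\<in>I. f i x)"
  by (induction I rule: finite_induct) (auto intro: Ck_const Ck_add)

lemma Ck_compose_affine: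
  fixes A :: "'c::euclidean_space \<Rightarrow> 'b::euclidean_space"
  assumes A: "linear A"
  shows "Ck n f \<Longrightarrow> Ck n (\<lambda>x. f (A x + t))"
proof (induction n arbitrary: f)
  case 0
  have "((\<lambda>x. f (A x + t)) has_derivative (\<lambda>h. frechet_derivative f (at (A x + t)) (A h))) (at x)" for x
    by (rule has_derivative_compose[where g=f, OF _ Ck_has_derivative[OF 0]])
       (auto intro!: derivative_eq_intros linear_imp_has_derivative A)
  then show ?case by (rule Ck_0I)
next
  case (Suc n)
  show ?case
  proof (rule Ck_SucI)
    fix x show "((\<lambda>x. f (A x + t)) has_derivative (\<lambda>h. frechet_derivative f (at (A x + t)) (A h))) (at x)"
      by (rule has_derivative_compose[where g=f, OF _ Ck_has_derivative[OF Suc.prems]])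
         (auto intro!: derivative_eq_intros linear_imp_has_derivative A)
  next
    fix b :: 'c assume "b \<in> Basis"
    have lin: "linear (frechet_derivative f (at y))" for y
      using Ck_has_derivative[OF Suc.prems] has_derivative_linear by blast
    \<comment> \<open>The image \<open>A b\<close> of a basis vector is in general no basis vector,
      while the induction hypothesis speaks of basis directions only; linearity of the derivative
      bridges the gap.\<close>
    have eq: "frechet_derivative f (at y) (A b) = (\<Sum>c\<in>Basis. (A b \<bullet> c) * frechet_derivative f (at y) c)" for y
    proof -
      have "frechet_derivative f (at y) (A b) = frechet_derivative f (at y) (\<Sum>c\<in>Basis. (A b \<bullet> c) *\<^sub>R c)"
        by (simp add: euclidean_representation)
      also have "\<dots> = (\<Sum>c\<in>Basis. (A b \<bullet> c) * frechet_derivative f (at y) c)"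
        using lin[of y] by (simp add: linear_sum linear_cmul)
      finally show ?thesis .
    qed
    show "Ck n (\<lambda>x. frechet_derivative f (at (A x + t)) (A b))"
      unfolding eq
      by (intro Ck_sum Ck_mult Ck_const finite_Basis Suc.IH Ck_SucE(2)[OF Suc.prems])
  qed
qed

lemma Ck_compose_real:
  fixes f :: "real \<Rightarrow> real" and g :: "'b::euclidean_space \<Rightarrow> real"
  shows "Ck n f \<Longrightarrow> Ck n g \<Longrightarrow> Ck n (\<lambda>x. f (g x))"
proof (induction n arbitrary: f g)
  case 0
  have "((\<lambda>x. f (g x)) has_derivative (\<lambda>h. frechet_derivative f (at (g x)) (frechet_derivative g (at x) h))) (at x)" for x
    by (rule has_derivative_compose[OF Ck_has_derivative[OF 0(2)] Ck_has_derivative[OF 0(1)]])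
  then show ?case by (rule Ck_0I)
next
  case (Suc n)
  show ?case
  proof (rule Ck_SucI)
    fix x show "((\<lambda>x. f (g x)) has_derivative (\<lambda>h. frechet_derivative f (at (g x)) (frechet_derivative g (at x) h))) (at x)"
      by (rule has_derivative_compose[OF Ck_has_derivative[OF Suc.prems(2)] Ck_has_derivative[OF Suc.prems(1)]])
  next
    fix b :: 'b assume b: "b \<in> Basis"
    have lin: "linear (frechet_derivative f (at y))" for y
      using Ck_has_derivative[OF Suc.prems(1)] has_derivative_linear by blast
    have eq: "frechet_derivative f (at y) h = h * frechet_derivative f (at y) 1" for y h
      using linear_cmul[OF lin[of y], of h 1] by simp
    have "Ck n (\<lambda>x. frechet_derivative f (at (g x)) 1)"
      by (rule Suc.IH[OF Ck_SucE(2)[OF Suc.prems(1)] Ck_SucD[OF Suc.prems(2)]]) simp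
    then have "Ck n (\<lambda>x. frechet_derivative g (at x) b * frechet_derivative f (at (g x)) 1)"
      by (rule Ck_mult[OF Ck_SucE(2)[OF Suc.prems(2) b]])
    then show "Ck n (\<lambda>x. frechet_derivative f (at (g x)) (frechet_derivative g (at x) b))"
      by (subst eq)
  qed
qed

lemma Ck_real_SucI:
  fixes f :: "real \<Rightarrow> real"
  assumes "\<And>x. (f has_real_derivative f' x) (at x)" "Ck n f'"
  shows "Ck (Suc n) f"
  using assms by (intro Ck_SucI[where f'="\<lambda>x h. f' x * h"]) (auto simp: has_field_derivative_def)

lemma Ck_real_0I:
  fixes f :: "real \<Rightarrow> real"
  assumes "\<And>x. (f has_real_derivative f' x) (at x)"
  shows "Ck 0 f"
  using assms by (auto simp: has_field_derivative_def differentiable_def)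

lemma Ck_exp: "Ck n (exp :: real \<Rightarrow> real)"
proof (induction n)
  case 0 show ?case by (rule Ck_real_0I[where f'=exp]) (auto intro!: derivative_eq_intros)
next
  case (Suc n) then show ?case by (intro Ck_real_SucI[where f'=exp]) (auto intro!: derivative_eq_intros)
qed

lemma Ck_inner: "Ck n (\<lambda>x. x \<bullet> v)"
proof (cases n)
  case 0
  show ?thesis unfolding 0 by (rule Ck_0I[where f'="\<lambda>_ h. h \<bullet> v"]) (auto intro!: derivative_eq_intros)
next
  case (Suc m)
  show ?thesis unfolding Suc
    by (rule Ck_SucI[where f'="\<lambda>_ h. h \<bullet> v"]) (auto intro!: derivative_eq_intros Ck_const)
qed

lemma smooth_differentiable: "smooth f \<Longrightarrow> f differentiable at x"
  by (metis smooth_iff_Ck Ck_differentiable)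

lemma smooth_frechet: "smooth f \<Longrightarrow> b \<in> Basis \<Longrightarrow> smooth (\<lambda>x. frechet_derivative f (at x) b)"
  by (metis smooth_iff_Ck Ck_SucE(2))

lemma smooth_const: "smooth (\<lambda>x. c)" by (simp add: smooth_iff_Ck Ck_const)
lemma smooth_add: "smooth f \<Longrightarrow> smooth g \<Longrightarrow> smooth (\<lambda>x. f x + g x)" by (simp add: smooth_iff_Ck Ck_add)
lemma smooth_mult: "smooth f \<Longrightarrow> smooth g \<Longrightarrow> smooth (\<lambda>x. f x * g x)" by (simp add: smooth_iff_Ck Ck_mult)
lemma smooth_diff: "smooth f \<Longrightarrow> smooth g \<Longrightarrow> smooth (\<lambda>x. f x - g x)"
  using smooth_add[of f "\<lambda>x. (-1) * g x"] smooth_mult[OF smooth_const, of g "-1"] by simp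
lemma smooth_sum: "finite I \<Longrightarrow> (\<And>i. i \<in> I \<Longrightarrow> smooth (f i)) \<Longrightarrow> smooth (\<lambda>x. \<Sum>i\<in>I. f i x)"
  by (simp add: smooth_iff_Ck Ck_sum)
lemma smooth_prod: "finite I \<Longrightarrow> (\<And>i. i \<in> I \<Longrightarrow> smooth (f i)) \<Longrightarrow> smooth (\<lambda>x. \<Prod>i\<in>I. f i x)"
  by (induction I rule: finite_induct) (auto intro: smooth_const smooth_mult)
lemma smooth_power: "smooth f \<Longrightarrow> smooth (\<lambda>x. f x ^ n)"
  by (induction n) (auto intro: smooth_const smooth_mult)
lemma smooth_compose_affine: "linear A \<Longrightarrow> smooth f \<Longrightarrow> smooth (\<lambda>x. f (A x + t))"
  by (simp add: smooth_iff_Ck Ck_compose_affine)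
lemma smooth_compose_real: "smooth f \<Longrightarrow> smooth g \<Longrightarrow> smooth (\<lambda>x. f (g x))" for f :: "real \<Rightarrow> real"
  by (simp add: smooth_iff_Ck Ck_compose_real)
lemma smooth_exp: "smooth (exp :: real \<Rightarrow> real)" by (simp add: smooth_iff_Ck Ck_exp)
lemma smooth_inner: "smooth (\<lambda>x. x \<bullet> v)" by (simp add: smooth_iff_Ck Ck_inner)

text \<open>Serves the cut-off \<open>\<eta>\<close>, which is obtained as a primitive of a smooth
  bump and has no explicit formula.\<close>

lemma smooth_real_antiderivative:
  fixes f :: "real \<Rightarrow> real"
  assumes "\<And>x. (f has_real_derivative f' x) (at x)" "smooth f'"
  shows "smooth f"
  unfolding smooth_iff_Ck
proof
  fix n show "Ck n f"
    using Ck_SucD[OF Ck_real_SucI[OF assms(1), of n]] assms(2) by (simp add: smooth_iff_Ck)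
qed

lemma smooth_continuous: "smooth f \<Longrightarrow> continuous_on S f"
  by (metis continuous_at_imp_continuous_on differentiable_imp_continuous_within smooth_differentiable)

lemma continuous_frechet: "smooth f \<Longrightarrow> b \<in> Basis \<Longrightarrow> continuous_on S (\<lambda>x. frechet_derivative f (at x) b)"
  by (intro smooth_continuous smooth_frechet)

lemma frechet_eq_grad:
  assumes "f differentiable at x"
  shows "frechet_derivative f (at x) h = grad f x \<bullet> h"
proof -
  have lin: "linear (frechet_derivative f (at x))"
    using assms frechet_derivative_works has_derivative_linear by blast
  have "frechet_derivative f (at x) h = frechet_derivative f (at x) (\<Sum>c\<in>Basis. (h \<bullet> c) *\<^sub>R c)"
    by (simp add: euclidean_representation)
  also have "\<dots> = (\<Sum>c\<in>Basis. (h \<bullet> c) * frechet_derivative f (at x) c)"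
    using lin by (simp add: linear_sum linear_cmul)
  also have "\<dots> = grad f x \<bullet> h"
    unfolding grad_def inner_sum_left by (intro sum.cong) (auto simp: inner_commute)
  finally show ?thesis .
qed

lemma grad_eqI:
  assumes "(f has_derivative (\<lambda>h. v \<bullet> h)) (at x)"
  shows "grad f x = v"
proof -
  have "frechet_derivative f (at x) = (\<lambda>h. v \<bullet> h)" using assms frechet_derivative_at by metis
  then show ?thesis unfolding grad_def by (simp add: euclidean_representation)
qed

lemma has_derivative_grad:
  assumes "f differentiable at x"
  shows "(f has_derivative (\<lambda>h. grad f x \<bullet> h)) (at x)"
  using assms frechet_eq_grad[OF assms] by (metis (no_types, lifting) ext frechet_derivative_works)

lemma grad_inner_Basis: "b \<in> Basis \<Longrightarrow> grad f x \<bullet> b = frechet_derivative f (at x) b"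
  unfolding grad_def by simp

lemma grad_mult:
  assumes "f differentiable at x" "g differentiable at x"
  shows "grad (\<lambda>x. f x * g x) x = f x *\<^sub>R grad g x + g x *\<^sub>R grad f x"
  by (rule grad_eqI)
     (auto intro!: derivative_eq_intros has_derivative_grad assms simp: inner_add_left algebra_simps)

lemma grad_cmult:
  assumes "f differentiable at x"
  shows "grad (\<lambda>x. c * f x) x = c *\<^sub>R grad f x"
  by (rule grad_eqI)
     (auto intro!: derivative_eq_intros has_derivative_grad assms)

lemma grad_sum:
  assumes "\<And>i. i \<in> I \<Longrightarrow> f i differentiable at x"
  shows "grad (\<lambda>x. \<Sum>i\<in>I. f i x) x = (\<Sum>i\<in>I. grad (f i) x)"
  by (rule grad_eqI)
     (auto intro!: derivative_eq_intros has_derivative_grad assms simp: inner_sum_left)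

lemma continuous_grad: "smooth f \<Longrightarrow> continuous_on S (grad f)"
  unfolding grad_def[abs_def] by (intro continuous_intros continuous_frechet)

subsection \<open>Test functions\<close>

lemma test_fun_smooth: "test_fun A f \<Longrightarrow> smooth f"
  by (simp add: test_fun_def)

lemma test_fun_differentiable: "test_fun A f \<Longrightarrow> f differentiable at x"
  by (simp add: test_fun_def smooth_differentiable)

lemma test_fun_mono: "test_fun A f \<Longrightarrow> A \<subseteq> B \<Longrightarrow> test_fun B f"
  by (auto simp: test_fun_def)

lemma test_funI:
  assumes "smooth f" "compact K" "K \<subseteq> A" "\<And>x. x \<notin> K \<Longrightarrow> f x = 0"
  shows "test_fun A f"
proof -
  have sub: "closure {x. f x \<noteq> 0} \<subseteq> K"
    using assms(2,4) by (intro closure_minimal) (auto simp: compact_imp_closed)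
  have "bounded (closure {x. f x \<noteq> 0})"
    by (rule bounded_subset[OF compact_imp_bounded[OF assms(2)] sub])
  then have "compact (closure {x. f x \<noteq> 0})" by (simp add: compact_eq_bounded_closed)
  then show ?thesis using assms(1,3) sub unfolding test_fun_def by blast
qed

text \<open>The complement of the closed support is open, so the derivatives vanish there as well:
  one compact set serves the function and its gradient.\<close>

lemma test_funE:
  assumes "test_fun A f"
  obtains K where "compact K" "K \<subseteq> A" "\<And>x. x \<notin> K \<Longrightarrow> f x = 0" "\<And>x. x \<notin> K \<Longrightarrow> grad f x = 0"
    "\<And>x. x \<notin> K \<Longrightarrow> frechet_derivative f (at x) = (\<lambda>h. 0)"
proof -
  let ?K = "closure {x. f x \<noteq> 0}"
  have K: "compact ?K" "?K \<subseteq> A" using assms by (auto simp: test_fun_def)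
  have z: "f x = 0" if "x \<notin> ?K" for x using that closure_subset[of "{x. f x \<noteq> 0}"] by blast
  have d: "frechet_derivative f (at x) = (\<lambda>h. 0)" if "x \<notin> ?K" for x
  proof -
    have "(f has_derivative (\<lambda>h. 0)) (at x)"
    proof (rule has_derivative_transform_within_open[OF has_derivative_const])
      show "open (- ?K)" by (intro open_Compl closed_closure)
      show "x \<in> - ?K" using that by simp
      show "0 = f y" if "y \<in> - ?K" for y using z[of y] that by simp
    qed
    then show ?thesis by (metis frechet_derivative_at)
  qed
  have "grad f x = 0" if "x \<notin> ?K" for x
    unfolding grad_def using d[OF that] by simp
  then show ?thesis using that K z d by blast
qed

lemma test_fun_zero: "test_fun A (\<lambda>x. 0)"
  by (rule test_funI[where K="{}"]) (auto intro: smooth_const)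

lemma test_fun_mult_smooth:
  assumes "test_fun A f" "smooth g"
  shows "test_fun A (\<lambda>x. g x * f x)"
proof -
  obtain K where "compact K" "K \<subseteq> A" "\<And>x. x \<notin> K \<Longrightarrow> f x = 0" using test_funE[OF assms(1)] by metis
  then show ?thesis using assms
    by (intro test_funI[where K=K] smooth_mult) (auto simp: test_fun_smooth)
qed

lemma test_fun_add:
  assumes "test_fun A f" "test_fun A g"
  shows "test_fun A (\<lambda>x. f x + g x)"
proof -
  obtain K L where "compact K" "K \<subseteq> A" "\<And>x. x \<notin> K \<Longrightarrow> f x = 0"
    and "compact L" "L \<subseteq> A" "\<And>x. x \<notin> L \<Longrightarrow> g x = 0"
    using test_funE[OF assms(1)] test_funE[OF assms(2)] by metis
  then show ?thesis using assms
    by (intro test_funI[where K="K \<union> L"] smooth_add) (auto simp: test_fun_smooth)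
qed

lemma test_fun_cmult: "test_fun A f \<Longrightarrow> test_fun A (\<lambda>x. c * f x)"
  by (rule test_fun_mult_smooth[OF _ smooth_const])

lemma test_fun_sum:
  "finite I \<Longrightarrow> (\<And>i. i \<in> I \<Longrightarrow> test_fun A (f i)) \<Longrightarrow> test_fun A (\<lambda>x. \<Sum>i\<in>I. f i x)"
  by (induction I rule: finite_induct) (auto intro: test_fun_zero test_fun_add)

lemma test_fun_frechet:
  assumes "test_fun A f" "b \<in> Basis"
  shows "test_fun A (\<lambda>x. frechet_derivative f (at x) b)"
proof -
  obtain K where "compact K" "K \<subseteq> A" "\<And>x. x \<notin> K \<Longrightarrow> frechet_derivative f (at x) = (\<lambda>h. 0)"
    using test_funE[OF assms(1)] by metis
  then show ?thesis using assms
    by (intro test_funI[where K=K] smooth_frechet) (auto simp: test_fun_smooth)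
qed

subsection \<open>Bump functions\<close>

text \<open>\<open>ebump 0\<close> is the classical \<open>exp (- 1 / x)\<close> glued to 0. The
  powers in the denominator make the family closed under differentiation up to linear combinations,
  so smoothness reduces to first derivatives for all \<open>n\<close>.\<close>

definition ebump :: "nat \<Rightarrow> real \<Rightarrow> real" where
  "ebump n x = (if x > 0 then exp (- 1 / x) / x ^ n else 0)"

lemma ebump_tendsto: "(ebump n \<longlongrightarrow> 0) (at 0)"
proof (rule filterlim_split_at_real)
  show "(ebump n \<longlongrightarrow> 0) (at_left 0)"
    by (rule Lim_transform_eventually[OF tendsto_const])
       (auto simp: ebump_def eventually_at_left_field intro: exI[of _ "-1"])
  have "((\<lambda>y::real. y ^ n / exp y) \<longlongrightarrow> 0) at_top" by (rule tendsto_power_div_exp_0)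
  then have "((\<lambda>x::real. inverse x ^ n / exp (inverse x)) \<longlongrightarrow> 0) (at_right 0)"
    by (rule filterlim_compose[OF _ filterlim_inverse_at_top_right])
  then show "(ebump n \<longlongrightarrow> 0) (at_right 0)"
    by (rule Lim_transform_eventually)
       (auto simp: ebump_def eventually_at_right_field exp_minus field_simps intro!: exI[of _ 1])
qed

lemma ebump_deriv:
  "(ebump n has_real_derivative (ebump (n + 2) x - n * ebump (n + 1) x)) (at x)"
proof -
  consider "x > 0" | "x < 0" | "x = 0" by linarith
  then show ?thesis
  proof cases
    case 1
    have "((\<lambda>x. exp (- 1 / x) / x ^ n) has_real_derivative (ebump (n + 2) x - n * ebump (n + 1) x)) (at x)"
    proof (cases n)
      case 0
      then show ?thesis using 1
        by (auto intro!: derivative_eq_intros simp: ebump_def field_simps power2_eq_square)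
    next
      case (Suc m)
      then show ?thesis using 1
        by (auto intro!: derivative_eq_intros simp: ebump_def)
           (simp add: field_simps power2_eq_square, cases m, simp_all)
    qed
    then show ?thesis
      by (rule has_field_derivative_transform_within_open[where S="{0<..}"]) (use 1 in \<open>auto simp: ebump_def\<close>)
  next
    case 2
    have "((\<lambda>x. 0) has_real_derivative 0) (at x)" by simp
    then have "(ebump n has_real_derivative 0) (at x)"
      by (rule has_field_derivative_transform_within_open[where S="{..<0}"]) (use 2 in \<open>auto simp: ebump_def\<close>)
    then show ?thesis using 2 by (simp add: ebump_def)
  next
    case 3
    \<comment> \<open>The difference quotient of \<open>ebump n\<close> at 0 is
      \<open>ebump (n + 1)\<close>, which tends to 0.\<close>
    have "(ebump n has_real_derivative 0) (at 0)"
      unfolding has_field_derivative_iff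
      by (rule Lim_transform_eventually[OF ebump_tendsto[of "n+1"]])
         (auto simp: ebump_def eventually_at_filter field_simps)
    then show ?thesis using 3 by (simp add: ebump_def)
  qed
qed

lemma Ck_ebump: "Ck m (ebump n)"
proof (induction m arbitrary: n)
  case 0 show ?case by (rule Ck_real_0I[OF ebump_deriv])
next
  case (Suc m)
  have "Ck m (\<lambda>x. ebump (n + 2) x + (- real n) * ebump (n + 1) x)"
    by (intro Ck_add Ck_mult Ck_const Suc)
  then show ?case by (intro Ck_real_SucI[OF ebump_deriv]) auto
qed

lemma smooth_ebump: "smooth (ebump n)"
  by (simp add: smooth_iff_Ck Ck_ebump)

lemma ebump0_bounds: "0 \<le> ebump 0 x" "ebump 0 x \<le> 1" "ebump 0 x > 0 \<longleftrightarrow> x > 0"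
  by (auto simp: ebump_def)

lemma ebump0_scale_tendsto: "x > 0 \<Longrightarrow> (\<lambda>n. ebump 0 (real n * x)) \<longlonglongrightarrow> 1"
proof -
  assume x: "x > 0"
  have "(\<lambda>n. exp (- (1/x) * inverse (real n))) \<longlonglongrightarrow> exp (- (1/x) * 0)"
    by (intro tendsto_intros lim_inverse_n)
  then have "(\<lambda>n. exp (- (1/x) * inverse (real n))) \<longlonglongrightarrow> 1" by simp
  then show ?thesis
    by (rule Lim_transform_eventually)
       (use x in \<open>auto simp: ebump_def field_simps eventually_sequentially intro!: exI[of _ 1]\<close>)
qed

text \<open>For positive \<open>n\<close> the parameter leaves the set of positivity, the open box,
  unchanged and only steepens the walls: each factor \<open>exp (- 1 / (n * d))\<close> with
  \<open>d > 0\<close> tends to 1.\<close>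

definition box_bump :: "'b::euclidean_space \<Rightarrow> 'b \<Rightarrow> nat \<Rightarrow> 'b \<Rightarrow> real" where
  "box_bump a b n x =
     (\<Prod>i\<in>Basis. ebump 0 (real n * (x \<bullet> i - a \<bullet> i)) * ebump 0 (real n * (b \<bullet> i - x \<bullet> i)))"

lemma box_bump_smooth: "smooth (box_bump a b n)"
proof -
  have 1: "smooth (\<lambda>x::'a. real n * (x \<bullet> i - a \<bullet> i))" "smooth (\<lambda>x::'a. real n * (b \<bullet> i - x \<bullet> i))" for i
    by (intro smooth_mult smooth_diff smooth_const smooth_inner)+
  show ?thesis unfolding box_bump_def[abs_def]
    by (intro smooth_prod smooth_mult finite_Basis
          smooth_compose_real[OF smooth_ebump[of 0] 1(1)] smooth_compose_real[OF smooth_ebump[of 0] 1(2)])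
qed

lemma box_bump_bounds: "0 \<le> box_bump a b n x" "box_bump a b n x \<le> 1"
  unfolding box_bump_def
  by (intro prod_nonneg mult_nonneg_nonneg ballI ebump0_bounds)
     (intro prod_le_1 conjI mult_nonneg_nonneg mult_le_one ebump0_bounds)

lemma box_bump_pos: "n > 0 \<Longrightarrow> x \<in> box a b \<Longrightarrow> box_bump a b n x > 0"
  unfolding box_bump_def
  by (intro prod_pos ballI mult_pos_pos) (auto simp: ebump0_bounds mem_box)

lemma box_bump_zero: "x \<notin> box a b \<Longrightarrow> box_bump a b n x = 0"
proof -
  assume "x \<notin> box a b"
  then obtain i where i: "i \<in> Basis" "x \<bullet> i \<le> a \<bullet> i \<or> b \<bullet> i \<le> x \<bullet> i"
    by (auto simp: mem_box not_less)
  then have "ebump 0 (real n * (x \<bullet> i - a \<bullet> i)) * ebump 0 (real n * (b \<bullet> i - x \<bullet> i)) = 0"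
    by (auto simp: ebump_def zero_less_mult_iff)
  then show ?thesis unfolding box_bump_def using i(1) by (intro prod_zero) auto
qed

lemma box_bump_tendsto: "x \<in> box a b \<Longrightarrow> (\<lambda>n. box_bump a b n x) \<longlonglongrightarrow> 1"
proof -
  assume x: "x \<in> box a b"
  have "(\<lambda>n. box_bump a b n x) \<longlonglongrightarrow> (\<Prod>i\<in>(Basis::'a set). 1 * 1)"
    unfolding box_bump_def
    by (intro tendsto_prod tendsto_mult ebump0_scale_tendsto) (use x in \<open>auto simp: mem_box\<close>)
  then show ?thesis by simp
qed

lemma test_fun_box_bump: "cbox a b \<subseteq> A \<Longrightarrow> test_fun A (box_bump a b n)"
  by (rule test_funI[OF box_bump_smooth, where K="cbox a b"])
     (use box_subset_cbox in \<open>auto intro!: box_bump_zero\<close>)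

text \<open>An open set is a countable union of boxes whose closures lie inside it. One minus the
  product of all \<open>1 - f\<close> is the smooth counterpart of a union: it is near 1 as soon as
  one bump \<open>f\<close> is, and finitely many bumps keep the support compact in
  \<open>U\<close>. The index \<open>n\<close> drives the number of boxes and their steepness at
  once.\<close>

lemma ex_test_funs_tendsto_indicator:
  fixes U :: "'b::euclidean_space set"
  assumes "open U"
  obtains \<phi> where "\<And>n::nat. test_fun U (\<phi> n)" "\<And>n x. 0 \<le> \<phi> n x" "\<And>n x. \<phi> n x \<le> 1"
    "\<And>x. (\<lambda>n. \<phi> n x) \<longlonglongrightarrow> indicator U x"
proof -
  let ?F = "{box a b | a b. cbox a b \<subseteq> U}"
  have U: "\<Union>?F = U"
  proof
    show "\<Union>?F \<subseteq> U" using box_subset_cbox by fastforce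
    show "U \<subseteq> \<Union>?F"
    proof
      fix x assume "x \<in> U"
      then obtain a b where "x \<in> box a b" "cbox a b \<subseteq> U"
        using open_contains_cbox[of U x] assms by metis
      then show "x \<in> \<Union>?F" by blast
    qed
  qed
  obtain F' where F': "F' \<subseteq> ?F" "countable F'" "\<Union>F' = \<Union>?F"
    using Lindelof[of ?F] by (auto simp: open_box)
  \<comment> \<open>The empty set makes the family nonempty even for \<open>U = {}\<close>, so that
    \<open>from_nat_into\<close> enumerates it; it counts as a box with reversed corners.\<close>
  define G where "G = insert {} F'"
  have G: "countable G" "G \<noteq> {}" "\<Union>G = U" using F' U by (auto simp: G_def)
  have "\<exists>a b. from_nat_into G k = box a b \<and> cbox a b \<subseteq> U" for k
  proof -
    have "from_nat_into G k \<in> G" using G by (simp add: from_nat_into)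
    moreover have "\<exists>a b. ({}::'b set) = box a b \<and> cbox a b \<subseteq> U"
    proof (intro exI conjI)
      show "{} = box One (- One :: 'b)" by (simp add: box_eq_empty(1)[THEN iffD2] nonempty_Basis ex_in_conv)
      have "cbox One (- One :: 'b) = {}" by (simp add: box_eq_empty(2) nonempty_Basis ex_in_conv)
      then show "cbox One (- One) \<subseteq> U" by simp
    qed
    ultimately show ?thesis using F'(1) unfolding G_def
      by (cases "from_nat_into (insert {} F') k = {}") auto
  qed
  then obtain a b where ab: "\<And>k. from_nat_into G k = box (a k) (b k)" "\<And>k. cbox (a k) (b k) \<subseteq> U"
    by metis
  define \<phi> where "\<phi> n x = 1 - (\<Prod>k\<le>n. 1 - box_bump (a k) (b k) n x)" for n x
  have p: "0 \<le> (\<Prod>k\<le>n. 1 - box_bump (a k) (b k) n x)" "(\<Prod>k\<le>n. 1 - box_bump (a k) (b k) n x) \<le> 1" for n x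
    by (intro prod_nonneg prod_le_1; use box_bump_bounds in force)+
  show ?thesis
  proof
    fix n show "test_fun U (\<phi> n)"
    proof (rule test_funI[where K="\<Union>k\<le>n. cbox (a k) (b k)"])
      show "smooth (\<phi> n)" unfolding \<phi>_def[abs_def]
        by (intro smooth_diff smooth_const smooth_prod box_bump_smooth) auto
      show "\<phi> n x = 0" if "x \<notin> (\<Union>k\<le>n. cbox (a k) (b k))" for x
      proof -
        have "box_bump (a k) (b k) n x = 0" if "k \<le> n" for k
          using box_subset_cbox \<open>x \<notin> _\<close> that by (intro box_bump_zero) blast
        then show ?thesis by (simp add: \<phi>_def)
      qed
    qed (use ab(2) in auto)
    fix x show "0 \<le> \<phi> n x" "\<phi> n x \<le> 1" using p[of n x] by (auto simp: \<phi>_def)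
  next
    fix x show "(\<lambda>n. \<phi> n x) \<longlonglongrightarrow> indicator U x"
    proof (cases "x \<in> U")
      case True
      then obtain k0 where k0: "x \<in> box (a k0) (b k0)"
        using G ab(1) by (metis UnionE from_nat_into_surj)
      have le: "(\<Prod>k\<le>n. 1 - box_bump (a k) (b k) n x) \<le> 1 - box_bump (a k0) (b k0) n x" if "n \<ge> k0" for n
      proof -
        have "(\<Prod>k\<le>n. 1 - box_bump (a k) (b k) n x) =
           (1 - box_bump (a k0) (b k0) n x) * (\<Prod>k\<in>{..n}-{k0}. 1 - box_bump (a k) (b k) n x)"
          using that by (subst prod.remove[of _ k0]) auto
        also have "\<dots> \<le> (1 - box_bump (a k0) (b k0) n x) * 1"
          by (intro mult_left_mono prod_le_1) (use box_bump_bounds in force)+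
        finally show ?thesis by simp
      qed
      have "(\<lambda>n. \<Prod>k\<le>n. 1 - box_bump (a k) (b k) n x) \<longlonglongrightarrow> 0"
      proof (rule tendsto_sandwich[OF _ _ tendsto_const])
        show "(\<lambda>n. 1 - box_bump (a k0) (b k0) n x) \<longlonglongrightarrow> 0"
          using tendsto_diff[OF tendsto_const box_bump_tendsto[OF k0], of 1] by simp
      qed (use p le in \<open>auto simp: eventually_sequentially\<close>)
      from tendsto_diff[OF tendsto_const this, of 1] True show ?thesis by (simp add: \<phi>_def)
    next
      case False
      then have "x \<notin> box (a k) (b k)" for k using ab(2) box_subset_cbox by blast
      then show ?thesis using False by (simp add: \<phi>_def box_bump_zero)
    qed
  qed
qed

subsection \<open>Square-integrable functions\<close>

text \<open>Square integrability over an arbitrary measure, with values in any Euclidean space, so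
  that functions and their gradients share one calculus.\<close>

definition sqi :: "'m measure \<Rightarrow> ('m \<Rightarrow> 'v::euclidean_space) \<Rightarrow> bool" where
  "sqi M f \<longleftrightarrow> f \<in> borel_measurable M \<and> integrable M (\<lambda>x. (norm (f x))\<^sup>2)"

lemma sqi_measurable[measurable_dest]: "sqi M f \<Longrightarrow> f \<in> borel_measurable M"
  by (simp add: sqi_def)

lemma sqi_inner: "sqi M f \<Longrightarrow> sqi M g \<Longrightarrow> integrable M (\<lambda>x. f x \<bullet> g x)"
proof -
  assume fg: "sqi M f" "sqi M g"
  note [measurable] = fg[THEN sqi_measurable]
  show ?thesis
  proof (rule Bochner_Integration.integrable_bound)
    show "integrable M (\<lambda>x. (norm (f x))\<^sup>2 + (norm (g x))\<^sup>2)" using fg by (auto simp: sqi_def)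
    have "\<bar>f x \<bullet> g x\<bar> \<le> (norm (f x))\<^sup>2 + (norm (g x))\<^sup>2" for x
    proof -
      have "\<bar>f x \<bullet> g x\<bar> \<le> norm (f x) * norm (g x)" by (rule Cauchy_Schwarz_ineq2)
      also have "\<dots> \<le> (norm (f x))\<^sup>2 + (norm (g x))\<^sup>2"
        using sum_squares_bound[of "norm (f x)" "norm (g x)"]
          mult_nonneg_nonneg[OF norm_ge_zero[of "f x"] norm_ge_zero[of "g x"]] by linarith
      finally show ?thesis .
    qed
    then show "AE x in M. norm (f x \<bullet> g x) \<le> norm ((norm (f x))\<^sup>2 + (norm (g x))\<^sup>2)"
      by (auto intro!: AE_I2)
  qed measurable
qed

lemma sqi_mult: "sqi M f \<Longrightarrow> sqi M g \<Longrightarrow> integrable M (\<lambda>x. f x * g x)" for f :: "_ \<Rightarrow> real"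
  using sqi_inner[of M f g] by simp

lemma sqi_power2: "sqi M f \<Longrightarrow> integrable M (\<lambda>x. (f x)\<^sup>2)" for f :: "_ \<Rightarrow> real"
  by (simp add: sqi_def)

lemma norm_add_sq: "(norm (a + b))\<^sup>2 \<le> 2 * (norm a)\<^sup>2 + 2 * (norm b)\<^sup>2" for a b :: "'v::real_inner"
proof -
  have "(norm (a + b))\<^sup>2 \<le> (norm a + norm b)\<^sup>2" by (intro power_mono norm_triangle_ineq) auto
  also have "\<dots> \<le> 2 * (norm a)\<^sup>2 + 2 * (norm b)\<^sup>2"
    using sum_squares_bound[of "norm a" "norm b"] by (simp add: power2_sum)
  finally show ?thesis .
qed

lemma sqi_add: "sqi M f \<Longrightarrow> sqi M g \<Longrightarrow> sqi M (\<lambda>x. f x + g x)"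
proof -
  assume fg: "sqi M f" "sqi M g"
  note [measurable] = fg[THEN sqi_measurable]
  have "integrable M (\<lambda>x. (norm (f x + g x))\<^sup>2)"
  proof (rule Bochner_Integration.integrable_bound)
    show "integrable M (\<lambda>x. 2 * (norm (f x))\<^sup>2 + 2 * (norm (g x))\<^sup>2)" using fg by (auto simp: sqi_def)
    show "AE x in M. norm ((norm (f x + g x))\<^sup>2) \<le> norm (2 * (norm (f x))\<^sup>2 + 2 * (norm (g x))\<^sup>2)"
      using norm_add_sq by (auto intro!: AE_I2)
  qed measurable
  then show ?thesis by (simp add: sqi_def)
qed

lemma sqi_scale:
  fixes \<zeta> :: "_ \<Rightarrow> real"
  assumes [measurable]: "\<zeta> \<in> borel_measurable M" and K: "\<And>x. \<bar>\<zeta> x\<bar> \<le> K" and f: "sqi M f"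
  shows "sqi M (\<lambda>x. \<zeta> x *\<^sub>R f x)"
proof -
  note [measurable] = f[THEN sqi_measurable]
  have "integrable M (\<lambda>x. (norm (\<zeta> x *\<^sub>R f x))\<^sup>2)"
  proof (rule Bochner_Integration.integrable_bound)
    show "integrable M (\<lambda>x. K\<^sup>2 * (norm (f x))\<^sup>2)" using f by (auto simp: sqi_def)
    have "(norm (\<zeta> x *\<^sub>R f x))\<^sup>2 \<le> K\<^sup>2 * (norm (f x))\<^sup>2" for x
      using K[of x] by (simp add: power_mult_distrib mult_right_mono abs_le_square_iff[symmetric])
    then show "AE x in M. norm ((norm (\<zeta> x *\<^sub>R f x))\<^sup>2) \<le> norm (K\<^sup>2 * (norm (f x))\<^sup>2)"
      by (auto intro!: AE_I2)
  qed measurable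
  then show ?thesis by (simp add: sqi_def)
qed

lemma sqi_vec:
  fixes u :: "_ \<Rightarrow> real" and v :: "_ \<Rightarrow> 'v::euclidean_space"
  assumes [measurable]: "v \<in> borel_measurable M" and K: "\<And>x. norm (v x) \<le> K" and u: "sqi M u"
  shows "sqi M (\<lambda>x. u x *\<^sub>R v x)"
proof -
  note [measurable] = u[THEN sqi_measurable]
  have "integrable M (\<lambda>x. (norm (u x *\<^sub>R v x))\<^sup>2)"
  proof (rule Bochner_Integration.integrable_bound)
    show "integrable M (\<lambda>x. K\<^sup>2 * (u x)\<^sup>2)" using u by (auto simp: sqi_def)
    have "(norm (u x *\<^sub>R v x))\<^sup>2 \<le> K\<^sup>2 * (u x)\<^sup>2" for x
      using mult_left_mono[OF power_mono[OF K[of x], of 2], of "(u x)\<^sup>2"]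
      by (simp add: power_mult_distrib mult.commute)
    then show "AE x in M. norm ((norm (u x *\<^sub>R v x))\<^sup>2) \<le> norm (K\<^sup>2 * (u x)\<^sup>2)"
      by (auto intro!: AE_I2)
  qed measurable
  then show ?thesis by (simp add: sqi_def)
qed

lemma sqi_const_scale: "sqi M f \<Longrightarrow> sqi M (\<lambda>x. c *\<^sub>R f x)"
  using sqi_scale[of "\<lambda>_. c" M "\<bar>c\<bar>" f] by simp

lemma sqi_cmult: "sqi M f \<Longrightarrow> sqi M (\<lambda>x. c * f x)" for f :: "_ \<Rightarrow> real"
  using sqi_const_scale[of M f c] by simp

lemma sqi_diff: "sqi M f \<Longrightarrow> sqi M g \<Longrightarrow> sqi M (\<lambda>x. f x - g x)"
  using sqi_add[of M f "\<lambda>x. (-1) *\<^sub>R g x"] sqi_const_scale[of M g "-1"] by simp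

lemma sqi_zero: "sqi M (\<lambda>x. 0)" by (simp add: sqi_def)

lemma sqi_sum: "finite I \<Longrightarrow> (\<And>i. i \<in> I \<Longrightarrow> sqi M (f i)) \<Longrightarrow> sqi M (\<lambda>x. \<Sum>i\<in>I. f i x)"
  by (induction I rule: finite_induct) (auto intro: sqi_zero sqi_add)

text \<open>The integral of \<open>(norm (t *\<^sub>R f x + g x))\<^sup>2\<close> is a nonnegative
  quadratic polynomial in \<open>t\<close>; its value at the minimiser \<open>t = - (C / A)\<close>
  gives the claim. For \<open>A = 0\<close> the function \<open>f\<close> vanishes almost
  everywhere.\<close>

lemma Cauchy_Schwarz_integral:
  assumes f: "sqi M f" and g: "sqi M g"
  shows "(\<integral>x. f x \<bullet> g x \<partial>M)\<^sup>2 \<le> (\<integral>x. (norm (f x))\<^sup>2 \<partial>M) * (\<integral>x. (norm (g x))\<^sup>2 \<partial>M)"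
proof -
  define A B C where "A = (\<integral>x. (norm (f x))\<^sup>2 \<partial>M)" "B = (\<integral>x. (norm (g x))\<^sup>2 \<partial>M)" "C = (\<integral>x. f x \<bullet> g x \<partial>M)"
  note [measurable] = f[THEN sqi_measurable] g[THEN sqi_measurable]
  have q: "0 \<le> t\<^sup>2 * A + 2 * t * C + B" for t
  proof -
    have "0 \<le> (\<integral>x. (norm (t *\<^sub>R f x + g x))\<^sup>2 \<partial>M)" by (intro Bochner_Integration.integral_nonneg) auto
    also have "\<dots> = (\<integral>x. t\<^sup>2 * (norm (f x))\<^sup>2 + 2 * t * (f x \<bullet> g x) + (norm (g x))\<^sup>2 \<partial>M)"
    proof (intro Bochner_Integration.integral_cong refl)
      fix x
      have "(norm (t *\<^sub>R f x + g x))\<^sup>2 = t * (t * (f x \<bullet> f x)) + 2 * t * (f x \<bullet> g x) + g x \<bullet> g x"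
        unfolding power2_norm_eq_inner by (simp add: inner_add_left inner_add_right inner_commute[of "g _" "f _"] distrib_left)
      then show "(norm (t *\<^sub>R f x + g x))\<^sup>2 = t\<^sup>2 * (norm (f x))\<^sup>2 + 2 * t * (f x \<bullet> g x) + (norm (g x))\<^sup>2"
        by (simp add: power2_eq_square dot_square_norm)
    qed
    also have "\<dots> = t\<^sup>2 * A + 2 * t * C + B"
      using f g sqi_inner[OF f g] by (simp add: A_B_C_def sqi_def)
    finally show ?thesis .
  qed
  have A0: "A \<ge> 0" unfolding A_B_C_def by (intro Bochner_Integration.integral_nonneg) auto
  have "C\<^sup>2 \<le> A * B"
  proof (cases "A = 0")
    case True
    then have "AE x in M. (norm (f x))\<^sup>2 = 0"
      using f unfolding A_B_C_def by (subst (asm) integral_nonneg_eq_0_iff_AE) (auto simp: sqi_def)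
    then have "C = (\<integral>x. 0 \<partial>M)" unfolding A_B_C_def by (intro integral_cong_AE) auto
    then show ?thesis using True by simp
  next
    case False
    then have A: "A > 0" using A0 by simp
    have "0 \<le> A * ((C / A)\<^sup>2 * A + 2 * (- (C / A)) * C + B)"
      using q[of "- (C / A)"] A by (intro mult_nonneg_nonneg) auto
    also have "\<dots> = A * B - C\<^sup>2" using A by (simp add: field_simps power2_eq_square)
    finally show ?thesis by simp
  qed
  then show ?thesis by (simp add: A_B_C_def)
qed

section \<open>Convergence in L2\<close>

definition L2conv :: "'m measure \<Rightarrow> (nat \<Rightarrow> 'm \<Rightarrow> 'v::euclidean_space) \<Rightarrow> ('m \<Rightarrow> 'v) \<Rightarrow> bool" where
  "L2conv M fs f \<longleftrightarrow> (\<forall>n. sqi M (fs n)) \<and> sqi M f \<and> (\<lambda>n. \<integral>x. (norm (fs n x - f x))\<^sup>2 \<partial>M) \<longlonglongrightarrow> 0"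

lemma L2conv_sqi: "L2conv M fs f \<Longrightarrow> sqi M (fs n)" "L2conv M fs f \<Longrightarrow> sqi M f"
  by (auto simp: L2conv_def)

lemma L2conv_const: "sqi M f \<Longrightarrow> L2conv M (\<lambda>n. f) f"
  by (simp add: L2conv_def)

lemma L2conv_add:
  assumes f: "L2conv M fs f" and g: "L2conv M gs g"
  shows "L2conv M (\<lambda>n x. fs n x + gs n x) (\<lambda>x. f x + g x)"
proof -
  note s = L2conv_sqi[OF f] L2conv_sqi[OF g]
  have "(\<lambda>n. \<integral>x. (norm (fs n x + gs n x - (f x + g x)))\<^sup>2 \<partial>M) \<longlonglongrightarrow> 0"
  proof (rule tendsto_sandwich[OF _ _ tendsto_const])
    show "(\<lambda>n. 2 * (\<integral>x. (norm (fs n x - f x))\<^sup>2 \<partial>M) + 2 * (\<integral>x. (norm (gs n x - g x))\<^sup>2 \<partial>M)) \<longlonglongrightarrow> 0"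
      using f g by (auto simp: L2conv_def intro!: tendsto_eq_intros)
    show "\<forall>\<^sub>F n in sequentially. 0 \<le> (\<integral>x. (norm (fs n x + gs n x - (f x + g x)))\<^sup>2 \<partial>M)"
      by (intro always_eventually allI Bochner_Integration.integral_nonneg) auto
    have "(\<integral>x. (norm (fs n x + gs n x - (f x + g x)))\<^sup>2 \<partial>M) \<le>
      (\<integral>x. 2 * (norm (fs n x - f x))\<^sup>2 + 2 * (norm (gs n x - g x))\<^sup>2 \<partial>M)" for n
      using sqi_diff[OF sqi_add sqi_add, OF s(1,3) s(2,4), of n n] sqi_diff[OF s(1,2), of n] sqi_diff[OF s(3,4), of n]
        norm_add_sq[of "fs n x - f x" "gs n x - g x" for x]
      by (intro integral_mono) (auto simp: sqi_def add_diff_add)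
    also have "(\<integral>x. 2 * (norm (fs n x - f x))\<^sup>2 + 2 * (norm (gs n x - g x))\<^sup>2 \<partial>M) =
      2 * (\<integral>x. (norm (fs n x - f x))\<^sup>2 \<partial>M) + 2 * (\<integral>x. (norm (gs n x - g x))\<^sup>2 \<partial>M)" for n
      using sqi_diff[OF s(1,2), of n] sqi_diff[OF s(3,4), of n] by (simp add: sqi_def)
    finally show "\<forall>\<^sub>F n in sequentially. (\<integral>x. (norm (fs n x + gs n x - (f x + g x)))\<^sup>2 \<partial>M)
       \<le> 2 * (\<integral>x. (norm (fs n x - f x))\<^sup>2 \<partial>M) + 2 * (\<integral>x. (norm (gs n x - g x))\<^sup>2 \<partial>M)"
      by (intro always_eventually allI)
  qed
  then show ?thesis using s by (auto simp: L2conv_def intro: sqi_add)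
qed

text \<open>Source of the stability under multiplication by bounded factors and under taking
  components: a pointwise Lipschitz relation between the differences carries over to the L2
  distances.\<close>

lemma L2conv_bound:
  assumes f: "L2conv M fs f" and g: "\<And>n. sqi M (gs n)" "sqi M g"
    and le: "\<And>n x. norm (gs n x - g x) \<le> K * norm (fs n x - f x)"
  shows "L2conv M gs g"
proof -
  note s = L2conv_sqi[OF f]
  have "(\<lambda>n. \<integral>x. (norm (gs n x - g x))\<^sup>2 \<partial>M) \<longlonglongrightarrow> 0"
  proof (rule tendsto_sandwich[OF _ _ tendsto_const])
    show "(\<lambda>n. K\<^sup>2 * (\<integral>x. (norm (fs n x - f x))\<^sup>2 \<partial>M)) \<longlonglongrightarrow> 0"
      using f by (auto simp: L2conv_def intro!: tendsto_eq_intros)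
    show "\<forall>\<^sub>F n in sequentially. 0 \<le> (\<integral>x. (norm (gs n x - g x))\<^sup>2 \<partial>M)"
      by (intro always_eventually allI Bochner_Integration.integral_nonneg) auto
    have "(\<integral>x. (norm (gs n x - g x))\<^sup>2 \<partial>M) \<le> (\<integral>x. K\<^sup>2 * (norm (fs n x - f x))\<^sup>2 \<partial>M)" for n
      using sqi_diff[OF g(1,2), of n] sqi_diff[OF s(1,2), of n] power_mono[OF le, of n _ 2]
      by (intro integral_mono) (auto simp: sqi_def power_mult_distrib)
    then show "\<forall>\<^sub>F n in sequentially. (\<integral>x. (norm (gs n x - g x))\<^sup>2 \<partial>M)
       \<le> K\<^sup>2 * (\<integral>x. (norm (fs n x - f x))\<^sup>2 \<partial>M)"
      by (intro always_eventually allI) simp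
  qed
  then show ?thesis using g by (auto simp: L2conv_def)
qed

lemma L2conv_scale:
  fixes \<zeta> :: "_ \<Rightarrow> real"
  assumes m: "\<zeta> \<in> borel_measurable M" and K: "\<And>x. \<bar>\<zeta> x\<bar> \<le> K" and f: "L2conv M fs f"
  shows "L2conv M (\<lambda>n x. \<zeta> x *\<^sub>R fs n x) (\<lambda>x. \<zeta> x *\<^sub>R f x)"
proof (rule L2conv_bound[OF f, where K=K])
  show "norm (\<zeta> x *\<^sub>R fs n x - \<zeta> x *\<^sub>R f x) \<le> K * norm (fs n x - f x)" for n x
    unfolding scaleR_diff_right[symmetric] norm_scaleR using K[of x] by (intro mult_right_mono) auto
qed (intro sqi_scale[OF m K] L2conv_sqi[OF f])+

lemma L2conv_mult:
  fixes \<zeta> :: "_ \<Rightarrow> real"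
  assumes m: "\<zeta> \<in> borel_measurable M" and K: "\<And>x. \<bar>\<zeta> x\<bar> \<le> K" and f: "L2conv M fs f"
  shows "L2conv M (\<lambda>n x. \<zeta> x * fs n x) (\<lambda>x. \<zeta> x * f x)"
  using L2conv_scale[OF assms] by simp

lemma L2conv_vec:
  fixes us :: "nat \<Rightarrow> _ \<Rightarrow> real" and v :: "_ \<Rightarrow> 'v::euclidean_space"
  assumes m: "v \<in> borel_measurable M" and K: "\<And>x. norm (v x) \<le> K" and f: "L2conv M us u"
  shows "L2conv M (\<lambda>n x. us n x *\<^sub>R v x) (\<lambda>x. u x *\<^sub>R v x)"
proof (rule L2conv_bound[OF f, where K=K])
  show "norm (us n x *\<^sub>R v x - u x *\<^sub>R v x) \<le> K * norm (us n x - u x)" for n x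
    unfolding scaleR_diff_left[symmetric] norm_scaleR using mult_right_mono[OF K[of x], of "\<bar>us n x - u x\<bar>"]
    by (simp add: mult.commute)
qed (intro sqi_vec[OF m K] L2conv_sqi[OF f])+

lemma L2conv_sum:
  "finite I \<Longrightarrow> (\<And>i. i \<in> I \<Longrightarrow> L2conv M (\<lambda>n. fs n i) (f i)) \<Longrightarrow>
    L2conv M (\<lambda>n x. \<Sum>i\<in>I. fs n i x) (\<lambda>x. \<Sum>i\<in>I. f i x)"
  by (induction I rule: finite_induct) (auto intro: L2conv_const sqi_zero L2conv_add)

text \<open>The difference of the inner products splits into three products, each with a factor that
  tends to 0 in L2; the Cauchy-Schwarz inequality handles all three.\<close>

lemma L2conv_inner:
  assumes f: "L2conv M fs f" and g: "L2conv M gs g"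
  shows "(\<lambda>n. \<integral>x. fs n x \<bullet> gs n x \<partial>M) \<longlonglongrightarrow> (\<integral>x. f x \<bullet> g x \<partial>M)"
proof -
  note s = L2conv_sqi[OF f] L2conv_sqi[OF g]
  have z: "(\<lambda>n. \<integral>x. a n x \<bullet> b n x \<partial>M) \<longlonglongrightarrow> 0"
    if a: "\<And>n. sqi M (a n)" "\<And>n. sqi M (b n)" and "(\<lambda>n. (\<integral>x. (norm (a n x))\<^sup>2 \<partial>M) * (\<integral>x. (norm (b n x))\<^sup>2 \<partial>M)) \<longlonglongrightarrow> 0"
    for a b :: "nat \<Rightarrow> 'a \<Rightarrow> 'b"
  proof -
    have "(\<lambda>n. (\<integral>x. a n x \<bullet> b n x \<partial>M)\<^sup>2) \<longlonglongrightarrow> 0"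
      by (rule tendsto_sandwich[OF _ _ tendsto_const that(3)])
         (auto intro!: always_eventually Cauchy_Schwarz_integral a)
    then have "(\<lambda>n. sqrt ((\<integral>x. a n x \<bullet> b n x \<partial>M)\<^sup>2)) \<longlonglongrightarrow> sqrt 0"
      by (rule tendsto_real_sqrt)
    then show ?thesis using tendsto_rabs_zero_iff by auto
  qed
  have c: "(\<lambda>n. \<integral>x. (norm (fs n x - f x))\<^sup>2 \<partial>M) \<longlonglongrightarrow> 0" "(\<lambda>n. \<integral>x. (norm (gs n x - g x))\<^sup>2 \<partial>M) \<longlonglongrightarrow> 0"
    using f g by (auto simp: L2conv_def)
  have 1: "(\<lambda>n. \<integral>x. (fs n x - f x) \<bullet> (gs n x - g x) \<partial>M) \<longlonglongrightarrow> 0"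
    by (intro z sqi_diff s) (use tendsto_mult[OF c] in simp)
  have 2: "(\<lambda>n. \<integral>x. (fs n x - f x) \<bullet> g x \<partial>M) \<longlonglongrightarrow> 0"
    by (intro z sqi_diff s) (use tendsto_mult[OF c(1) tendsto_const] in simp)
  have 3: "(\<lambda>n. \<integral>x. f x \<bullet> (gs n x - g x) \<partial>M) \<longlonglongrightarrow> 0"
    by (intro z sqi_diff s) (use tendsto_mult[OF tendsto_const c(2)] in simp)
  have "(\<integral>x. fs n x \<bullet> gs n x \<partial>M) = (\<integral>x. (fs n x - f x) \<bullet> (gs n x - g x) \<partial>M)
     + (\<integral>x. (fs n x - f x) \<bullet> g x \<partial>M) + (\<integral>x. f x \<bullet> (gs n x - g x) \<partial>M) + (\<integral>x. f x \<bullet> g x \<partial>M)" for n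
  proof -
    note i = sqi_inner[OF sqi_diff[OF s(1,2)] sqi_diff[OF s(3,4)], of n n] sqi_inner[OF sqi_diff[OF s(1,2)] s(4), of n]
      sqi_inner[OF s(2) sqi_diff[OF s(3,4)], of n] sqi_inner[OF s(2,4)]
    show ?thesis
      by (subst Bochner_Integration.integral_add[symmetric]; (intro Bochner_Integration.integrable_add i)?)+
         (auto intro!: Bochner_Integration.integral_cong simp: inner_diff_left inner_diff_right)
  qed
  then show ?thesis
    using tendsto_add[OF tendsto_add[OF tendsto_add[OF 1 2] 3] tendsto_const, of "\<integral>x. f x \<bullet> g x \<partial>M"] by simp
qed

lemma L2conv_integral_mult:
  fixes f :: "_ \<Rightarrow> real"
  assumes f: "L2conv M fs f" and g: "L2conv M gs g"
  shows "(\<lambda>n. \<integral>x. fs n x * gs n x \<partial>M) \<longlonglongrightarrow> (\<integral>x. f x * g x \<partial>M)"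
  using L2conv_inner[OF assms] by simp

lemma L2conv_norm:
  assumes f: "L2conv M fs f"
  shows "(\<lambda>n. \<integral>x. (norm (fs n x))\<^sup>2 \<partial>M) \<longlonglongrightarrow> (\<integral>x. (norm (f x))\<^sup>2 \<partial>M)"
  using L2conv_inner[OF f f] by (simp add: power2_norm_eq_inner)

lemma L2conv_power2:
  fixes f :: "_ \<Rightarrow> real"
  assumes f: "L2conv M fs f"
  shows "(\<lambda>n. \<integral>x. (fs n x)\<^sup>2 \<partial>M) \<longlonglongrightarrow> (\<integral>x. (f x)\<^sup>2 \<partial>M)"
  using L2conv_norm[OF f] by simp

subsection \<open>Functions vanishing outside a compact set\<close>

lemma continuous_compact_support_bounded:
  fixes f :: "'b::euclidean_space \<Rightarrow> 'v::euclidean_space"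
  assumes "continuous_on UNIV f" "compact K" "\<And>x. x \<notin> K \<Longrightarrow> f x = 0"
  obtains C where "C > 0" "\<And>x. norm (f x) \<le> C"
proof -
  have "bounded (f ` K)"
    by (intro compact_imp_bounded compact_continuous_image continuous_on_subset[OF assms(1)] assms) auto
  then obtain C where "C > 0" "\<And>x. x \<in> K \<Longrightarrow> norm (f x) \<le> C" unfolding bounded_pos by auto
  then show ?thesis using assms(3) that[of C] by (metis norm_zero less_imp_le)
qed

lemma integrable_compact_support:
  fixes f :: "'b::euclidean_space \<Rightarrow> 'v::euclidean_space"
  assumes "continuous_on UNIV f" "compact K" "\<And>x. x \<notin> K \<Longrightarrow> f x = 0"
  shows "integrable lborel f" "A \<in> sets lebesgue \<Longrightarrow> integrable (lebesgue_on A) f"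
proof -
  have eq: "(\<lambda>x. indicator K x *\<^sub>R f x) = f" using assms(3) by (auto simp: indicator_def)
  have "integrable lborel (\<lambda>x. indicator K x *\<^sub>R f x)"
    by (rule borel_integrable_compact[OF assms(2)]) (rule continuous_on_subset[OF assms(1)], auto)
  then show 1: "integrable lborel f" unfolding eq .
  then have "integrable lebesgue f" using integrable_completion borel_measurable_integrable by blast
  then show "integrable (lebesgue_on A) f" if "A \<in> sets lebesgue"
    using that integrable_mult_indicator[OF that] by (simp add: integrable_restrict_space)
qed

lemma sqi_compact_support:
  fixes f :: "'b::euclidean_space \<Rightarrow> 'v::euclidean_space"
  assumes "continuous_on UNIV f" "compact K" "\<And>x. x \<notin> K \<Longrightarrow> f x = 0" and A: "A \<in> sets lebesgue"
  shows "sqi (lebesgue_on A) f"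
proof -
  have "integrable (lebesgue_on A) (\<lambda>x. (norm (f x))\<^sup>2)"
  proof -
    have "continuous_on UNIV (\<lambda>x. (norm (f x))\<^sup>2)" by (intro continuous_intros assms(1))
    then show ?thesis using integrable_compact_support(2)[of "\<lambda>x. (norm (f x))\<^sup>2" K A] assms by auto
  qed
  moreover have "f \<in> borel_measurable (lebesgue_on A)"
    using assms(1) by (intro measurable_restrict_space1 measurable_completion) (simp add: borel_measurable_continuous_onI)
  ultimately show ?thesis by (simp add: sqi_def)
qed

lemma test_fun_sqi:
  assumes "test_fun B \<phi>" "A \<in> sets lebesgue"
  shows "sqi (lebesgue_on A) \<phi>" "sqi (lebesgue_on A) (grad \<phi>)"
proof -
  obtain K where K: "compact K" "\<And>x. x \<notin> K \<Longrightarrow> \<phi> x = 0" "\<And>x. x \<notin> K \<Longrightarrow> grad \<phi> x = 0"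
    using test_funE[OF assms(1)] by metis
  show "sqi (lebesgue_on A) \<phi>" "sqi (lebesgue_on A) (grad \<phi>)"
    using K assms by (auto intro!: sqi_compact_support smooth_continuous continuous_grad test_fun_smooth)
qed

lemma integral_lebesgue_on_eq_lborel:
  fixes f :: "'b::euclidean_space \<Rightarrow> real"
  assumes "f \<in> borel_measurable borel" "\<And>x. x \<notin> A \<Longrightarrow> f x = 0" "A \<in> sets lebesgue"
  shows "(\<integral>x. f x \<partial>lebesgue_on A) = (\<integral>x. f x \<partial>lborel)"
proof -
  have "(\<integral>x. f x \<partial>lebesgue_on A) = (\<integral>x. indicator A x *\<^sub>R f x \<partial>lebesgue)"
    using assms(3) by (simp add: integral_restrict_space)
  also have "(\<lambda>x. indicator A x *\<^sub>R f x) = f"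
  proof
    show "indicator A x *\<^sub>R f x = f x" for x using assms(2)[of x] by (cases "x \<in> A") auto
  qed
  also have "(\<integral>x. f x \<partial>lebesgue) = (\<integral>x. f x \<partial>lborel)" using assms(1) by (intro integral_completion) simp
  finally show ?thesis .
qed

lemma lborel_integral_translate:
  fixes f :: "'b::euclidean_space \<Rightarrow> real"
  assumes "f \<in> borel_measurable borel"
  shows "(\<integral>x. f (x + c) \<partial>lborel) = (\<integral>x. f x \<partial>lborel)"
proof -
  have "(\<integral>x. f x \<partial>lborel) = (\<integral>x. f x \<partial>distr lborel borel ((+) c))" by (simp add: lborel_distr_plus)
  also have "\<dots> = (\<integral>x. f (c + x) \<partial>lborel)" using assms by (subst integral_distr) auto
  finally show ?thesis by (simp add: add.commute)
qed

text \<open>Every difference quotient of \<open>F\<close> has integral 0 by translation invariance,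
  and the quotients converge under a common integrable bound. All integrations by parts rest on
  this.\<close>

lemma integral_frechet_derivative_test_fun:
  fixes F :: "'b::euclidean_space \<Rightarrow> real"
  assumes F: "test_fun A F"
  shows "(\<integral>x. frechet_derivative F (at x) b \<partial>lborel) = 0"
proof -
  obtain K where K: "compact K" "\<And>x. x \<notin> K \<Longrightarrow> F x = 0" "\<And>x. x \<notin> K \<Longrightarrow> grad F x = 0"
    using test_funE[OF F] by metis
  have sm: "smooth F" using F by (rule test_fun_smooth)
  have cF: "continuous_on UNIV F" by (rule smooth_continuous[OF sm])
  then have [measurable]: "F \<in> borel_measurable borel" by (rule borel_measurable_continuous_onI)
  obtain C where C: "C > 0" "\<And>x. norm (grad F x) \<le> C"
    using continuous_compact_support_bounded[OF continuous_grad[OF sm] K(1,3)] by metis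
  obtain r where r: "r > 0" "\<And>x. x \<in> K \<Longrightarrow> norm x \<le> r"
    using compact_imp_bounded[OF K(1)] unfolding bounded_pos by auto
  define h where "h n = 1 / real (Suc n)" for n
  have h: "h n > 0" "h n \<le> 1" for n by (auto simp: h_def)
  have lim: "h \<longlonglongrightarrow> 0" unfolding h_def using LIMSEQ_inverse_real_of_nat by (simp add: inverse_eq_divide)
  define S where "S n x = (F (x + h n *\<^sub>R b) - F x) / h n" for n x
  have [measurable]: "S n \<in> borel_measurable borel" for n unfolding S_def[abs_def] by measurable
  have iF: "integrable lborel F" by (rule integrable_compact_support[OF cF K(1,2)])
  have iF2: "integrable lborel (\<lambda>x. F (x + h n *\<^sub>R b))" for n
  proof (rule integrable_compact_support(1)[where K="(\<lambda>x. x - h n *\<^sub>R b) ` K"])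
    show "compact ((\<lambda>x. x - h n *\<^sub>R b) ` K)" using K(1) by (intro compact_continuous_image continuous_intros)
    show "continuous_on UNIV (\<lambda>x. F (x + h n *\<^sub>R b))"
      by (rule continuous_on_compose2[OF cF]) (auto intro!: continuous_intros)
    fix x assume "x \<notin> (\<lambda>x. x - h n *\<^sub>R b) ` K"
    then have "x + h n *\<^sub>R b \<notin> K" by (metis add_diff_cancel_right' imageI)
    then show "F (x + h n *\<^sub>R b) = 0" by (rule K(2))
  qed
  have zero: "(\<integral>x. S n x \<partial>lborel) = 0" for n
    unfolding S_def using iF iF2[of n] by (simp add: lborel_integral_translate)
  have Lip: "\<bar>F (x + v) - F x\<bar> \<le> C * norm v" for x v
  proof -
    have "norm (F (x + v) - F x) \<le> C * norm ((x + v) - x)"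
    proof (rule differentiable_bound[of UNIV F "\<lambda>x h. grad F x \<bullet> h"])
      show "(F has_derivative (\<lambda>h. grad F y \<bullet> h)) (at y within UNIV)" for y
        using has_derivative_grad[OF smooth_differentiable[OF sm]] by simp
      show "onorm (\<lambda>h. grad F y \<bullet> h) \<le> C" for y
      proof (rule onorm_le)
        show "norm (grad F y \<bullet> v) \<le> C * norm v" for v
          using Cauchy_Schwarz_ineq2[of "grad F y" v] mult_right_mono[OF C(2)[of y], of "norm v"] by simp
      qed
    qed auto
    then show ?thesis by simp
  qed
  \<comment> \<open>For the dominating function, \<open>C * norm b\<close> bounds the quotients by
    the mean value inequality, and since the steps \<open>h n\<close> are at most 1 the shifted
    supports stay in the ball of radius \<open>r + norm b\<close>.\<close>
  have "(\<lambda>n. \<integral>x. S n x \<partial>lborel) \<longlonglongrightarrow> (\<integral>x. frechet_derivative F (at x) b \<partial>lborel)"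
  proof (rule integral_dominated_convergence[where w="\<lambda>x. (C * norm b) * indicator (cball 0 (r + norm b)) x"])
    show "(\<lambda>x. frechet_derivative F (at x) b) \<in> borel_measurable lborel"
      unfolding frechet_eq_grad[OF smooth_differentiable[OF sm]]
      using continuous_grad[OF sm, of UNIV, THEN borel_measurable_continuous_onI] by measurable
    show "integrable lborel (\<lambda>x::'b. (C * norm b) * indicator (cball 0 (r + norm b)) x)"
      by (intro integrable_mult_right integrable_real_indicator) (use emeasure_lborel_cball_finite in \<open>auto simp: infinity_ennreal_def[symmetric] simp del: infinity_ennreal_def\<close>)
    show "AE x in lborel. (\<lambda>n. S n x) \<longlonglongrightarrow> frechet_derivative F (at x) b"
    proof (rule AE_I2)
      fix x
      have "((\<lambda>s. F (x + s *\<^sub>R b)) has_derivative (\<lambda>s. grad F x \<bullet> (s *\<^sub>R b))) (at 0)"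
        by (rule has_derivative_compose[of "\<lambda>s. x + s *\<^sub>R b" _ _ _ F])
           (auto intro!: derivative_eq_intros has_derivative_grad[OF smooth_differentiable[OF sm]])
      then have "((\<lambda>s. F (x + s *\<^sub>R b)) has_real_derivative (grad F x \<bullet> b)) (at 0)"
        by (simp add: has_field_derivative_def mult.commute[of _ "grad F x \<bullet> b"])
      then have "((\<lambda>s. (F (x + s *\<^sub>R b) - F x) / s) \<longlongrightarrow> grad F x \<bullet> b) (at 0)"
        by (simp add: has_field_derivative_iff)
      then have "(\<lambda>n. S n x) \<longlonglongrightarrow> grad F x \<bullet> b"
        unfolding S_def by (rule filterlim_compose)
           (use lim h(1) in \<open>auto simp: filterlim_at less_imp_neq[symmetric] intro!: always_eventually\<close>)
      then show "(\<lambda>n. S n x) \<longlonglongrightarrow> frechet_derivative F (at x) b"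
        by (simp add: frechet_eq_grad[OF smooth_differentiable[OF sm]])
    qed
    show "AE x in lborel. norm (S n x) \<le> (C * norm b) * indicator (cball 0 (r + norm b)) x" for n
    proof (rule AE_I2)
      fix x
      show "norm (S n x) \<le> (C * norm b) * indicator (cball 0 (r + norm b)) x"
      proof (cases "x \<in> cball 0 (r + norm b)")
        case True
        have "\<bar>F (x + h n *\<^sub>R b) - F x\<bar> \<le> (C * norm b) * h n" using Lip[of x "h n *\<^sub>R b"] h[of n] by (simp add: mult_ac)
        then show ?thesis using True h[of n] by (simp add: S_def field_simps)
      next
        case False
        then have n: "norm x > r + norm b" by simp
        then have 1: "F x = 0" using r(2)[of x] norm_ge_zero[of b] K(2)[of x] by force
        have "norm (h n *\<^sub>R b) \<le> norm b" using h[of n] mult_right_mono[of "h n" 1 "norm b"] by simp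
        then have "norm (x + h n *\<^sub>R b) > r" using n norm_diff_ineq[of x "h n *\<^sub>R b"] by linarith
        then have "F (x + h n *\<^sub>R b) = 0" using r(2) K(2) by force
        then show ?thesis using False 1 by (simp add: S_def)
      qed
    qed
  qed measurable
  then show ?thesis by (simp add: zero LIMSEQ_const_iff)
qed

subsection \<open>Weak gradients\<close>

lemma L2_iff_sqi: "A \<in> sets lebesgue \<Longrightarrow> L2 A u \<longleftrightarrow> sqi (lebesgue_on A) u"
  unfolding L2_def sqi_def set_integrable_def
  by (auto simp: borel_measurable_restrict_space_iff integrable_restrict_space mult.commute)

lemma L2v_iff_sqi: "A \<in> sets lebesgue \<Longrightarrow> L2v A g \<longleftrightarrow> sqi (lebesgue_on A) g"
  unfolding L2v_def sqi_def set_integrable_def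
  by (auto simp: borel_measurable_restrict_space_iff integrable_restrict_space)

lemma LINT_lebesgue_on:
  fixes f :: "_ \<Rightarrow> real"
  shows "A \<in> sets lebesgue \<Longrightarrow> (LINT x:A|lebesgue. f x) = (\<integral>x. f x \<partial>lebesgue_on A)"
  unfolding set_lebesgue_integral_def by (simp add: integral_restrict_space)

lemma weak_grad_iff:
  assumes A: "A \<in> sets lebesgue"
  shows "weak_grad A u g \<longleftrightarrow> sqi (lebesgue_on A) u \<and> sqi (lebesgue_on A) g \<and>
     (\<forall>\<phi>. test_fun A \<phi> \<longrightarrow> (\<forall>b\<in>Basis.
        (\<integral>x. u x * frechet_derivative \<phi> (at x) b \<partial>lebesgue_on A) = - (\<integral>x. (g x \<bullet> b) * \<phi> x \<partial>lebesgue_on A)))"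
  unfolding weak_grad_def using A by (simp add: L2_iff_sqi L2v_iff_sqi LINT_lebesgue_on)

lemma test_fun_by_parts:
  fixes \<phi> \<psi> :: "'b::euclidean_space \<Rightarrow> real"
  assumes p: "test_fun A \<phi>" "test_fun A \<psi>" and A: "A \<in> sets lebesgue"
  shows "(\<integral>x. \<phi> x * frechet_derivative \<psi> (at x) b \<partial>lebesgue_on A) = - (\<integral>x. (grad \<phi> x \<bullet> b) * \<psi> x \<partial>lebesgue_on A)"
proof -
  note sm = p[THEN test_fun_smooth]
  have [measurable]: "\<phi> \<in> borel_measurable borel" "\<psi> \<in> borel_measurable borel"
    "grad \<phi> \<in> borel_measurable borel" "grad \<psi> \<in> borel_measurable borel"
    using sm by (auto intro!: borel_measurable_continuous_onI smooth_continuous continuous_grad)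
  obtain K where K: "compact K" "K \<subseteq> A" "\<And>x. x \<notin> K \<Longrightarrow> \<phi> x = 0" "\<And>x. x \<notin> K \<Longrightarrow> grad \<phi> x = 0"
    using test_funE[OF p(1)] by metis
  have eq: "frechet_derivative f (at x) b = grad f x \<bullet> b" if "smooth f" for f x
    by (rule frechet_eq_grad[OF smooth_differentiable[OF that]])
  have "0 = (\<integral>x. frechet_derivative (\<lambda>x. \<phi> x * \<psi> x) (at x) b \<partial>lborel)"
    using integral_frechet_derivative_test_fun[OF test_fun_mult_smooth[OF p(2) sm(1)]] by simp
  also have "\<dots> = (\<integral>x. \<phi> x * (grad \<psi> x \<bullet> b) + (grad \<phi> x \<bullet> b) * \<psi> x \<partial>lborel)"
    by (intro Bochner_Integration.integral_cong refl)
       (simp add: eq[OF smooth_mult[OF sm]] grad_mult[OF sm[THEN smooth_differentiable]] inner_add_left)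
  also have "\<dots> = (\<integral>x. \<phi> x * (grad \<psi> x \<bullet> b) \<partial>lborel) + (\<integral>x. (grad \<phi> x \<bullet> b) * \<psi> x \<partial>lborel)"
    by (intro Bochner_Integration.integral_add integrable_compact_support[OF _ K(1)] continuous_intros
         smooth_continuous continuous_grad sm) (auto simp: K)
  also have "(\<integral>x. \<phi> x * (grad \<psi> x \<bullet> b) \<partial>lborel) = (\<integral>x. \<phi> x * (grad \<psi> x \<bullet> b) \<partial>lebesgue_on A)"
    using K(2,3) A by (intro integral_lebesgue_on_eq_lborel[symmetric]) auto
  also have "(\<integral>x. (grad \<phi> x \<bullet> b) * \<psi> x \<partial>lborel) = (\<integral>x. (grad \<phi> x \<bullet> b) * \<psi> x \<partial>lebesgue_on A)"
  proof (intro integral_lebesgue_on_eq_lborel[symmetric] A)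
    show "(grad \<phi> x \<bullet> b) * \<psi> x = 0" if "x \<notin> A" for x
    proof -
      have "grad \<phi> x = 0" using K(4)[of x] K(2) that by blast
      then show ?thesis by simp
    qed
  qed measurable
  finally show ?thesis by (simp add: eq[OF sm(2)])
qed

lemma sqi_inner_const: "sqi M g \<Longrightarrow> sqi M (\<lambda>x. g x \<bullet> b)"
proof -
  assume g: "sqi M g"
  note [measurable] = sqi_measurable[OF g]
  have "integrable M (\<lambda>x. (norm (g x \<bullet> b))\<^sup>2)"
  proof (rule Bochner_Integration.integrable_bound)
    show "integrable M (\<lambda>x. (norm b)\<^sup>2 * (norm (g x))\<^sup>2)" using g by (auto simp: sqi_def)
    show "AE x in M. norm ((norm (g x \<bullet> b))\<^sup>2) \<le> norm ((norm b)\<^sup>2 * (norm (g x))\<^sup>2)"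
      using power_mono[OF Cauchy_Schwarz_ineq2[of "g _" b], where n=2]
      by (auto intro!: AE_I2 simp: power_mult_distrib mult.commute)
  qed measurable
  then show ?thesis by (simp add: sqi_def)
qed

lemma L2conv_inner_const: "L2conv M gs g \<Longrightarrow> L2conv M (\<lambda>n x. gs n x \<bullet> b) (\<lambda>x. g x \<bullet> b)"
proof (rule L2conv_bound[where K="norm b"])
  show "norm (gs n x \<bullet> b - g x \<bullet> b) \<le> norm b * norm (gs n x - g x)" for n x
    unfolding inner_diff_left[symmetric] real_norm_def
    using Cauchy_Schwarz_ineq2[of "gs n x - g x" b] by (simp add: mult.commute)
qed (auto intro!: sqi_inner_const simp: L2conv_def)

text \<open>Both sides of the integration by parts formula are continuous in L2, so a limit of test
  functions whose gradients converge gets its weak gradient for free. \<open>W0I\<close> turns this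
  into the working criterion for membership in \<open>W0\<close>.\<close>

lemma weak_grad_limit:
  fixes A :: "'b::euclidean_space set"
  assumes A: "A \<in> sets lebesgue" and t: "\<And>n. test_fun A (\<phi>s n)"
    and c: "L2conv (lebesgue_on A) \<phi>s v" "L2conv (lebesgue_on A) (\<lambda>n. grad (\<phi>s n)) g"
  shows "weak_grad A v g"
  unfolding weak_grad_iff[OF A]
proof (intro conjI allI impI ballI)
  show "sqi (lebesgue_on A) v" "sqi (lebesgue_on A) g" using c by (auto simp: L2conv_sqi)
  fix \<phi> and b :: 'b assume p: "test_fun A \<phi>" and b: "b \<in> Basis"
  have 1: "(\<lambda>n. \<integral>x. \<phi>s n x * frechet_derivative \<phi> (at x) b \<partial>lebesgue_on A) \<longlonglongrightarrow>
        (\<integral>x. v x * frechet_derivative \<phi> (at x) b \<partial>lebesgue_on A)"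
    by (intro L2conv_integral_mult c L2conv_const test_fun_sqi(1)[OF test_fun_frechet[OF p b] A])
  have 2: "(\<lambda>n. - (\<integral>x. (grad (\<phi>s n) x \<bullet> b) * \<phi> x \<partial>lebesgue_on A)) \<longlonglongrightarrow> - (\<integral>x. (g x \<bullet> b) * \<phi> x \<partial>lebesgue_on A)"
    by (intro tendsto_minus L2conv_integral_mult c L2conv_const L2conv_inner_const test_fun_sqi(1)[OF p A])
  show "(\<integral>x. v x * frechet_derivative \<phi> (at x) b \<partial>lebesgue_on A) = - (\<integral>x. (g x \<bullet> b) * \<phi> x \<partial>lebesgue_on A)"
    by (rule LIMSEQ_unique[OF 1]) (use 2 test_fun_by_parts[OF t p A] in simp)
qed

lemma W0_iff:
  assumes A: "A \<in> sets lebesgue"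
  shows "W0 A u \<longleftrightarrow> (\<exists>g \<phi>s. weak_grad A u g \<and> (\<forall>n. test_fun A (\<phi>s n)) \<and>
    L2conv (lebesgue_on A) \<phi>s u \<and> L2conv (lebesgue_on A) (\<lambda>n. grad (\<phi>s n)) g)"
proof -
  let ?M = "lebesgue_on A"
  have "(\<lambda>n. LINT x:A|lebesgue. (\<phi>s n x - u x)\<^sup>2 + (norm (grad (\<phi>s n) x - g x))\<^sup>2) \<longlonglongrightarrow> 0 \<longleftrightarrow>
     L2conv ?M \<phi>s u \<and> L2conv ?M (\<lambda>n. grad (\<phi>s n)) g"
    if w: "weak_grad A u g" and t: "\<forall>n. test_fun A (\<phi>s n)" for g \<phi>s
  proof -
    have s: "sqi ?M (\<phi>s n)" "sqi ?M (grad (\<phi>s n))" "sqi ?M u" "sqi ?M g" for n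
      using t w A by (auto simp: weak_grad_iff intro: test_fun_sqi)
    have i: "integrable ?M (\<lambda>x. (\<phi>s n x - u x)\<^sup>2)" "integrable ?M (\<lambda>x. (norm (grad (\<phi>s n) x - g x))\<^sup>2)" for n
      using sqi_diff[OF s(1,3), of n] sqi_diff[OF s(2,4), of n] by (auto simp: sqi_def)
    have eq: "(LINT x:A|lebesgue. (\<phi>s n x - u x)\<^sup>2 + (norm (grad (\<phi>s n) x - g x))\<^sup>2) =
      (\<integral>x. (\<phi>s n x - u x)\<^sup>2 \<partial>?M) + (\<integral>x. (norm (grad (\<phi>s n) x - g x))\<^sup>2 \<partial>?M)" for n
      using i[of n] by (simp add: LINT_lebesgue_on[OF A])
    have nn: "(\<integral>x. (\<phi>s n x - u x)\<^sup>2 \<partial>?M) \<ge> 0" "(\<integral>x. (norm (grad (\<phi>s n) x - g x))\<^sup>2 \<partial>?M) \<ge> 0" for n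
      by (intro Bochner_Integration.integral_nonneg; simp)+
    have "(\<lambda>n. (\<integral>x. (\<phi>s n x - u x)\<^sup>2 \<partial>?M) + (\<integral>x. (norm (grad (\<phi>s n) x - g x))\<^sup>2 \<partial>?M)) \<longlonglongrightarrow> 0 \<longleftrightarrow>
      (\<lambda>n. \<integral>x. (\<phi>s n x - u x)\<^sup>2 \<partial>?M) \<longlonglongrightarrow> 0 \<and> (\<lambda>n. \<integral>x. (norm (grad (\<phi>s n) x - g x))\<^sup>2 \<partial>?M) \<longlonglongrightarrow> 0"
      (is "?S \<longlonglongrightarrow> 0 \<longleftrightarrow> ?P \<longlonglongrightarrow> 0 \<and> ?Q \<longlonglongrightarrow> 0")
    proof safe
      assume S: "?S \<longlonglongrightarrow> 0"
      show "?P \<longlonglongrightarrow> 0" "?Q \<longlonglongrightarrow> 0"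
        by (rule tendsto_sandwich[OF _ _ tendsto_const S]; use nn in \<open>auto intro!: always_eventually\<close>)+
    next
      assume "?P \<longlonglongrightarrow> 0" "?Q \<longlonglongrightarrow> 0"
      then show "?S \<longlonglongrightarrow> 0" using tendsto_add[of ?P 0 _ ?Q 0] by simp
    qed
    then show ?thesis unfolding eq L2conv_def using s by simp
  qed
  then show ?thesis unfolding W0_def by blast
qed

lemma W0I:
  assumes "A \<in> sets lebesgue" "\<And>n. test_fun A (\<phi>s n)"
    and "L2conv (lebesgue_on A) \<phi>s v" "L2conv (lebesgue_on A) (\<lambda>n. grad (\<phi>s n)) g"
  shows "W0 A v" "weak_grad A v g"
  using assms weak_grad_limit[OF assms] W0_iff[OF assms(1), of v] by blast+

subsection \<open>The fundamental lemma of the calculus of variations\<close>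

text \<open>Outer regularity approximates the set \<open>S\<close> where \<open>f\<close> is
  negative, cut down to a ball, by decreasing bounded open sets \<open>V m\<close>. The nonnegative
  integrals over them tend to the integral over \<open>S\<close>, which is then nonnegative and
  nonpositive. Besides the fundamental lemma, this turns the integrated comparison with the heat
  kernel into an almost everywhere one.\<close>

lemma AE_nonneg_if_integral_open_nonneg:
  fixes f :: "'b::euclidean_space \<Rightarrow> real"
  assumes f: "integrable lebesgue f"
    and nn: "\<And>U. open U \<Longrightarrow> bounded U \<Longrightarrow> 0 \<le> (\<integral>x. indicator U x * f x \<partial>lebesgue)"
  shows "AE x in lebesgue. 0 \<le> f x"
proof -
  note [measurable] = borel_measurable_integrable[OF f]
  have "AE x in lebesgue. x \<in> ball 0 (real n) \<longrightarrow> 0 \<le> f x" for n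
  proof -
    define S where "S = {x \<in> space lebesgue. f x < 0} \<inter> ball 0 (real n)"
    have "ball 0 (real n) \<in> sets (lebesgue :: 'b measure)" by simp
    then have S: "S \<in> sets lebesgue" unfolding S_def by (intro sets.Int) measurable
    have "\<exists>T. open T \<and> S \<subseteq> T \<and> T - S \<in> lmeasurable \<and> emeasure lebesgue (T - S) < ennreal (1 / real (Suc m))" for m
      using sets_lebesgue_outer_open[OF S, of "1 / real (Suc m)"] by (metis zero_less_divide_1_iff of_nat_0_less_iff zero_less_Suc)
    then obtain T where T: "\<And>m. open (T m)" "\<And>m. S \<subseteq> T m" "\<And>m. T m - S \<in> lmeasurable"
      "\<And>m. emeasure lebesgue (T m - S) < ennreal (1 / real (Suc m))" by metis
    define V where "V m = (\<Inter>i\<le>m. T i) \<inter> ball 0 (real n)" for m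
    have V: "open (V m)" "bounded (V m)" "S \<subseteq> V m" for m
      unfolding V_def using T(1,2) by (auto intro!: open_INT open_Int bounded_Int simp: S_def)
    define W where "W = (\<Inter>m. V m)"
    have [measurable]: "V m \<in> sets lebesgue" for m using V(1) by (simp add: borel_open)
    have Wm[measurable]: "W \<in> sets lebesgue" unfolding W_def by measurable
    have "emeasure lebesgue (W - S) \<le> ennreal (1 / real (Suc m))" for m
    proof -
      have "emeasure lebesgue (W - S) \<le> emeasure lebesgue (T m - S)"
        using T(3)[of m] by (intro emeasure_mono) (auto simp: W_def V_def)
      then show ?thesis using T(4)[of m] by simp
    qed
    then have "emeasure lebesgue (W - S) \<le> 0"
      by (intro LIMSEQ_le_const[OF tendsto_ennrealI[OF LIMSEQ_inverse_real_of_nat, simplified]])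
         (auto simp: inverse_eq_divide)
    then have WS: "W - S \<in> null_sets lebesgue" using S by (intro null_setsI) auto
    have "(\<lambda>m. \<integral>x. indicator (V m) x * f x \<partial>lebesgue) \<longlonglongrightarrow> (\<integral>x. indicator W x * f x \<partial>lebesgue)"
    proof (rule integral_dominated_convergence[where w="\<lambda>x. \<bar>f x\<bar>"])
      show "AE x in lebesgue. (\<lambda>m. indicator (V m) x * f x) \<longlonglongrightarrow> indicator W x * f x"
      proof (rule AE_I2, intro tendsto_mult tendsto_const)
        fix x show "(\<lambda>m. indicator (V m) x :: real) \<longlonglongrightarrow> indicator W x"
        proof (cases "x \<in> W")
          case False
          then obtain m where "x \<notin> V m" by (auto simp: W_def)
          then have "\<And>k. k \<ge> m \<Longrightarrow> x \<notin> V k" by (auto simp: V_def)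
          then show ?thesis using False
            by (intro tendsto_eventually) (auto simp: eventually_sequentially intro!: exI[of _ m])
        qed (simp add: W_def)
      qed
    qed (use f in \<open>auto simp: indicator_def\<close>)
    then have "0 \<le> (\<integral>x. indicator W x * f x \<partial>lebesgue)"
      by (rule LIMSEQ_le_const) (use nn V in auto)
    also have "\<dots> = (\<integral>x. indicator S x * f x \<partial>lebesgue)"
    proof (rule integral_cong_AE)
      show "AE x in lebesgue. indicator W x * f x = indicator S x * f x"
        using AE_not_in[OF WS] by eventually_elim (use V(3) in \<open>auto simp: indicator_def W_def\<close>)
    qed (use S in measurable)
    finally have 0: "0 \<le> (\<integral>x. indicator S x * f x \<partial>lebesgue)" .
    have iS: "integrable lebesgue (\<lambda>x. - (indicator S x * f x))"
      using integrable_mult_indicator[OF S f] by simp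
    have "(\<integral>x. - (indicator S x * f x) \<partial>lebesgue) = 0"
    proof (rule antisym)
      show "0 \<le> (\<integral>x. - (indicator S x * f x) \<partial>lebesgue)"
        by (intro Bochner_Integration.integral_nonneg) (auto simp: S_def indicator_def)
    qed (use 0 in simp)
    then have "AE x in lebesgue. - (indicator S x * f x) = 0"
      by (subst (asm) integral_nonneg_eq_0_iff_AE[OF iS]) (auto simp: S_def indicator_def)
    then show ?thesis
      by eventually_elim (auto simp: S_def indicator_def split: if_splits)
  qed
  then have "AE x in lebesgue. \<forall>n. x \<in> ball 0 (real n) \<longrightarrow> 0 \<le> f x" by (subst AE_all_countable) blast
  then show ?thesis
  proof eventually_elim
    case (elim x)
    obtain n where "norm x < real n" using reals_Archimedean2 by blast
    then show ?case using elim by auto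
  qed
qed

text \<open>Uniformly bounded test functions converging to the indicator of an open set show that
  \<open>h\<close> has integral 0 over the part of any open set in \<open>A\<close> and in a ball;
  the sign criterion then applies to \<open>h\<close> and to \<open>- h\<close>.\<close>

lemma fundamental_lemma:
  fixes A :: "'b::euclidean_space set" and h :: "'b \<Rightarrow> real"
  assumes A: "open A" and h: "sqi (lebesgue_on A) h"
    and z: "\<And>\<phi>. test_fun A \<phi> \<Longrightarrow> (\<integral>x. h x * \<phi> x \<partial>lebesgue_on A) = 0"
  shows "AE x in lebesgue_on A. h x = 0"
proof -
  have Am[measurable]: "A \<in> sets lebesgue" using A by (simp add: borel_open)
  note [measurable] = sqi_measurable[OF h]
  have "AE x in lebesgue. x \<in> A \<inter> ball 0 (real n) \<longrightarrow> h x = 0" for n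
  proof -
    define f where "f x = indicator (A \<inter> ball 0 (real n)) x * h x" for x
    have b: "A \<inter> ball 0 (real n) \<in> lmeasurable"
      using A by (intro bounded_set_imp_lmeasurable) (auto intro: bounded_Int simp: borel_open)
    \<comment> \<open>A square-integrable function need not be integrable on an unbounded set; on a
      ball it is, as a product with the square-integrable indicator.\<close>
    have i1: "integrable (lebesgue_on A) (\<lambda>x. indicator (ball 0 (real n)) x * h x)"
    proof (rule sqi_mult[OF _ h])
      have "integrable (lebesgue_on A) (indicat_real (ball 0 (real n)))"
        using b lmeasurable_iff_integrable[of "A \<inter> ball 0 (real n)"] by (simp add: integrable_restrict_space flip: indicator_inter_arith)
      then show "sqi (lebesgue_on A) (indicat_real (ball 0 (real n)))"
        by (simp add: sqi_def power2_eq_square flip: indicator_inter_arith)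
    qed
    then have f: "integrable lebesgue f"
      using Am by (simp add: integrable_restrict_space f_def[abs_def] indicator_inter_arith mult.assoc)
    have zero: "(\<integral>x. indicator U x * f x \<partial>lebesgue) = 0" if U: "open U" for U
    proof -
      define V where "V = U \<inter> A \<inter> ball 0 (real n)"
      have V: "open V" using U A by (auto simp: V_def)
      obtain \<phi> where p: "\<And>n::nat. test_fun V (\<phi> n)" "\<And>n x. 0 \<le> \<phi> n x" "\<And>n x. \<phi> n x \<le> 1"
        "\<And>x. (\<lambda>n. \<phi> n x) \<longlonglongrightarrow> indicator V x" using ex_test_funs_tendsto_indicator[OF V] by metis
      have [measurable]: "\<phi> k \<in> borel_measurable (lebesgue_on A)" for k
        using sqi_measurable[OF test_fun_sqi(1)[OF p(1) Am]] .
      have Vm[measurable]: "V \<in> sets lebesgue" using V by (simp add: borel_open)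
      have pz: "\<phi> k x = 0" if "x \<notin> V" for k x
        using test_funE[OF p(1)[of k]] that by (metis subsetD)
      have "(\<lambda>k. \<integral>x. h x * \<phi> k x \<partial>lebesgue_on A) \<longlonglongrightarrow> (\<integral>x. h x * indicator V x \<partial>lebesgue_on A)"
      proof (rule integral_dominated_convergence[where w="\<lambda>x. \<bar>indicator (ball 0 (real n)) x * h x\<bar>"])
        show "AE x in lebesgue_on A. (\<lambda>k. h x * \<phi> k x) \<longlonglongrightarrow> h x * indicator V x"
          by (intro AE_I2 tendsto_intros p)
        show "AE x in lebesgue_on A. norm (h x * \<phi> k x) \<le> \<bar>indicator (ball 0 (real n)) x * h x\<bar>" for k
        proof (rule AE_I2)
          fix x show "norm (h x * \<phi> k x) \<le> \<bar>indicator (ball 0 (real n)) x * h x\<bar>"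
            using p(2,3)[of k x] pz[of x k] mult_left_le[of "\<phi> k x" "\<bar>h x\<bar>"]
            by (cases "x \<in> V") (auto simp: abs_mult V_def indicator_def)
        qed
        show "(\<lambda>x. h x * indicator V x) \<in> borel_measurable (lebesgue_on A)"
        proof (intro borel_measurable_times)
          show "h \<in> borel_measurable (lebesgue_on A)" by measurable
          have "(indicator V :: 'b \<Rightarrow> real) \<in> borel_measurable lebesgue" using Vm by measurable
          then show "(indicator V :: 'b \<Rightarrow> real) \<in> borel_measurable (lebesgue_on A)" by (rule measurable_restrict_space1)
        qed
      qed (use i1 in auto)
      then have "(\<integral>x. h x * indicator V x \<partial>lebesgue_on A) = 0"
      proof -
        have "V \<subseteq> A" by (auto simp: V_def)
        then have "(\<lambda>k. \<integral>x. h x * \<phi> k x \<partial>lebesgue_on A) = (\<lambda>k. 0)"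
          using z[OF test_fun_mono[OF p(1)]] by auto
        then show ?thesis using \<open>_ \<longlonglongrightarrow> (\<integral>x. h x * indicator V x \<partial>lebesgue_on A)\<close>
          by (simp add: LIMSEQ_const_iff)
      qed
      then have "(\<integral>x. indicator A x * (h x * indicator V x) \<partial>lebesgue) = 0"
        using Am by (simp add: integral_restrict_space)
      moreover have "(\<lambda>x. indicator A x * (h x * indicator V x)) = (\<lambda>x. indicator U x * f x)"
        by (auto simp: V_def f_def indicator_def)
      ultimately show ?thesis by simp
    qed
    have "AE x in lebesgue. 0 \<le> f x"
      by (rule AE_nonneg_if_integral_open_nonneg[OF f]) (simp add: zero)
    moreover have "AE x in lebesgue. 0 \<le> - f x"
      by (rule AE_nonneg_if_integral_open_nonneg) (use f zero in auto)
    ultimately show ?thesis by eventually_elim (auto simp: f_def indicator_def split: if_splits)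
  qed
  then have "AE x in lebesgue. \<forall>n. x \<in> A \<inter> ball 0 (real n) \<longrightarrow> h x = 0" by (subst AE_all_countable) blast
  then have "AE x in lebesgue. x \<in> A \<longrightarrow> h x = 0"
  proof eventually_elim
    case (elim x)
    obtain n where "norm x < real n" using reals_Archimedean2 by blast
    then show ?case using elim by auto
  qed
  then show ?thesis using Am by (simp add: AE_restrict_space_iff)
qed

text \<open>\<open>wgrad\<close> is an arbitrary choice among weak gradients. Uniqueness almost
  everywhere allows any weak gradient that has been computed, for instance by a product rule, to
  take its place under an integral.\<close>

lemma weak_grad_unique:
  fixes A :: "'b::euclidean_space set"
  assumes A: "open A" and g: "weak_grad A u g" "weak_grad A u g'"
  shows "AE x in lebesgue_on A. g x = g' x"
proof -
  have Am: "A \<in> sets lebesgue" using A by (simp add: borel_open)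
  note w = g[unfolded weak_grad_iff[OF Am]]
  have "AE x in lebesgue_on A. (g x - g' x) \<bullet> b = 0" if b: "b \<in> Basis" for b
  proof (rule fundamental_lemma[OF A])
    show "sqi (lebesgue_on A) (\<lambda>x. (g x - g' x) \<bullet> b)"
      using w by (intro sqi_inner_const sqi_diff) auto
    fix \<phi> assume p: "test_fun A \<phi>"
    note i = sqi_mult[OF sqi_inner_const test_fun_sqi(1)[OF p Am]]
    have "(\<integral>x. ((g x - g' x) \<bullet> b) * \<phi> x \<partial>lebesgue_on A) =
       (\<integral>x. (g x \<bullet> b) * \<phi> x \<partial>lebesgue_on A) - (\<integral>x. (g' x \<bullet> b) * \<phi> x \<partial>lebesgue_on A)"
      using w by (simp add: inner_diff_left left_diff_distrib i Bochner_Integration.integral_diff)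
    also have "\<dots> = 0" using w p b by force
    finally show "(\<integral>x. ((g x - g' x) \<bullet> b) * \<phi> x \<partial>lebesgue_on A) = 0" .
  qed
  then have "AE x in lebesgue_on A. \<forall>b\<in>Basis. (g x - g' x) \<bullet> b = 0"
    by (simp add: AE_ball_countable countable_finite)
  then show ?thesis by eventually_elim (auto intro: euclidean_eqI simp: inner_diff_left)
qed

subsection \<open>Functions in the Sobolev space with zero boundary values\<close>

lemma open_sets_lebesgue: "open A \<Longrightarrow> A \<in> sets (lebesgue :: 'b::euclidean_space measure)"
  by (simp add: borel_open)

lemma weak_grad_sqi:
  assumes "open A" "weak_grad A u g"
  shows "sqi (lebesgue_on A) u" "sqi (lebesgue_on A) g"
  using assms(2) weak_grad_iff[OF open_sets_lebesgue[OF assms(1)]] by auto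

lemma weak_grad_wgrad: "weak_grad A u g \<Longrightarrow> weak_grad A u (wgrad A u)"
  unfolding wgrad_def by (rule someI[of "weak_grad A u"])

lemma wgrad_AE:
  assumes "open A" "weak_grad A u g"
  shows "AE x in lebesgue_on A. wgrad A u x = g x"
  by (rule weak_grad_unique[OF assms(1) weak_grad_wgrad[OF assms(2)] assms(2)])

lemma L2conv_cong_AE:
  assumes f: "L2conv M fs f" and g: "sqi M g" and ae: "AE x in M. f x = g x"
  shows "L2conv M fs g"
proof -
  note [measurable] = sqi_measurable[OF L2conv_sqi(1)[OF f]] sqi_measurable[OF L2conv_sqi(2)[OF f]] sqi_measurable[OF g]
  have "(\<integral>x. (norm (fs n x - f x))\<^sup>2 \<partial>M) = (\<integral>x. (norm (fs n x - g x))\<^sup>2 \<partial>M)" for n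
    using ae by (intro integral_cong_AE) auto
  then show ?thesis using f g unfolding L2conv_def by simp
qed

lemma W0_weak_grad: "W0 A u \<Longrightarrow> weak_grad A u (wgrad A u)"
  unfolding W0_def using weak_grad_wgrad by blast

lemma W0_sqi:
  assumes "open A" "W0 A u"
  shows "sqi (lebesgue_on A) u" "sqi (lebesgue_on A) (wgrad A u)"
  using weak_grad_sqi[OF assms(1) W0_weak_grad[OF assms(2)]] .

text \<open>The definition of \<open>W0\<close> only provides convergence of the gradients to some
  weak gradient; by uniqueness the limit may be taken to be the chosen representative
  \<open>wgrad A u\<close>.\<close>

lemma W0E:
  assumes A: "open A" and u: "W0 A u"
  obtains \<phi>s where "\<And>n. test_fun A (\<phi>s n)" "L2conv (lebesgue_on A) \<phi>s u"
    "L2conv (lebesgue_on A) (\<lambda>n. grad (\<phi>s n)) (wgrad A u)"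
proof -
  obtain g \<phi>s where g: "weak_grad A u g" "\<And>n. test_fun A (\<phi>s n)" "L2conv (lebesgue_on A) \<phi>s u"
    "L2conv (lebesgue_on A) (\<lambda>n. grad (\<phi>s n)) g"
    using u unfolding W0_iff[OF open_sets_lebesgue[OF A]] by blast
  have "AE x in lebesgue_on A. g x = wgrad A u x" using wgrad_AE[OF A g(1)] by eventually_elim simp
  then have "L2conv (lebesgue_on A) (\<lambda>n. grad (\<phi>s n)) (wgrad A u)"
    using L2conv_cong_AE[OF g(4)] W0_sqi[OF A u] by blast
  then show ?thesis using g that by blast
qed

lemma energy_eq:
  assumes A: "open A" and g: "weak_grad A u g"
  shows "energy A u = (\<integral>x. (norm (g x))\<^sup>2 \<partial>lebesgue_on A)"
proof -
  note [measurable] = sqi_measurable[OF weak_grad_sqi(2)[OF A g]]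
    sqi_measurable[OF weak_grad_sqi(2)[OF A weak_grad_wgrad[OF g]]]
  show ?thesis unfolding energy_def LINT_lebesgue_on[OF open_sets_lebesgue[OF A]]
    by (intro integral_cong_AE) (use wgrad_AE[OF A g] in auto)
qed

lemma test_fun_W0:
  assumes A: "open A" and p: "test_fun A \<phi>"
  shows "W0 A \<phi>" "weak_grad A \<phi> (grad \<phi>)"
  using W0I[OF open_sets_lebesgue[OF A], of "\<lambda>n. \<phi>" \<phi> "grad \<phi>"] p
    L2conv_const[OF test_fun_sqi(1)[OF p open_sets_lebesgue[OF A]]]
    L2conv_const[OF test_fun_sqi(2)[OF p open_sets_lebesgue[OF A]]] by blast+

text \<open>Supplies the weak gradients of the members of a trial space, whose energy thereby
  becomes a quadratic form in the coefficients.\<close>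

lemma W0_sum:
  assumes A: "open A" and us: "\<And>i. i < (j::nat) \<Longrightarrow> W0 A (us i)"
  shows "W0 A (\<lambda>x. \<Sum>i<j. c i * us i x)" "weak_grad A (\<lambda>x. \<Sum>i<j. c i * us i x) (\<lambda>x. \<Sum>i<j. c i *\<^sub>R wgrad A (us i) x)"
proof -
  have "\<exists>\<phi>s. (\<forall>n. test_fun A (\<phi>s n)) \<and> L2conv (lebesgue_on A) \<phi>s (us i) \<and>
    L2conv (lebesgue_on A) (\<lambda>n. grad (\<phi>s n)) (wgrad A (us i))" if "i < j" for i
    using W0E[OF A us[OF that]] by metis
  then obtain \<phi> where p: "\<And>i n. i < j \<Longrightarrow> test_fun A (\<phi> i n)" "\<And>i. i < j \<Longrightarrow> L2conv (lebesgue_on A) (\<phi> i) (us i)"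
    "\<And>i. i < j \<Longrightarrow> L2conv (lebesgue_on A) (\<lambda>n. grad (\<phi> i n)) (wgrad A (us i))" by metis
  have t: "test_fun A (\<lambda>x. \<Sum>i<j. c i * \<phi> i n x)" for n
    by (intro test_fun_sum test_fun_cmult p) auto
  have c1: "L2conv (lebesgue_on A) (\<lambda>n x. \<Sum>i<j. c i * \<phi> i n x) (\<lambda>x. \<Sum>i<j. c i * us i x)"
    by (intro L2conv_sum L2conv_mult[where K="\<bar>c i\<bar>" for i] p) auto
  have g: "grad (\<lambda>x. \<Sum>i<j. c i * \<phi> i n x) = (\<lambda>x. \<Sum>i<j. c i *\<^sub>R grad (\<phi> i n) x)" for n
  proof
    fix x
    have d: "\<phi> i n differentiable at x" if "i < j" for i using p(1)[OF that] test_fun_differentiable by blast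
    have "grad (\<lambda>x. \<Sum>i<j. c i * \<phi> i n x) x = (\<Sum>i<j. grad (\<lambda>x. c i * \<phi> i n x) x)"
      using d by (intro grad_sum) auto
    also have "\<dots> = (\<Sum>i<j. c i *\<^sub>R grad (\<phi> i n) x)"
      using d by (intro sum.cong grad_cmult) auto
    finally show "grad (\<lambda>x. \<Sum>i<j. c i * \<phi> i n x) x = (\<Sum>i<j. c i *\<^sub>R grad (\<phi> i n) x)" .
  qed
  have c2: "L2conv (lebesgue_on A) (\<lambda>n. grad (\<lambda>x. \<Sum>i<j. c i * \<phi> i n x)) (\<lambda>x. \<Sum>i<j. c i *\<^sub>R wgrad A (us i) x)"
    unfolding g by (intro L2conv_sum L2conv_scale[where K="\<bar>c i\<bar>" for i] p) auto
  show "W0 A (\<lambda>x. \<Sum>i<j. c i * us i x)" "weak_grad A (\<lambda>x. \<Sum>i<j. c i * us i x) (\<lambda>x. \<Sum>i<j. c i *\<^sub>R wgrad A (us i) x)"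
    using W0I[OF open_sets_lebesgue[OF A] t c1 c2] by auto
qed

text \<open>Smoothness of \<open>\<zeta>\<close> is only required through its products with test functions: the cut-offs used
  later carry the indicator of a single cylinder and need not even be continuous outside \<open>A\<close>.\<close>

definition multiplier ::
  "'b::euclidean_space set \<Rightarrow> 'b set \<Rightarrow> ('b \<Rightarrow> real) \<Rightarrow> ('b \<Rightarrow> 'b) \<Rightarrow> bool" where
  "multiplier A B \<zeta> \<gamma> \<longleftrightarrow> \<zeta> \<in> borel_measurable borel \<and> \<gamma> \<in> borel_measurable borel \<and>
     (\<exists>K. (\<forall>x. \<bar>\<zeta> x\<bar> \<le> K) \<and> (\<forall>x. norm (\<gamma> x) \<le> K)) \<and>
     (\<forall>\<phi>. test_fun A \<phi> \<longrightarrow> test_fun B (\<lambda>x. \<zeta> x * \<phi> x) \<and>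
        (\<forall>x. grad (\<lambda>x. \<zeta> x * \<phi> x) x = \<zeta> x *\<^sub>R grad \<phi> x + \<phi> x *\<^sub>R \<gamma> x))"

lemma borel_measurable_lebesgue_on: "f \<in> borel_measurable borel \<Longrightarrow> f \<in> borel_measurable (lebesgue_on A)"
  by (intro measurable_restrict_space1 measurable_completion) simp

text \<open>The approximants live in \<open>B\<close> although convergence is measured on all of
  \<open>A\<close>: with a cylinder for \<open>B\<close> they are admissible in the Poincare
  inequality of that cylinder.\<close>

lemma multiplier_W0_approx:
  assumes A: "open A" and m: "multiplier A B \<zeta> \<gamma>" and u: "W0 A u"
  obtains \<psi>s where "\<And>n. test_fun B (\<psi>s n)" "L2conv (lebesgue_on A) \<psi>s (\<lambda>x. \<zeta> x * u x)"
    "L2conv (lebesgue_on A) (\<lambda>n. grad (\<psi>s n)) (\<lambda>x. \<zeta> x *\<^sub>R wgrad A u x + u x *\<^sub>R \<gamma> x)"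
proof -
  obtain \<phi>s where p: "\<And>n. test_fun A (\<phi>s n)" "L2conv (lebesgue_on A) \<phi>s u"
    "L2conv (lebesgue_on A) (\<lambda>n. grad (\<phi>s n)) (wgrad A u)" using W0E[OF A u] by metis
  obtain K where K: "\<And>x. \<bar>\<zeta> x\<bar> \<le> K" "\<And>x. norm (\<gamma> x) \<le> K" using m unfolding multiplier_def by blast
  have meas: "\<zeta> \<in> borel_measurable (lebesgue_on A)" "\<gamma> \<in> borel_measurable (lebesgue_on A)"
    using m by (auto simp: multiplier_def intro: borel_measurable_lebesgue_on)
  have t: "test_fun B (\<lambda>x. \<zeta> x * \<phi>s n x)"
    and g: "grad (\<lambda>x. \<zeta> x * \<phi>s n x) = (\<lambda>x. \<zeta> x *\<^sub>R grad (\<phi>s n) x + \<phi>s n x *\<^sub>R \<gamma> x)" for n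
    using m p(1)[of n] unfolding multiplier_def by blast+
  have "L2conv (lebesgue_on A) (\<lambda>n. grad (\<lambda>x. \<zeta> x * \<phi>s n x)) (\<lambda>x. \<zeta> x *\<^sub>R wgrad A u x + u x *\<^sub>R \<gamma> x)"
    unfolding g by (intro L2conv_add L2conv_scale[OF meas(1) K(1)] L2conv_vec[OF meas(2) K(2)] p)
  then show ?thesis by (rule that[OF t L2conv_mult[OF meas(1) K(1) p(2)]])
qed

lemma multiplier_W0:
  assumes A: "open A" and m: "multiplier A B \<zeta> \<gamma>" and B: "B \<subseteq> A" and u: "W0 A u"
  shows "W0 A (\<lambda>x. \<zeta> x * u x)" "weak_grad A (\<lambda>x. \<zeta> x * u x) (\<lambda>x. \<zeta> x *\<^sub>R wgrad A u x + u x *\<^sub>R \<gamma> x)"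
proof -
  obtain \<psi>s where p: "\<And>n. test_fun B (\<psi>s n)" "L2conv (lebesgue_on A) \<psi>s (\<lambda>x. \<zeta> x * u x)"
    "L2conv (lebesgue_on A) (\<lambda>n. grad (\<psi>s n)) (\<lambda>x. \<zeta> x *\<^sub>R wgrad A u x + u x *\<^sub>R \<gamma> x)"
    using multiplier_W0_approx[OF A m u] by metis
  show "W0 A (\<lambda>x. \<zeta> x * u x)" "weak_grad A (\<lambda>x. \<zeta> x * u x) (\<lambda>x. \<zeta> x *\<^sub>R wgrad A u x + u x *\<^sub>R \<gamma> x)"
    using W0I[OF open_sets_lebesgue[OF A] test_fun_mono[OF p(1) B] p(2,3)] by auto
qed

lemma multiplier_smooth:
  assumes "smooth \<zeta>" "\<And>x. \<bar>\<zeta> x\<bar> \<le> K" "\<And>x. norm (grad \<zeta> x) \<le> K"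
  shows "multiplier A A \<zeta> (grad \<zeta>)"
  unfolding multiplier_def
proof (intro conjI allI impI exI)
  show "\<zeta> \<in> borel_measurable borel" "grad \<zeta> \<in> borel_measurable borel"
    using assms(1) by (auto intro!: borel_measurable_continuous_onI smooth_continuous continuous_grad)
  show "\<bar>\<zeta> x\<bar> \<le> K" "norm (grad \<zeta> x) \<le> K" for x using assms by auto
  fix \<phi> assume p: "test_fun A \<phi>"
  show "test_fun A (\<lambda>x. \<zeta> x * \<phi> x)" by (rule test_fun_mult_smooth[OF p assms(1)])
  show "grad (\<lambda>x. \<zeta> x * \<phi> x) x = \<zeta> x *\<^sub>R grad \<phi> x + \<phi> x *\<^sub>R grad \<zeta> x" for x
    by (rule grad_mult[OF smooth_differentiable[OF assms(1)] test_fun_differentiable[OF p]])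
qed

section \<open>Testing the eigenvalue equation\<close>

lemma eigenfunction_W0: "eigenfunction A lam u \<Longrightarrow> W0 A u"
  by (simp add: eigenfunction_def)

lemma eigenfunction_test:
  assumes A: "open A" and u: "eigenfunction A lam u" and v: "W0 A v" and g: "weak_grad A v g"
  shows "(\<integral>x. wgrad A u x \<bullet> g x \<partial>lebesgue_on A) = lam * (\<integral>x. u x * v x \<partial>lebesgue_on A)"
proof -
  note Am = open_sets_lebesgue[OF A]
  note [measurable] = sqi_measurable[OF W0_sqi(2)[OF A eigenfunction_W0[OF u]]]
    sqi_measurable[OF W0_sqi(2)[OF A v]] sqi_measurable[OF weak_grad_sqi(2)[OF A g]]
  have "(\<integral>x. wgrad A u x \<bullet> g x \<partial>lebesgue_on A) = (\<integral>x. wgrad A u x \<bullet> wgrad A v x \<partial>lebesgue_on A)"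
    by (intro integral_cong_AE) (use wgrad_AE[OF A g] in auto)
  then show ?thesis using u v unfolding eigenfunction_def by (simp add: LINT_lebesgue_on[OF Am])
qed

lemma eigenfunction_norm_pos:
  assumes A: "open A" and u: "eigenfunction A lam u"
  shows "(\<integral>x. (u x)\<^sup>2 \<partial>lebesgue_on A) > 0"
proof -
  have s: "sqi (lebesgue_on A) u" using W0_sqi(1)[OF A eigenfunction_W0[OF u]] .
  have "(\<integral>x. (u x)\<^sup>2 \<partial>lebesgue_on A) \<noteq> 0"
  proof
    assume "(\<integral>x. (u x)\<^sup>2 \<partial>lebesgue_on A) = 0"
    then have "AE x in lebesgue_on A. u x = 0"
      by (subst (asm) integral_nonneg_eq_0_iff_AE[OF sqi_power2[OF s]]) auto
    then show False using u open_sets_lebesgue[OF A]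
      by (simp add: AE_restrict_space_iff eigenfunction_def)
  qed
  moreover have "(\<integral>x. (u x)\<^sup>2 \<partial>lebesgue_on A) \<ge> 0" by (intro Bochner_Integration.integral_nonneg) auto
  ultimately show ?thesis by linarith
qed

lemma eigenvalue_nonneg:
  assumes A: "open A" and u: "eigenfunction A lam u"
  shows "lam \<ge> 0"
proof -
  have "0 \<le> (\<integral>x. wgrad A u x \<bullet> wgrad A u x \<partial>lebesgue_on A)"
    by (intro Bochner_Integration.integral_nonneg) auto
  also have "\<dots> = lam * (\<integral>x. (u x)\<^sup>2 \<partial>lebesgue_on A)"
    using eigenfunction_test[OF A u eigenfunction_W0[OF u] W0_weak_grad[OF eigenfunction_W0[OF u]]]
    by (simp add: power2_eq_square)
  finally show ?thesis using eigenfunction_norm_pos[OF A u] by (simp add: zero_le_mult_iff)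
qed

subsection \<open>The variational eigenvalues\<close>

text \<open>Boundedness of the coefficients by compactness of the unit sphere of the \<open>\<ell>\<^sup>1\<close>-norm in
  the first \<open>j\<close> coordinates, taken inside the product space \<open>nat \<Rightarrow> real\<close>.\<close>

lemma coefficients_bounded:
  fixes M :: "'m measure" and us :: "nat \<Rightarrow> 'm \<Rightarrow> real"
  assumes s: "\<And>i. i < j \<Longrightarrow> sqi M (us i)"
    and ind: "\<And>c. (AE x in M. (\<Sum>i<j. c i * us i x) = 0) \<Longrightarrow> \<forall>i<j. c i = 0"
  obtains K where "\<And>c i. (\<integral>x. (\<Sum>i<j. c i * us i x)\<^sup>2 \<partial>M) = 1 \<Longrightarrow> i < j \<Longrightarrow> \<bar>c i\<bar> \<le> K"
proof (cases "j = 0")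
  case True then show ?thesis using that by simp
next
  case False
  define q where "q c = (\<integral>x. (\<Sum>i<j. c i * us i x)\<^sup>2 \<partial>M)" for c :: "nat \<Rightarrow> real"
  define l where "l c = (\<Sum>i<j. \<bar>c i\<bar>)" for c :: "nat \<Rightarrow> real"
  have sq: "sqi M (\<lambda>x. \<Sum>i<j. c i * us i x)" for c :: "nat \<Rightarrow> real"
    by (intro sqi_sum sqi_cmult s) auto
  \<comment> \<open>As a polynomial in finitely many coordinates, \<open>q\<close> is continuous for
    the product topology.\<close>
  have q_eq: "q c = (\<Sum>i<j. \<Sum>k<j. c i * c k * (\<integral>x. us i x * us k x \<partial>M))" for c
  proof -
    have "q c = (\<integral>x. (\<Sum>i<j. \<Sum>k<j. (c i * c k) * (us i x * us k x)) \<partial>M)"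
      unfolding q_def power2_eq_square sum_product by (simp add: mult_ac)
    also have "\<dots> = (\<Sum>i<j. \<Sum>k<j. c i * c k * (\<integral>x. us i x * us k x \<partial>M))"
      by (subst Bochner_Integration.integral_sum; intro Bochner_Integration.integrable_sum integrable_mult_right sqi_mult s sum.cong refl;
          (subst Bochner_Integration.integral_sum)?) (auto intro!: integrable_mult_right sqi_mult s)
    finally show ?thesis .
  qed
  have cq: "continuous_on UNIV q" unfolding q_eq[abs_def]
    by (intro continuous_intros continuous_on_product_coordinates)
  have cl: "continuous_on UNIV l" unfolding l_def[abs_def] by (intro continuous_intros continuous_on_product_coordinates)
  \<comment> \<open>The coordinates from \<open>j\<close> on are pinned to 0; left free, they would
    make the product noncompact.\<close>
  define B where "B = PiE UNIV (\<lambda>i. if i < j then {-1..1::real} else {0})"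
  have "compactin (product_topology (\<lambda>i. euclidean) UNIV) B"
    unfolding B_def compactin_PiE by auto
  then have "compact B" unfolding euclidean_product_topology by simp
  moreover have "closed {c. l c = 1}" using closed_Collect_eq[OF cl continuous_on_const] .
  ultimately have comp: "compact (B \<inter> {c. l c = 1})" by (rule compact_Int_closed)
  have "(\<lambda>i. if i = 0 then 1 else 0) \<in> B \<inter> {c. l c = 1}"
    using False by (auto simp: B_def l_def if_distrib sum.delta cong: if_cong)
  then obtain c0 where c0: "c0 \<in> B \<inter> {c. l c = 1}" "\<And>c. c \<in> B \<inter> {c. l c = 1} \<Longrightarrow> q c0 \<le> q c"
    using continuous_attains_inf[OF comp _ continuous_on_subset[OF cq]] by blast
  have pos: "q c0 > 0"
  proof (rule ccontr)
    assume "\<not> q c0 > 0"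
    moreover have "q c0 \<ge> 0" unfolding q_def by (intro Bochner_Integration.integral_nonneg) auto
    ultimately have "(\<integral>x. (\<Sum>i<j. c0 i * us i x)\<^sup>2 \<partial>M) = 0" unfolding q_def by linarith
    then have "AE x in M. (\<Sum>i<j. c0 i * us i x) = 0"
      by (subst (asm) integral_nonneg_eq_0_iff_AE[OF sqi_power2[OF sq]]) auto
    from ind[OF this] have "l c0 = 0" unfolding l_def by simp
    then show False using c0(1) by simp
  qed
  have bound: "\<bar>c i\<bar> \<le> 1 / sqrt (q c0)" if c: "q c = 1" "i < j" for c i
  proof (cases "l c = 0")
    case True
    then have "c i = 0" using c(2) by (simp add: l_def sum_nonneg_eq_0_iff)
    then show ?thesis using pos by simp
  next
    case False
    have "l c \<ge> 0" unfolding l_def by (intro sum_nonneg) auto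
    then have lp: "l c > 0" using False by linarith
    \<comment> \<open>Homogeneity: scaling \<open>c\<close> to the unit sphere of \<open>l\<close>
      divides \<open>q c\<close> by \<open>(l c)\<^sup>2\<close>, and on that sphere
      \<open>q\<close> is at least \<open>q c0 > 0\<close>.\<close>
    define d where "d i = (if i < j then c i / l c else 0)" for i
    have le: "\<bar>c i\<bar> \<le> l c" if "i < j" for i
      unfolding l_def using that by (intro member_le_sum) auto
    have le': "- l c \<le> c i" "c i \<le> l c" if "i < j" for i using le[OF that] by auto
    have "l d = (\<Sum>i<j. \<bar>c i\<bar> / l c)" unfolding l_def[of d] d_def using lp by (intro sum.cong) auto
    also have "\<dots> = 1" using lp by (simp add: l_def[of c] sum_divide_distrib[symmetric])
    finally have "d \<in> B \<inter> {c. l c = 1}"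
      using le' lp by (auto simp: B_def d_def field_simps)
    then have "q c0 \<le> q d" by (rule c0(2))
    also have "q d = q c / (l c)\<^sup>2"
      unfolding q_eq d_def by (auto simp: sum_divide_distrib power2_eq_square intro!: sum.cong)
    finally have "q c0 * (l c)\<^sup>2 \<le> 1" using lp c by (simp add: field_simps)
    then have "(l c)\<^sup>2 \<le> 1 / q c0" using pos by (simp add: field_simps)
    then have "l c \<le> sqrt (1 / q c0)" by (rule real_le_rsqrt)
    then show ?thesis using le[OF c(2)] by (simp add: real_sqrt_divide)
  qed
  show ?thesis by (rule that[of "1 / sqrt (q c0)"]) (use bound in \<open>auto simp: q_def\<close>)
qed

text \<open>\<open>Sup\<close> and \<open>Inf\<close> of reals are informative only for nonempty
  bounded sets, so these facts are what gives \<open>dir_eig\<close> its meaning. The upper bound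
  comes from the bounded coefficients of normalised vectors and the finitely many integrals of
  products of gradients.\<close>

lemma Rayleigh_set_subspace:
  assumes A: "open A" and j: "j \<ge> 1" and F: "F \<in> subspaces_dim A j"
  defines "S \<equiv> {energy A v | v. v \<in> F \<and> (LINT x:A|lebesgue. (v x)\<^sup>2) = 1}"
  shows "S \<noteq> {}" "bdd_above S" "\<And>s. s \<in> S \<Longrightarrow> 0 \<le> s"
proof -
  note Am = open_sets_lebesgue[OF A]
  obtain us where F_eq: "F = {(\<lambda>x. \<Sum>i<j. c i * us i x) | c. True}" and us: "\<And>i. i < j \<Longrightarrow> W0 A (us i)"
    and ind: "\<And>c. (AE x in lebesgue. x \<in> A \<longrightarrow> (\<Sum>i<j. c i * us i x) = 0) \<Longrightarrow> (\<forall>i<j. c i = 0)"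
    using F unfolding subspaces_dim_def by blast
  note s = W0_sqi[OF A us]
  have sq: "sqi (lebesgue_on A) (\<lambda>x. \<Sum>i<j. c i * us i x)" for c :: "nat \<Rightarrow> real"
    by (intro sqi_sum sqi_cmult s) auto
  have ind': "\<And>c. (AE x in lebesgue_on A. (\<Sum>i<j. c i * us i x) = 0) \<Longrightarrow> \<forall>i<j. c i = 0"
    using ind Am by (simp add: AE_restrict_space_iff)
  obtain K where K: "\<And>c i. (\<integral>x. (\<Sum>i<j. c i * us i x)\<^sup>2 \<partial>lebesgue_on A) = 1 \<Longrightarrow> i < j \<Longrightarrow> \<bar>c i\<bar> \<le> K"
    using coefficients_bounded[of j "lebesgue_on A" us, OF s(1) ind'] by blast
  show "\<And>s. s \<in> S \<Longrightarrow> 0 \<le> s"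
    unfolding S_def energy_def LINT_lebesgue_on[OF Am] by (auto intro: Bochner_Integration.integral_nonneg)
  show "bdd_above S"
  proof (rule bdd_aboveI)
    fix s assume "s \<in> S"
    then obtain c where c: "s = energy A (\<lambda>x. \<Sum>i<j. c i * us i x)" "(\<integral>x. (\<Sum>i<j. c i * us i x)\<^sup>2 \<partial>lebesgue_on A) = 1"
      unfolding S_def F_eq LINT_lebesgue_on[OF Am] by blast
    have "s = (\<integral>x. (norm (\<Sum>i<j. c i *\<^sub>R wgrad A (us i) x))\<^sup>2 \<partial>lebesgue_on A)"
      unfolding c(1) by (rule energy_eq[OF A W0_sum(2)[OF A us]])
    also have "\<dots> = (\<integral>x. (\<Sum>i<j. \<Sum>k<j. (c i * c k) * (wgrad A (us i) x \<bullet> wgrad A (us k) x)) \<partial>lebesgue_on A)"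
      unfolding power2_norm_eq_inner inner_sum_left inner_sum_right
      by (simp add: mult_ac inner_commute sum_distrib_left)
    also have "\<dots> = (\<Sum>i<j. \<Sum>k<j. c i * c k * (\<integral>x. wgrad A (us i) x \<bullet> wgrad A (us k) x \<partial>lebesgue_on A))"
      by (subst Bochner_Integration.integral_sum; intro Bochner_Integration.integrable_sum integrable_mult_right sqi_inner s(2) sum.cong refl;
          (subst Bochner_Integration.integral_sum)?) (auto intro!: integrable_mult_right sqi_inner s(2))
    also have "\<dots> \<le> (\<Sum>i<j. \<Sum>k<j. K * K * \<bar>\<integral>x. wgrad A (us i) x \<bullet> wgrad A (us k) x \<partial>lebesgue_on A\<bar>)"
    proof (intro sum_mono)
      fix i k assume ik: "i \<in> {..<j}" "k \<in> {..<j}"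
      have "c i * c k * z \<le> K * K * \<bar>z\<bar>" for z
      proof -
        have "c i * c k * z \<le> \<bar>c i\<bar> * \<bar>c k\<bar> * \<bar>z\<bar>" by (metis abs_ge_self abs_mult)
        also have "\<dots> \<le> K * K * \<bar>z\<bar>"
          using K[OF c(2)] ik by (intro mult_right_mono mult_mono) (auto intro: order_trans[OF abs_ge_zero])
        finally show ?thesis .
      qed
      then show "c i * c k * (\<integral>x. wgrad A (us i) x \<bullet> wgrad A (us k) x \<partial>lebesgue_on A) \<le>
        K * K * \<bar>\<integral>x. wgrad A (us i) x \<bullet> wgrad A (us k) x \<partial>lebesgue_on A\<bar>" .
    qed
    finally show "s \<le> (\<Sum>i<j. \<Sum>k<j. K * K * \<bar>\<integral>x. wgrad A (us i) x \<bullet> wgrad A (us k) x \<partial>lebesgue_on A\<bar>)" .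
  qed
  \<comment> \<open>A normalised multiple of the first spanning function is a unit vector of
    \<open>F\<close>; \<open>j \<ge> 1\<close> guarantees that this function exists.\<close>
  have e0: "(\<Sum>i<j. (if i = 0 then a else 0) * us i x) = a * us 0 x" for x and a :: real
    using j by (simp add: if_distrib[of "\<lambda>c. c * _"] sum.delta cong: if_cong)
  have "(\<integral>x. (us 0 x)\<^sup>2 \<partial>lebesgue_on A) \<noteq> 0"
  proof
    assume "(\<integral>x. (us 0 x)\<^sup>2 \<partial>lebesgue_on A) = 0"
    then have "AE x in lebesgue_on A. us 0 x = 0"
      using j by (subst (asm) integral_nonneg_eq_0_iff_AE[OF sqi_power2[OF s(1)]]) auto
    then have "AE x in lebesgue_on A. (\<Sum>i<j. (if i = 0 then 1 else 0) * us i x) = 0" unfolding e0 by simp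
    from ind'[OF this] j show False by auto
  qed
  moreover have "(\<integral>x. (us 0 x)\<^sup>2 \<partial>lebesgue_on A) \<ge> 0" by (intro Bochner_Integration.integral_nonneg) auto
  ultimately have n: "(\<integral>x. (us 0 x)\<^sup>2 \<partial>lebesgue_on A) > 0" by linarith
  define a where "a = 1 / sqrt (\<integral>x. (us 0 x)\<^sup>2 \<partial>lebesgue_on A)"
  have v1: "(\<integral>x. (a * us 0 x)\<^sup>2 \<partial>lebesgue_on A) = 1"
    using n by (simp add: power_mult_distrib a_def power_divide)
  define v where "v = (\<lambda>x. \<Sum>i<j. (if i = 0 then a else 0) * us i x)"
  have "(LINT x:A|lebesgue. (v x)\<^sup>2) = 1"
    unfolding LINT_lebesgue_on[OF Am] v_def e0 by (rule v1)
  moreover have "v \<in> F" unfolding F_eq v_def by (intro CollectI exI[of _ "\<lambda>i. if i = 0 then a else 0"] conjI TrueI refl)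
  ultimately have "energy A v \<in> S" unfolding S_def by blast
  then show "S \<noteq> {}" by blast
qed

lemma bdd_below_Rayleigh:
  assumes A: "open A" and j: "j \<ge> 1"
  shows "bdd_below {Sup {energy A v |v. v \<in> F \<and> (LINT x:A|lebesgue. (v x)\<^sup>2) = 1} |F. F \<in> subspaces_dim A j}"
proof (rule bdd_belowI[of _ 0])
  fix m assume "m \<in> {Sup {energy A v |v. v \<in> F \<and> (LINT x:A|lebesgue. (v x)\<^sup>2) = 1} |F. F \<in> subspaces_dim A j}"
  then obtain F where F: "F \<in> subspaces_dim A j" and m: "m = Sup {energy A v |v. v \<in> F \<and> (LINT x:A|lebesgue. (v x)\<^sup>2) = 1}"
    by blast
  note R = Rayleigh_set_subspace[OF A j F]
  obtain s where s: "s \<in> {energy A v |v. v \<in> F \<and> (LINT x:A|lebesgue. (v x)\<^sup>2) = 1}" using R(1) by blast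
  show "0 \<le> m" unfolding m by (rule order_trans[OF R(3)[OF s] cSup_upper[OF s R(2)]])
qed

text \<open>The line spanned by \<open>\<phi>\<close> is an admissible trial space whose only
  Rayleigh value is \<open>e / n\<close>. This is the Poincare inequality of \<open>A\<close> with
  constant \<open>dir_eig 1 A\<close>, in the form needed on cross sections.\<close>

lemma dir_eig_1_le:
  assumes A: "open A" and p: "test_fun A \<phi>"
  shows "dir_eig 1 A * (\<integral>x. (\<phi> x)\<^sup>2 \<partial>lebesgue_on A) \<le> (\<integral>x. (norm (grad \<phi> x))\<^sup>2 \<partial>lebesgue_on A)"
proof -
  note Am = open_sets_lebesgue[OF A]
  define n where "n = (\<integral>x. (\<phi> x)\<^sup>2 \<partial>lebesgue_on A)"
  define e where "e = (\<integral>x. (norm (grad \<phi> x))\<^sup>2 \<partial>lebesgue_on A)"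
  have n0: "n \<ge> 0" "e \<ge> 0" unfolding n_def e_def by (auto intro: Bochner_Integration.integral_nonneg)
  show ?thesis
  proof (cases "n = 0")
    case True then show ?thesis using n0 by (simp add: n_def e_def)
  next
    case False
    then have n: "n > 0" using n0 by simp
    define F where "F = {(\<lambda>x. \<Sum>i<(1::nat). c i * \<phi> x) | c :: nat \<Rightarrow> real. True}"
    have F: "F \<in> subspaces_dim A 1"
      unfolding subspaces_dim_def
    proof (rule CollectI, rule exI[of _ "\<lambda>_. \<phi>"], intro conjI allI impI)
      show "F = {\<lambda>x. \<Sum>i<(1::nat). c i * \<phi> x |c. True}" by (rule F_def)
      show "W0 A \<phi>" by (rule test_fun_W0[OF A p])
      fix c :: "nat \<Rightarrow> real" and i :: nat
      assume ae: "AE x in lebesgue. x \<in> A \<longrightarrow> (\<Sum>i<1. c i * \<phi> x) = 0" and i: "i < 1"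
      show "c i = 0"
      proof (rule ccontr)
        assume "c i \<noteq> 0"
        then have "AE x in lebesgue_on A. \<phi> x = 0" using ae i Am by (simp add: AE_restrict_space_iff)
        then have "n = (\<integral>x. 0 \<partial>lebesgue_on A)" unfolding n_def
          using sqi_measurable[OF test_fun_sqi(1)[OF p Am]] by (intro integral_cong_AE) auto
        then show False using n by simp
      qed
    qed
    define S where "S = {energy A v | v. v \<in> F \<and> (LINT x:A|lebesgue. (v x)\<^sup>2) = 1}"
    have S: "s = e / n" if sS: "s \<in> S" for s
    proof -
      obtain v where v: "v \<in> F" "s = energy A v" "(\<integral>x. (v x)\<^sup>2 \<partial>lebesgue_on A) = 1"
        using sS unfolding S_def LINT_lebesgue_on[OF Am] by blast
      then obtain c' :: "nat \<Rightarrow> real" where "v = (\<lambda>x. \<Sum>i<(1::nat). c' i * \<phi> x)" unfolding F_def by blast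
      then have "v = (\<lambda>x. c' 0 * \<phi> x)" by simp
      then obtain c :: real where c: "s = energy A (\<lambda>x. c * \<phi> x)" "(\<integral>x. (c * \<phi> x)\<^sup>2 \<partial>lebesgue_on A) = 1"
        using v by blast
      have c2: "c\<^sup>2 * n = 1" using c(2) by (simp add: power_mult_distrib n_def)
      have "s = (\<integral>x. (norm (grad (\<lambda>x. c * \<phi> x) x))\<^sup>2 \<partial>lebesgue_on A)"
        unfolding c(1) by (rule energy_eq[OF A test_fun_W0(2)[OF A test_fun_cmult[OF p]]])
      also have "\<dots> = c\<^sup>2 * e"
        by (simp add: grad_cmult[OF test_fun_differentiable[OF p]] power_mult_distrib e_def)
      also have "\<dots> = e / n" using c2 n by (simp add: field_simps)
      finally show ?thesis .
    qed
    note R = Rayleigh_set_subspace[OF A order_refl F, folded S_def]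
    have "S = {e / n}" using S R(1) by blast
    then have "Sup S = e / n" by simp
    have "dir_eig 1 A \<le> Sup S"
      unfolding dir_eig_def
    proof (rule cInf_lower)
      show "Sup S \<in> {Sup {energy A v |v. v \<in> F \<and> (LINT x:A|lebesgue. (v x)\<^sup>2) = 1} |F. F \<in> subspaces_dim A 1}"
        using F unfolding S_def by blast
      show "bdd_below {Sup {energy A v |v. v \<in> F \<and> (LINT x:A|lebesgue. (v x)\<^sup>2) = 1} |F. F \<in> subspaces_dim A 1}"
        by (rule bdd_below_Rayleigh[OF A order_refl])
    qed
    then show ?thesis using \<open>Sup S = e / n\<close> n by (simp add: n_def[symmetric] e_def[symmetric] field_simps)
  qed
qed

text \<open>The first \<open>j\<close> of the \<open>l\<close> spanning functions are independent
  again, because coefficients can be padded with zeros.\<close>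

lemma subspaces_dim_subset:
  assumes A: "open A" and j: "j \<le> l" and F: "F \<in> subspaces_dim A l"
  obtains F' where "F' \<in> subspaces_dim A j" "F' \<subseteq> F"
proof -
  obtain us where F_eq: "F = {(\<lambda>x. \<Sum>i<l. c i * us i x) | c. True}" and us: "\<And>i. i < l \<Longrightarrow> W0 A (us i)"
    and ind: "\<And>c. (AE x in lebesgue. x \<in> A \<longrightarrow> (\<Sum>i<l. c i * us i x) = 0) \<Longrightarrow> (\<forall>i<l. c i = 0)"
    using F unfolding subspaces_dim_def by blast
  have ext: "(\<Sum>i<j. c i * us i x) = (\<Sum>i<l. (if i < j then c i else 0) * us i x)" for c x
    using j by (intro sum.mono_neutral_cong_left) auto
  define F' where "F' = {(\<lambda>x. \<Sum>i<j. c i * us i x) | c. True}"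
  have "F' \<in> subspaces_dim A j"
    unfolding subspaces_dim_def
  proof (rule CollectI, rule exI[of _ us], intro conjI allI impI)
    show "F' = {\<lambda>x. \<Sum>i<j. c i * us i x |c. True}" by (simp add: F'_def)
    show "W0 A (us i)" if "i < j" for i using us that j by simp
    fix c i assume "AE x in lebesgue. x \<in> A \<longrightarrow> (\<Sum>i<j. c i * us i x) = 0" and i: "i < j"
    then have "AE x in lebesgue. x \<in> A \<longrightarrow> (\<Sum>i<l. (if i < j then c i else 0) * us i x) = 0"
      by (simp only: ext)
    from ind[OF this] have "i < l \<longrightarrow> (if i < j then c i else 0) = 0" by (rule spec)
    then show "c i = 0" using i j by simp
  qed
  moreover have "F' \<subseteq> F"
  proof
    fix f assume "f \<in> F'"
    then obtain c where "f = (\<lambda>x. \<Sum>i<j. c i * us i x)" by (auto simp: F'_def)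
    then have "f = (\<lambda>x. \<Sum>i<l. (if i < j then c i else 0) * us i x)" by (simp only: ext)
    then show "f \<in> F" unfolding F_eq by (intro CollectI exI conjI TrueI)
  qed
  ultimately show ?thesis using that by blast
qed

text \<open>Every trial space for \<open>l\<close> contains one for \<open>j\<close>, with a smaller
  supremum. If there were no trial space for \<open>l\<close>, the right-hand side would be the
  infimum of the empty set.\<close>

lemma dir_eig_mono:
  assumes A: "open A" and j: "1 \<le> j" "j \<le> l" and ne: "subspaces_dim A l \<noteq> {}"
  shows "dir_eig j A \<le> dir_eig l A"
  unfolding dir_eig_def
proof (rule cInf_mono)
  let ?S = "\<lambda>F. {energy A v |v. v \<in> F \<and> (LINT x:A|lebesgue. (v x)\<^sup>2) = 1}"
  show "{Sup (?S F) |F. F \<in> subspaces_dim A l} \<noteq> {}" using ne by blast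
  show "bdd_below {Sup (?S F) |F. F \<in> subspaces_dim A j}"
    by (rule bdd_below_Rayleigh[OF A j(1)])
  fix b assume "b \<in> {Sup (?S F) |F. F \<in> subspaces_dim A l}"
  then obtain F where F: "F \<in> subspaces_dim A l" "b = Sup (?S F)" by blast
  obtain F' where F': "F' \<in> subspaces_dim A j" "F' \<subseteq> F" using subspaces_dim_subset[OF A j(2) F(1)] by metis
  have "Sup (?S F') \<le> b" unfolding F(2)
  proof (rule cSup_subset_mono)
    show "?S F' \<noteq> {}" by (rule Rayleigh_set_subspace(1)[OF A j(1) F'(1)])
    show "bdd_above (?S F)" by (rule Rayleigh_set_subspace(2)[OF A order_trans[OF j] F(1)])
    show "?S F' \<subseteq> ?S F" using F'(2) by blast
  qed
  then show "\<exists>a\<in>{Sup (?S F) |F. F \<in> subspaces_dim A j}. a \<le> b" using F' by blast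
qed

text \<open>The trial functions are powers of one coordinate times a bump that is positive on a box.
  If a combination vanishes almost everywhere, its polynomial factor vanishes on the whole box by
  continuity and has infinitely many roots.\<close>

lemma subspaces_dim_nonempty:
  fixes A :: "'b::euclidean_space set"
  assumes A: "open A" and ne: "A \<noteq> {}"
  shows "subspaces_dim A l \<noteq> {}"
proof -
  obtain z where z: "z \<in> A" using ne by blast
  obtain a b where ab: "z \<in> box a b" "cbox a b \<subseteq> A"
    using open_contains_cbox[of A z] A z by metis
  define e where "e = (SOME i::'b. i \<in> Basis)"
  have e: "e \<in> Basis" unfolding e_def by (rule someI_ex) (use nonempty_Basis in blast)
  define us where "us i x = (x \<bullet> e) ^ i * box_bump a b 1 x" for i :: nat and x
  have t: "test_fun A (us i)" for i
    unfolding us_def by (intro test_fun_mult_smooth test_fun_box_bump ab smooth_power smooth_inner)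
  have ind: "\<forall>i<l. c i = 0" if ae: "AE x in lebesgue. x \<in> A \<longrightarrow> (\<Sum>i<l. c i * us i x) = 0" for c
  proof -
    define P where "P x = (\<Sum>i<l. c i * (x \<bullet> e) ^ i)" for x
    have "P x = 0" if "x \<in> box a b" "(\<Sum>i<l. c i * us i x) = 0" for x
    proof -
      have "P x * box_bump a b 1 x = 0" using that by (simp add: us_def P_def sum_distrib_right mult.assoc)
      then show "P x = 0" using box_bump_pos[OF zero_less_one that(1)] by simp
    qed
    then have ae': "AE x in lebesgue. \<not> (x \<in> box a b \<and> P x \<noteq> 0)"
      using ae box_subset_cbox[of a b] ab(2) by (elim AE_mp[OF _ AE_I2]) blast
    have op: "open (box a b \<inter> {x. P x \<noteq> 0})"
      unfolding P_def by (intro open_Int open_box open_Collect_neq continuous_intros)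
    have "box a b \<inter> {x. P x \<noteq> 0} \<in> null_sets lebesgue"
      using ae' op by (subst AE_iff_null_sets) (auto simp: borel_open)
    then have "negligible (box a b \<inter> {x. P x \<noteq> 0})" by (simp add: negligible_iff_null_sets)
    with op have P0: "P x = 0" if "x \<in> box a b" for x
      using that open_not_negligible by blast
    have lt: "a \<bullet> e < b \<bullet> e" using ab(1) e by (auto simp: mem_box intro: order_less_trans)
    \<comment> \<open>A coefficient 0 at index \<open>l\<close> brings the sum into the form over
      \<open>i \<le> l\<close> for which \<open>polyfun_finite_roots\<close> counts roots.\<close>
    have "{a \<bullet> e<..<b \<bullet> e} \<subseteq> {s. (\<Sum>i\<le>l. (if i < l then c i else 0) * s ^ i) = 0}"
    proof safe
      fix s assume s: "s \<in> {a \<bullet> e<..<b \<bullet> e}"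
      \<comment> \<open>Moving \<open>z\<close> along \<open>e\<close> inside the box realises every
        value \<open>s\<close> of this coordinate.\<close>
      define y where "y = z + (s - z \<bullet> e) *\<^sub>R e"
      have ye: "y \<bullet> e = s" using e by (simp add: y_def inner_add_left)
      have "y \<bullet> i = z \<bullet> i" if "i \<in> Basis" "i \<noteq> e" for i
        using that e by (simp add: y_def inner_add_left inner_not_same_Basis)
      then have "y \<in> box a b" using s ab(1) ye by (metis greaterThanLessThan_iff mem_box(1))
      then have "P y = 0" by (rule P0)
      then show "(\<Sum>i\<le>l. (if i < l then c i else 0) * s ^ i) = 0"
        unfolding P_def ye by (simp add: lessThan_Suc_atMost[symmetric])
    qed
    then have "infinite {s. (\<Sum>i\<le>l. (if i < l then c i else 0) * s ^ i) = 0}"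
      using finite_subset infinite_Ioo[OF lt] by blast
    then have "\<not> (\<exists>k. k \<le> l \<and> (if k < l then c k else 0) \<noteq> 0)"
      using polyfun_finite_roots[of "\<lambda>i. if i < l then c i else 0" l] by blast
    then show ?thesis by (metis less_imp_le)
  qed
  have "{(\<lambda>x. \<Sum>i<l. c i * us i x) | c. True} \<in> subspaces_dim A l"
    unfolding subspaces_dim_def using test_fun_W0(1)[OF A t] ind by blast
  then show ?thesis by blast
qed

subsection \<open>Comparison with the heat kernel\<close>

text \<open>Extends the defining identity of the weak gradient from test functions to
  \<open>v\<close> in \<open>W0\<close> by approximation; it will be applied with \<open>v\<close> a
  smooth multiple of \<open>u\<close> itself.\<close>

lemma W0_by_parts:
  assumes A: "open A" and u: "weak_grad A u g" and v: "W0 A v" "weak_grad A v h" and b: "b \<in> Basis"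
  shows "(\<integral>x. u x * (h x \<bullet> b) \<partial>lebesgue_on A) = - (\<integral>x. (g x \<bullet> b) * v x \<partial>lebesgue_on A)"
proof -
  note Am = open_sets_lebesgue[OF A]
  obtain \<phi>s where p: "\<And>n. test_fun A (\<phi>s n)" "L2conv (lebesgue_on A) \<phi>s v"
    "L2conv (lebesgue_on A) (\<lambda>n. grad (\<phi>s n)) (wgrad A v)" using W0E[OF A v(1)] by metis
  have h: "L2conv (lebesgue_on A) (\<lambda>n. grad (\<phi>s n)) h"
    by (rule L2conv_cong_AE[OF p(3) weak_grad_sqi(2)[OF A v(2)] wgrad_AE[OF A v(2)]])
  note s = weak_grad_sqi[OF A u]
  have 1: "(\<lambda>n. \<integral>x. u x * (grad (\<phi>s n) x \<bullet> b) \<partial>lebesgue_on A) \<longlonglongrightarrow> (\<integral>x. u x * (h x \<bullet> b) \<partial>lebesgue_on A)"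
    by (intro L2conv_integral_mult L2conv_const s L2conv_inner_const h)
  have 2: "(\<lambda>n. - (\<integral>x. (g x \<bullet> b) * \<phi>s n x \<partial>lebesgue_on A)) \<longlonglongrightarrow> - (\<integral>x. (g x \<bullet> b) * v x \<partial>lebesgue_on A)"
    by (intro tendsto_minus L2conv_integral_mult L2conv_const sqi_inner_const s p)
  have eq: "(\<integral>x. u x * (grad (\<phi>s n) x \<bullet> b) \<partial>lebesgue_on A) = - (\<integral>x. (g x \<bullet> b) * \<phi>s n x \<partial>lebesgue_on A)" for n
    using u p(1)[of n] b unfolding weak_grad_iff[OF Am] by (simp add: grad_inner_Basis)
  show ?thesis by (rule LIMSEQ_unique[OF 1]) (use 2 eq in simp)
qed

text \<open>Testing the equation for \<open>u\<close> with \<open>\<phi> u\<close> and dropping \<open>\<phi> |\<nabla>u|\<^sup>2 \<ge> 0\<close>: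
  \<open>u\<^sup>2\<close> satisfies \<open>- \<Delta> (u\<^sup>2) \<le> 2 \<lambda> u\<^sup>2\<close> on the whole space.\<close>

lemma eigenfunction_square_subsolution:
  assumes A: "open A" and u: "eigenfunction A lam u"
    and sm: "smooth \<phi>" and nn: "\<And>x. 0 \<le> \<phi> x"
    and K: "\<And>x. \<bar>\<phi> x\<bar> \<le> K" "\<And>x. norm (grad \<phi> x) \<le> K"
      "\<And>b x. b \<in> Basis \<Longrightarrow> norm (grad (\<lambda>x. grad \<phi> x \<bullet> b) x) \<le> K"
  shows "0 \<le> (\<integral>x. (u x)\<^sup>2 * ((\<Sum>b\<in>Basis. grad (\<lambda>x. grad \<phi> x \<bullet> b) x \<bullet> b) + 2 * lam * \<phi> x) \<partial>lebesgue_on A)"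
proof -
  let ?M = "lebesgue_on A"
  let ?g = "wgrad A u"
  note W = eigenfunction_W0[OF u]
  note w = W0_weak_grad[OF W]
  note s = W0_sqi[OF A W]
  have smb: "smooth (\<lambda>x. grad \<phi> x \<bullet> b)" if "b \<in> Basis" for b
    unfolding grad_inner_Basis[OF that] by (rule smooth_frechet[OF sm that])
  have Kb: "\<bar>grad \<phi> x \<bullet> b\<bar> \<le> K" if "b \<in> Basis" for b x
    using Basis_le_norm[OF that, of "grad \<phi> x"] K(2)[of x] by simp
  have meas: "\<phi> \<in> borel_measurable ?M" "grad \<phi> \<in> borel_measurable ?M"
    using sm by (auto intro!: borel_measurable_lebesgue_on borel_measurable_continuous_onI smooth_continuous continuous_grad)
  have measb: "(\<lambda>x. grad \<phi> x \<bullet> b) \<in> borel_measurable ?M" "grad (\<lambda>x. grad \<phi> x \<bullet> b) \<in> borel_measurable ?M"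
    if "b \<in> Basis" for b
    using smb[OF that] by (auto intro!: borel_measurable_lebesgue_on borel_measurable_continuous_onI smooth_continuous continuous_grad)
  note m = multiplier_smooth[OF sm K(1,2), of A]
  have g: "sqi ?M (\<lambda>x. \<phi> x *\<^sub>R ?g x)" "sqi ?M (\<lambda>x. u x *\<^sub>R grad \<phi> x)"
    by (intro sqi_scale[OF meas(1) K(1) s(2)] sqi_vec[OF meas(2) K(2) s(1)])+
  have "lam * (\<integral>x. u x * (\<phi> x * u x) \<partial>?M) = (\<integral>x. ?g x \<bullet> (\<phi> x *\<^sub>R ?g x + u x *\<^sub>R grad \<phi> x) \<partial>?M)"
    using eigenfunction_test[OF A u multiplier_W0[OF A m order_refl W]] by simp
  also have "\<dots> = (\<integral>x. ?g x \<bullet> (\<phi> x *\<^sub>R ?g x) \<partial>?M) + (\<integral>x. ?g x \<bullet> (u x *\<^sub>R grad \<phi> x) \<partial>?M)"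
    unfolding inner_add_right by (intro Bochner_Integration.integral_add sqi_inner s g)
  finally have eq: "lam * (\<integral>x. u x * (\<phi> x * u x) \<partial>?M) =
    (\<integral>x. ?g x \<bullet> (\<phi> x *\<^sub>R ?g x) \<partial>?M) + (\<integral>x. ?g x \<bullet> (u x *\<^sub>R grad \<phi> x) \<partial>?M)" .
  have pos: "(\<integral>x. ?g x \<bullet> (\<phi> x *\<^sub>R ?g x) \<partial>?M) \<ge> 0"
    using nn by (intro Bochner_Integration.integral_nonneg) auto
  have "(\<integral>x. ?g x \<bullet> (u x *\<^sub>R grad \<phi> x) \<partial>?M) = (\<integral>x. (\<Sum>b\<in>Basis. u x * (grad \<phi> x \<bullet> b) * (?g x \<bullet> b)) \<partial>?M)"
    by (intro Bochner_Integration.integral_cong refl, subst euclidean_inner) (simp add: mult_ac)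
  also have "\<dots> = (\<Sum>b\<in>Basis. \<integral>x. u x * (grad \<phi> x \<bullet> b) * (?g x \<bullet> b) \<partial>?M)"
    using measb(1) by (intro Bochner_Integration.integral_sum sqi_mult sqi_inner_const s)
       (use sqi_scale[OF measb(1) Kb s(1)] in \<open>simp add: mult.commute\<close>)
  finally have 1: "(\<Sum>b\<in>Basis. \<integral>x. u x * (grad \<phi> x \<bullet> b) * (?g x \<bullet> b) \<partial>?M) \<le> lam * (\<integral>x. u x * (\<phi> x * u x) \<partial>?M)"
    using eq pos by linarith
  \<comment> \<open>Integrating \<open>u\<close> by parts against the \<open>b\<close>-derivative of
    \<open>(grad \<phi> x \<bullet> b) * u x\<close> produces the same term on both sides, whence
    the factor 2.\<close>
  have 2: "2 * (\<integral>x. u x * (grad \<phi> x \<bullet> b) * (?g x \<bullet> b) \<partial>?M) = - (\<integral>x. (u x)\<^sup>2 * (grad (\<lambda>x. grad \<phi> x \<bullet> b) x \<bullet> b) \<partial>?M)"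
    if b: "b \<in> Basis" for b
  proof -
    let ?z = "\<lambda>x. grad \<phi> x \<bullet> b"
    note mb = multiplier_smooth[OF smb[OF b] Kb[OF b] K(3)[OF b], of A]
    have zu: "sqi ?M (\<lambda>x. ?z x * u x)" using sqi_scale[OF measb(1)[OF b] Kb[OF b] s(1)] by simp
    have zg: "sqi ?M (\<lambda>x. u x * (grad ?z x \<bullet> b))"
      using sqi_inner_const[OF sqi_vec[OF measb(2)[OF b] K(3)[OF b] s(1)], of b] by simp
    have "(\<integral>x. u x * ((?z x *\<^sub>R ?g x + u x *\<^sub>R grad ?z x) \<bullet> b) \<partial>?M) = - (\<integral>x. (?g x \<bullet> b) * (?z x * u x) \<partial>?M)"
      by (rule W0_by_parts[OF A w multiplier_W0[OF A mb order_refl W] b])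
    moreover have "(\<integral>x. u x * ((?z x *\<^sub>R ?g x + u x *\<^sub>R grad ?z x) \<bullet> b) \<partial>?M)
      = (\<integral>x. (?z x * u x) * (?g x \<bullet> b) + u x * (u x * (grad ?z x \<bullet> b)) \<partial>?M)"
      by (simp add: inner_add_left algebra_simps)
    moreover have "\<dots> = (\<integral>x. (?z x * u x) * (?g x \<bullet> b) \<partial>?M) + (\<integral>x. u x * (u x * (grad ?z x \<bullet> b)) \<partial>?M)"
      by (intro Bochner_Integration.integral_add sqi_mult zu zg s sqi_inner_const)
    ultimately show ?thesis by (simp add: mult_ac power2_eq_square)
  qed
  have i1: "integrable ?M (\<lambda>x. (u x)\<^sup>2 * (grad (\<lambda>x. grad \<phi> x \<bullet> b) x \<bullet> b))" if b: "b \<in> Basis" for b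
    using sqi_mult[OF s(1) sqi_inner_const[OF sqi_vec[OF measb(2)[OF b] K(3)[OF b] s(1)]], of b]
    by (simp add: power2_eq_square mult.assoc)
  have i2: "integrable ?M (\<lambda>x. (u x)\<^sup>2 * \<phi> x)"
    using sqi_mult[OF s(1) sqi_scale[OF meas(1) K(1) s(1)]] by (simp add: power2_eq_square mult_ac)
  have "(\<integral>x. (u x)\<^sup>2 * ((\<Sum>b\<in>Basis. grad (\<lambda>x. grad \<phi> x \<bullet> b) x \<bullet> b) + 2 * lam * \<phi> x) \<partial>?M) =
    (\<integral>x. (\<Sum>b\<in>Basis. (u x)\<^sup>2 * (grad (\<lambda>x. grad \<phi> x \<bullet> b) x \<bullet> b)) + 2 * lam * ((u x)\<^sup>2 * \<phi> x) \<partial>?M)"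
    by (simp add: distrib_left sum_distrib_left mult_ac)
  also have "\<dots> = (\<Sum>b\<in>Basis. \<integral>x. (u x)\<^sup>2 * (grad (\<lambda>x. grad \<phi> x \<bullet> b) x \<bullet> b) \<partial>?M) + 2 * lam * (\<integral>x. (u x)\<^sup>2 * \<phi> x \<partial>?M)"
    using i1 i2 by (simp add: Bochner_Integration.integral_sum)
  also have "(\<Sum>b\<in>Basis. \<integral>x. (u x)\<^sup>2 * (grad (\<lambda>x. grad \<phi> x \<bullet> b) x \<bullet> b) \<partial>?M) =
    - 2 * (\<Sum>b\<in>Basis. \<integral>x. u x * (grad \<phi> x \<bullet> b) * (?g x \<bullet> b) \<partial>?M)"
    unfolding sum_distrib_left using 2 by (intro sum.cong) auto
  finally show ?thesis using 1 by (simp add: power2_eq_square mult_ac)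
qed

section \<open>Gaussian weights and the heat kernel\<close>

definition gauss :: "real \<Rightarrow> 'b::euclidean_space \<Rightarrow> 'b \<Rightarrow> real" where
  "gauss c x0 x = exp (- (c * ((x - x0) \<bullet> (x - x0))))"

lemma gauss_pos: "gauss c x0 x > 0" and gauss_le_1: "c \<ge> 0 \<Longrightarrow> gauss c x0 x \<le> 1"
  by (auto simp: gauss_def)

lemma smooth_gauss: "smooth (gauss c x0)"
proof -
  have "smooth (\<lambda>x. \<Sum>b\<in>Basis. (x \<bullet> b - x0 \<bullet> b) * (x \<bullet> b - x0 \<bullet> b))"
    by (intro smooth_sum smooth_mult smooth_diff smooth_const smooth_inner finite_Basis)
  then have "smooth (\<lambda>x. (x - x0) \<bullet> (x - x0))"
    by (subst euclidean_inner) (simp add: inner_diff_left)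
  then have "smooth (\<lambda>x. (- c) * ((x - x0) \<bullet> (x - x0)))" by (intro smooth_mult smooth_const)
  from smooth_compose_real[OF smooth_exp this] show ?thesis by (simp add: gauss_def[abs_def])
qed

lemma grad_gauss: "grad (gauss c x0) x = (- 2 * c * gauss c x0 x) *\<^sub>R (x - x0)"
  unfolding gauss_def[abs_def]
  by (rule grad_eqI) (auto intro!: derivative_eq_intros simp: inner_commute algebra_simps)

lemma grad_grad_gauss:
  "grad (\<lambda>x. grad (gauss c x0) x \<bullet> b) x =
    gauss c x0 x *\<^sub>R ((4 * c\<^sup>2 * ((x - x0) \<bullet> b)) *\<^sub>R (x - x0) - (2 * c) *\<^sub>R b)"
proof (rule grad_eqI)
  have g: "(gauss c x0 has_derivative (\<lambda>h. ((- 2 * c * gauss c x0 x) *\<^sub>R (x - x0)) \<bullet> h)) (at x)"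
    using has_derivative_grad[OF smooth_differentiable[OF smooth_gauss]] unfolding grad_gauss .
  have "((\<lambda>x. (- 2 * c) * (gauss c x0 x * ((x - x0) \<bullet> b))) has_derivative
     (\<lambda>h. (- 2 * c) * (gauss c x0 x * (h \<bullet> b) + (((- 2 * c * gauss c x0 x) *\<^sub>R (x - x0)) \<bullet> h) * ((x - x0) \<bullet> b)))) (at x)"
    by (intro has_derivative_mult_right has_derivative_mult g) (auto intro!: derivative_eq_intros)
  moreover have "(\<lambda>x. (- 2 * c) * (gauss c x0 x * ((x - x0) \<bullet> b))) = (\<lambda>x. grad (gauss c x0) x \<bullet> b)"
    by (simp add: grad_gauss mult.assoc)
  moreover have "(\<lambda>h. (- 2 * c) * (gauss c x0 x * (h \<bullet> b) + (((- 2 * c * gauss c x0 x) *\<^sub>R (x - x0)) \<bullet> h) * ((x - x0) \<bullet> b)))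
     = (\<lambda>h. gauss c x0 x *\<^sub>R ((4 * c\<^sup>2 * ((x - x0) \<bullet> b)) *\<^sub>R (x - x0) - (2 * c) *\<^sub>R b) \<bullet> h)"
    by (rule ext) (simp only: inner_diff_left inner_scaleR_left inner_commute[of b], simp add: algebra_simps power2_eq_square)
  ultimately show "((\<lambda>x. grad (gauss c x0) x \<bullet> b) has_derivative
     (\<lambda>h. gauss c x0 x *\<^sub>R ((4 * c\<^sup>2 * ((x - x0) \<bullet> b)) *\<^sub>R (x - x0) - (2 * c) *\<^sub>R b) \<bullet> h)) (at x)" by simp
qed

text \<open>This is \<open>y * exp (- y) \<le> 1\<close> with
  \<open>y = c * (norm (x - x0))\<^sup>2\<close>. It bounds the second derivatives of the Gaussian
  and, later, the error made by freezing the time.\<close>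

lemma gauss_norm_sq_bound:
  assumes "c > 0"
  shows "c * gauss c x0 x * (norm (x - x0))\<^sup>2 \<le> 1"
proof -
  define y where "y = c * (norm (x - x0))\<^sup>2"
  have "y \<le> exp y" using exp_ge_add_one_self[of y] by linarith
  then have "y * exp (- y) \<le> 1" by (simp add: exp_minus field_simps)
  then show ?thesis unfolding y_def gauss_def dot_square_norm by (simp only: mult_ac)
qed

lemma gauss_norm_bound:
  assumes "c > 0"
  shows "c * gauss c x0 x * norm (x - x0) \<le> 1 + c"
proof (cases "norm (x - x0) \<le> 1")
  case True
  have "c * gauss c x0 x * norm (x - x0) \<le> c * 1 * 1"
    using assms gauss_pos[of c x0 x] gauss_le_1[of c x0 x] True by (intro mult_mono) auto
  then show ?thesis by simp
next
  case False
  then have "norm (x - x0) \<le> (norm (x - x0))\<^sup>2" using mult_left_mono[of 1 "norm (x - x0)" "norm (x - x0)"] by (simp add: power2_eq_square)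
  then have "c * gauss c x0 x * norm (x - x0) \<le> c * gauss c x0 x * (norm (x - x0))\<^sup>2"
    using assms gauss_pos[of c x0 x] by (intro mult_left_mono) auto
  then show ?thesis using gauss_norm_sq_bound[OF assms, of x0 x] assms by linarith
qed

text \<open>The bracket without \<open>2 * lam\<close> is the Laplacian of the Gaussian divided by
  the Gaussian. For \<open>c = 1 / (4 * s)\<close> it is also the logarithmic time derivative of the
  heat kernel at time \<open>s\<close>, which is how an inequality in space becomes one in
  time.\<close>

lemma eigenfunction_gauss:
  fixes A :: "'b::euclidean_space set"
  assumes A: "open A" and u: "eigenfunction A lam u" and c: "c > 0"
  shows "0 \<le> (\<integral>x. (u x)\<^sup>2 * (gauss c x0 x * (4 * c\<^sup>2 * (norm (x - x0))\<^sup>2 - 2 * c * DIM('b) + 2 * lam)) \<partial>lebesgue_on A)"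
proof -
  have "0 \<le> (\<integral>x. (u x)\<^sup>2 * ((\<Sum>b\<in>Basis. grad (\<lambda>x. grad (gauss c x0) x \<bullet> b) x \<bullet> b) + 2 * lam * gauss c x0 x) \<partial>lebesgue_on A)"
  \<comment> \<open>\<open>3 + 6 * c\<close> dominates at once the bounds 1 for the Gaussian,
    \<open>2 * (1 + c)\<close> for its gradient and \<open>6 * c\<close> for the second
    derivatives.\<close>
  proof (rule eigenfunction_square_subsolution[OF A u smooth_gauss, where K="3 + 6 * c"])
    show "0 \<le> gauss c x0 x" for x using gauss_pos[of c x0 x] by simp
    show "\<bar>gauss c x0 x\<bar> \<le> 3 + 6 * c" for x using gauss_pos[of c x0 x] gauss_le_1[of c x0 x] c by simp
    show "norm (grad (gauss c x0) x) \<le> 3 + 6 * c" for x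
    proof -
      have "norm (grad (gauss c x0) x) = 2 * (c * gauss c x0 x * norm (x - x0))"
        using gauss_pos[of c x0 x] c by (simp add: grad_gauss abs_mult)
      then show ?thesis using gauss_norm_bound[OF c, of x0 x] c by linarith
    qed
    fix b :: 'b and x assume b: "b \<in> Basis"
    have "norm (grad (\<lambda>x. grad (gauss c x0) x \<bullet> b) x) \<le>
      gauss c x0 x * (norm ((4 * c\<^sup>2 * ((x - x0) \<bullet> b)) *\<^sub>R (x - x0)) + norm ((2 * c) *\<^sub>R b))"
      unfolding grad_grad_gauss norm_scaleR[of "gauss c x0 x"]
      using gauss_pos[of c x0 x] by (intro mult_mono norm_triangle_ineq4) auto
    also have "\<dots> \<le> gauss c x0 x * (4 * c\<^sup>2 * (norm (x - x0))\<^sup>2 + 2 * c)"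
    proof -
      have "\<bar>(x - x0) \<bullet> b\<bar> \<le> norm (x - x0)" by (rule Basis_le_norm[OF b])
      then have "\<bar>(x - x0) \<bullet> b\<bar> * norm (x - x0) \<le> (norm (x - x0))\<^sup>2"
        unfolding power2_eq_square by (rule mult_right_mono) simp
      then have "4 * c\<^sup>2 * (\<bar>(x - x0) \<bullet> b\<bar> * norm (x - x0)) \<le> 4 * c\<^sup>2 * (norm (x - x0))\<^sup>2"
        by (rule mult_left_mono) simp
      then show ?thesis using gauss_pos[of c x0 x] c b by (intro mult_left_mono add_mono) (auto simp: abs_mult mult_ac)
    qed
    also have "\<dots> = 4 * c * (c * gauss c x0 x * (norm (x - x0))\<^sup>2) + 2 * c * gauss c x0 x"
      by (simp add: algebra_simps power2_eq_square)
    also have "\<dots> \<le> 4 * c * 1 + 2 * c * 1"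
      using gauss_norm_sq_bound[OF c, of x0 x] gauss_le_1[of c x0 x] c
      by (intro add_mono mult_left_mono) auto
    finally show "norm (grad (\<lambda>x. grad (gauss c x0) x \<bullet> b) x) \<le> 3 + 6 * c" using c by simp
  qed
  also have "(\<lambda>x. (\<Sum>b\<in>Basis. grad (\<lambda>x. grad (gauss c x0) x \<bullet> b) x \<bullet> b) + 2 * lam * gauss c x0 x)
     = (\<lambda>x. gauss c x0 x * (4 * c\<^sup>2 * (norm (x - x0))\<^sup>2 - 2 * c * DIM('b) + 2 * lam))"
  proof
    fix x
    have "(\<Sum>b\<in>Basis. grad (\<lambda>x. grad (gauss c x0) x \<bullet> b) x \<bullet> b) =
      (\<Sum>b\<in>Basis. gauss c x0 x * (4 * c\<^sup>2 * ((x - x0) \<bullet> b * ((x - x0) \<bullet> b)) - 2 * c))"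
      by (intro sum.cong) (auto simp: grad_grad_gauss inner_diff_left algebra_simps)
    also have "\<dots> = gauss c x0 x * (4 * c\<^sup>2 * (\<Sum>b\<in>Basis. (x - x0) \<bullet> b * ((x - x0) \<bullet> b)) - 2 * c * DIM('b))"
      by (simp add: sum_subtractf sum_distrib_left right_diff_distrib)
    also have "(\<Sum>b\<in>Basis. (x - x0) \<bullet> b * ((x - x0) \<bullet> b)) = (norm (x - x0))\<^sup>2"
      by (subst power2_norm_eq_inner, subst (3) euclidean_inner) simp
    finally show "(\<Sum>b\<in>Basis. grad (\<lambda>x. grad (gauss c x0) x \<bullet> b) x \<bullet> b) + 2 * lam * gauss c x0 x
     = gauss c x0 x * (4 * c\<^sup>2 * (norm (x - x0))\<^sup>2 - 2 * c * DIM('b) + 2 * lam)"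
      by (simp add: algebra_simps)
  qed
  finally show ?thesis .
qed

text \<open>The factor \<open>(4 * pi) powr (- (DIM('b) / 2))\<close> of the usual kernel is left
  out, so the total mass is \<open>sqrt (4 * pi) ^ DIM('b)\<close>; this number reappears in front
  of \<open>(u x)\<^sup>2\<close> in the pointwise bounds.\<close>

definition heat :: "real \<Rightarrow> 'b::euclidean_space \<Rightarrow> real" where
  "heat t y = t powr (- (DIM('b) / 2)) * exp (- ((norm y)\<^sup>2 / (4 * t)))"

lemma heat_pos: "t > 0 \<Longrightarrow> heat t y > 0" by (simp add: heat_def)

lemma heat_nonneg[simp]: "0 \<le> heat t y" by (simp add: heat_def)

lemma heat_eq_gauss: "heat t (x - x0) = t powr (- (DIM('b) / 2)) * gauss (1 / (4 * t)) x0 x"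
  for x :: "'b::euclidean_space"
  by (simp add: heat_def gauss_def power2_norm_eq_inner)

lemma heat_le: "t > 0 \<Longrightarrow> heat t y \<le> t powr (- (DIM('b) / 2))" for y :: "'b::euclidean_space"
  unfolding heat_def by (simp add: mult_le_cancel_left1)

lemma borel_measurable_heat[measurable]: "heat t \<in> borel_measurable borel"
  unfolding heat_def[abs_def] by measurable

text \<open>A substitute for the heat equation that avoids differentiating under the integral sign; it
  follows from \<open>exp a \<ge> 1 + a\<close>, the last term being the error made by freezing the time at \<open>s\<close>.\<close>

lemma heat_increment:
  fixes y :: "'b::euclidean_space"
  assumes s: "0 < s" and st: "s \<le> t" and lam: "lam \<ge> 0"
  shows "exp (2 * lam * t) * heat t y \<ge> exp (2 * lam * s) * heat s y +
     (t - s) * (exp (2 * lam * s) * heat s y * ((norm y)\<^sup>2 / (4 * s\<^sup>2) - DIM('b) / (2 * s) + 2 * lam))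
     - (t - s)\<^sup>2 * (exp (2 * lam * s) * s powr (- (DIM('b) / 2)) / (s * t))"
proof -
  define N where "N = real DIM('b)"
  define r where "r = (norm y)\<^sup>2"
  define Ks where "Ks = exp (2 * lam * s) * heat s y"
  have r: "r \<ge> 0" by (simp add: r_def)
  have t: "t > 0" using s st by simp
  have Ks_eq: "Ks = exp (2 * lam * s - N / 2 * ln s - r / (4 * s))"
    using s unfolding Ks_def heat_def powr_def N_def r_def
    by (simp add: exp_add[symmetric] algebra_simps)
  have Kt_eq: "exp (2 * lam * t) * heat t y = exp (2 * lam * t - N / 2 * ln t - r / (4 * t))"
    using t unfolding heat_def powr_def N_def r_def
    by (simp add: exp_add[symmetric] algebra_simps)
  \<comment> \<open>The logarithm of the quotient of the weighted kernels at the times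
    \<open>t\<close> and \<open>s\<close>.\<close>
  define a where "a = 2 * lam * (t - s) - N / 2 * (ln t - ln s) + r / 4 * (1 / s - 1 / t)"
  have "exp (2 * lam * t) * heat t y = Ks * exp a"
    unfolding Ks_eq Kt_eq a_def exp_add[symmetric] by (rule arg_cong[of _ _ exp]) (simp add: field_simps)
  moreover have Ks: "Ks > 0" by (simp add: Ks_eq)
  ultimately have 1: "exp (2 * lam * t) * heat t y \<ge> Ks * (1 + a)"
    using exp_ge_add_one_self[of a] by (simp add: mult_left_mono)
  have "ln t - ln s = ln (t / s)" using s t by (simp add: ln_div)
  also have "\<dots> \<le> t / s - 1" using s t by (intro ln_le_minus_one) simp
  also have "\<dots> = (t - s) / s" using s by (simp add: field_simps)
  finally have "N / 2 * (ln t - ln s) \<le> N / 2 * ((t - s) / s)" by (intro mult_left_mono) (auto simp: N_def)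
  \<comment> \<open>Writing \<open>s / t = 1 - (t - s) / t\<close> separates the derivative at time
    \<open>s\<close> from a term quadratic in \<open>t - s\<close>.\<close>
  moreover have "r / 4 * (1 / s - 1 / t) = (t - s) * (r / (4 * s\<^sup>2)) - (t - s)\<^sup>2 * (r / (4 * s\<^sup>2 * t))"
    using s t by (simp add: field_simps power2_eq_square)
  ultimately have "a \<ge> (t - s) * (r / (4 * s\<^sup>2) - N / (2 * s) + 2 * lam) - (t - s)\<^sup>2 * (r / (4 * s\<^sup>2 * t))"
    unfolding a_def by (simp add: algebra_simps)
  then have "Ks * (1 + a) \<ge> Ks * (1 + ((t - s) * (r / (4 * s\<^sup>2) - N / (2 * s) + 2 * lam) - (t - s)\<^sup>2 * (r / (4 * s\<^sup>2 * t))))"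
    using Ks by (intro mult_left_mono) auto
  also have "Ks * (1 + ((t - s) * (r / (4 * s\<^sup>2) - N / (2 * s) + 2 * lam) - (t - s)\<^sup>2 * (r / (4 * s\<^sup>2 * t)))) =
    Ks + (t - s) * (Ks * (r / (4 * s\<^sup>2) - N / (2 * s) + 2 * lam)) - (t - s)\<^sup>2 * (Ks * (r / (4 * s)) / (s * t))"
    using s t by (simp add: field_simps power2_eq_square)
  finally have 2: "Ks * (1 + a) \<ge> \<dots>" .
  \<comment> \<open>The Gaussian factor in \<open>Ks\<close> absorbs \<open>r\<close>, so the
    quadratic error becomes independent of the point.\<close>
  have "Ks * (r / (4 * s)) \<le> exp (2 * lam * s) * s powr (- (DIM('b) / 2))"
  proof -
    have "(1 / (4 * s)) * gauss (1 / (4 * s)) 0 y * (norm (y - 0))\<^sup>2 \<le> 1"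
      by (rule gauss_norm_sq_bound) (use s in simp)
    then have "exp (2 * lam * s) * s powr (- (DIM('b) / 2)) * ((1 / (4 * s)) * gauss (1 / (4 * s)) 0 y * (norm (y - 0))\<^sup>2)
      \<le> exp (2 * lam * s) * s powr (- (DIM('b) / 2)) * 1" by (intro mult_left_mono) auto
    then show ?thesis using heat_eq_gauss[of s y 0] by (simp add: Ks_def r_def mult_ac)
  qed
  then have "(t - s)\<^sup>2 * (Ks * (r / (4 * s)) / (s * t)) \<le> (t - s)\<^sup>2 * (exp (2 * lam * s) * s powr (- (DIM('b) / 2)) / (s * t))"
    using s t by (intro mult_left_mono divide_right_mono) auto
  then show ?thesis using 1 2 unfolding Ks_def[symmetric] r_def[symmetric] N_def[symmetric] by linarith
qed

text \<open>Cutting the interval into \<open>n + 1\<close> equal pieces leaves a total loss of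
  \<open>C * (t - s)\<^sup>2 / (n + 1)\<close>, which tends to 0.\<close>

lemma mono_if_quadratic_increments:
  fixes H :: "real \<Rightarrow> real"
  assumes st: "s \<le> t" and inc: "\<And>a b. s \<le> a \<Longrightarrow> a \<le> b \<Longrightarrow> b \<le> t \<Longrightarrow> H a - C * (b - a)\<^sup>2 \<le> H b"
  shows "H s \<le> H t"
proof -
  have "H s - C * (t - s)\<^sup>2 / real (Suc n) \<le> H t" for n
  proof -
    define h where "h = (t - s) / real (Suc n)"
    have h: "h \<ge> 0" using st by (simp add: h_def)
    have "H s - real i * (C * h\<^sup>2) \<le> H (s + real i * h)" if "i \<le> Suc n" for i
      using that
    proof (induction i)
      case (Suc i)
      have "real (Suc i) * h \<le> real (Suc n) * h" using Suc.prems h by (intro mult_right_mono) auto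
      then have le: "s + real (Suc i) * h \<le> t" by (simp add: h_def)
      have "H (s + real i * h) - C * (s + real (Suc i) * h - (s + real i * h))\<^sup>2 \<le> H (s + real (Suc i) * h)"
        using h le by (intro inc) (auto simp: algebra_simps)
      then have "H (s + real i * h) - C * h\<^sup>2 \<le> H (s + real (Suc i) * h)" by (simp add: algebra_simps)
      then show ?case using Suc by (simp add: algebra_simps)
    qed simp
    from this[of "Suc n"] have "H s - real (Suc n) * (C * h\<^sup>2) \<le> H (s + real (Suc n) * h)" by simp
    moreover have "real (Suc n) * (C * h\<^sup>2) = C * (t - s)\<^sup>2 / real (Suc n)"
      by (simp add: h_def power2_eq_square)
    moreover have "s + real (Suc n) * h = t" by (simp add: h_def)
    ultimately show ?thesis by simp
  qed
  moreover have "(\<lambda>n. H s - C * (t - s)\<^sup>2 * inverse (real (Suc n))) \<longlonglongrightarrow> H s - C * (t - s)\<^sup>2 * 0"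
    by (intro tendsto_intros LIMSEQ_inverse_real_of_nat)
  ultimately show ?thesis by (intro LIMSEQ_le_const2[of _ "H s"]) (auto simp: field_simps)
qed

text \<open>The pointwise increment inequality is integrated against \<open>(u y)\<^sup>2\<close>.
  The term linear in the time step is nonnegative by \<open>eigenfunction_gauss\<close>, so only a
  quadratic loss remains.\<close>

lemma eigenfunction_heat_mono:
  fixes A :: "'b::euclidean_space set"
  assumes A: "open A" and u: "eigenfunction A lam u" and s: "0 < s" and st: "s \<le> t"
  shows "exp (2 * lam * s) * (\<integral>y. (u y)\<^sup>2 * heat s (y - x0) \<partial>lebesgue_on A)
       \<le> exp (2 * lam * t) * (\<integral>y. (u y)\<^sup>2 * heat t (y - x0) \<partial>lebesgue_on A)"
proof -
  let ?M = "lebesgue_on A"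
  note lam = eigenvalue_nonneg[OF A u]
  note sq = W0_sqi(1)[OF A eigenfunction_W0[OF u]]
  define n where "n = (\<integral>y. (u y)\<^sup>2 \<partial>?M)"
  have n: "n \<ge> 0" unfolding n_def by (intro Bochner_Integration.integral_nonneg) auto
  have ib: "integrable ?M (\<lambda>y. (u y)\<^sup>2 * f y)" if "f \<in> borel_measurable borel" "\<And>y. \<bar>f y\<bar> \<le> K" for f and K :: real
    using sqi_mult[OF sq sqi_scale[OF borel_measurable_lebesgue_on[OF that(1)] that(2) sq]]
    by (simp add: power2_eq_square mult_ac)
  have ih: "integrable ?M (\<lambda>y. (u y)\<^sup>2 * heat a (y - x0))" if "a > 0" for a
  proof (rule ib)
    show "\<bar>heat a (y - x0)\<bar> \<le> a powr (- (DIM('b) / 2))" for y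
      using heat_le[OF that, of "y - x0"] heat_pos[OF that, of "y - x0"] by simp
  qed measurable
  define H where "H a = (\<integral>y. (u y)\<^sup>2 * (exp (2 * lam * a) * heat a (y - x0)) \<partial>?M)" for a
  \<comment> \<open>Bounds the loss for all \<open>a \<le> b\<close> between \<open>s\<close> and
    \<open>t\<close> at once: the negative power and \<open>1 / (a * b)\<close> are largest at
    \<open>s\<close>, the exponential at \<open>t\<close>.\<close>
  define C where "C = n * (exp (2 * lam * t) * s powr (- (DIM('b) / 2)) / (s * s))"
  have "H s \<le> H t"
  proof (rule mono_if_quadratic_increments[OF st, where C=C])
    fix a b assume ab: "s \<le> a" "a \<le> b" "b \<le> t"
    have a: "a > 0" using s ab by simp
    define q where "q y = exp (2 * lam * a) * heat a (y - x0) * ((norm (y - x0))\<^sup>2 / (4 * a\<^sup>2) - DIM('b) / (2 * a) + 2 * lam)" for y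
    have q_eq: "q y = exp (2 * lam * a) * a powr (- (DIM('b) / 2)) *
       (gauss (1 / (4 * a)) x0 y * (4 * (1 / (4 * a))\<^sup>2 * (norm (y - x0))\<^sup>2 - 2 * (1 / (4 * a)) * DIM('b) + 2 * lam))" for y
      unfolding q_def heat_eq_gauss using a by (simp add: field_simps power2_eq_square)
    have "0 \<le> exp (2 * lam * a) * a powr (- (DIM('b) / 2)) * (\<integral>y. (u y)\<^sup>2 * (gauss (1 / (4 * a)) x0 y *
       (4 * (1 / (4 * a))\<^sup>2 * (norm (y - x0))\<^sup>2 - 2 * (1 / (4 * a)) * DIM('b) + 2 * lam)) \<partial>?M)"
      using a by (intro mult_nonneg_nonneg eigenfunction_gauss[OF A u]) auto
    then have q0: "0 \<le> (\<integral>y. (u y)\<^sup>2 * q y \<partial>?M)" unfolding q_eq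
      by (subst (asm) integral_mult_right_zero[symmetric]) (simp add: mult_ac)
    have [measurable]: "q \<in> borel_measurable borel" unfolding q_def[abs_def] by measurable
    have iq: "integrable ?M (\<lambda>y. (u y)\<^sup>2 * q y)"
    proof (rule ib)
      fix y
      define g where "g = gauss (1 / (4 * a)) x0 y"
      have g: "0 < g" "g \<le> 1" "1 / (4 * a) * g * (norm (y - x0))\<^sup>2 \<le> 1"
        unfolding g_def using a gauss_norm_sq_bound[of "1 / (4 * a)" x0 y] by (auto simp: gauss_pos intro: gauss_le_1)
      have "\<bar>g * (4 * (1 / (4 * a))\<^sup>2 * (norm (y - x0))\<^sup>2 - 2 * (1 / (4 * a)) * DIM('b) + 2 * lam)\<bar> =
        \<bar>1 / a * (1 / (4 * a) * g * (norm (y - x0))\<^sup>2) - g * (2 * (1 / (4 * a)) * DIM('b)) + g * (2 * lam)\<bar>"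
        using a by (simp add: field_simps power2_eq_square)
      also have "\<dots> \<le> \<bar>1 / a * (1 / (4 * a) * g * (norm (y - x0))\<^sup>2)\<bar> + \<bar>g * (2 * (1 / (4 * a)) * DIM('b))\<bar> + \<bar>g * (2 * lam)\<bar>"
        by linarith
      also have "\<dots> \<le> 1 / a * 1 + 1 * (2 * (1 / (4 * a)) * DIM('b)) + 1 * (2 * lam)"
        unfolding abs_mult[of g] abs_mult[of "1 / a" "1 / (4 * a) * g * (norm (y - x0))\<^sup>2"] using g a lam
        by (intro add_mono mult_mono) (auto simp: abs_mult)
      finally show "\<bar>q y\<bar> \<le> exp (2 * lam * a) * a powr (- (DIM('b) / 2)) * (1 / a * 1 + 1 * (2 * (1 / (4 * a)) * DIM('b)) + 1 * (2 * lam))"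
        unfolding q_eq g_def[symmetric] abs_mult[of "exp (2 * lam * a) * a powr (- (DIM('b) / 2))"]
        by (intro mult_mono) auto
    qed measurable
    have i1: "integrable ?M (\<lambda>y. (u y)\<^sup>2 * (exp (2 * lam * c) * heat c (y - x0)))" if "c > 0" for c
      using integrable_mult_right[OF ih[OF that], of "exp (2 * lam * c)"] by (simp add: mult_ac)
    define E where "E = exp (2 * lam * a) * a powr (- (DIM('b) / 2)) / (a * b)"
    have EC: "n * E \<le> C"
    proof -
      have "a powr (- (DIM('b) / 2)) \<le> s powr (- (DIM('b) / 2))" using s ab by (intro powr_mono2') auto
      moreover have "exp (2 * lam * a) \<le> exp (2 * lam * t)" using ab lam by (simp add: mult_left_mono)
      ultimately show ?thesis unfolding E_def C_def using s ab n
        by (intro mult_left_mono frac_le mult_mono) auto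
    qed
    have "H a - C * (b - a)\<^sup>2 \<le> H a + (b - a) * (\<integral>y. (u y)\<^sup>2 * q y \<partial>?M) - (b - a)\<^sup>2 * E * n"
    proof -
      have "(b - a) * (\<integral>y. (u y)\<^sup>2 * q y \<partial>?M) \<ge> 0" using q0 ab by (intro mult_nonneg_nonneg) auto
      moreover have "(b - a)\<^sup>2 * E * n \<le> C * (b - a)\<^sup>2" using mult_right_mono[OF EC, of "(b - a)\<^sup>2"] by (simp add: mult_ac)
      ultimately show ?thesis by linarith
    qed
    also have "\<dots> = (\<integral>y. (u y)\<^sup>2 * (exp (2 * lam * a) * heat a (y - x0)) + (b - a) * ((u y)\<^sup>2 * q y) - ((b - a)\<^sup>2 * E) * (u y)\<^sup>2 \<partial>?M)"
      unfolding H_def n_def using i1[OF a] iq sqi_power2[OF sq] by simp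
    also have "\<dots> \<le> H b"
      unfolding H_def
    proof (rule integral_mono)
      show "integrable ?M (\<lambda>y. (u y)\<^sup>2 * (exp (2 * lam * a) * heat a (y - x0)) + (b - a) * ((u y)\<^sup>2 * q y) - ((b - a)\<^sup>2 * E) * (u y)\<^sup>2)"
        using i1[OF a] iq sqi_power2[OF sq] by simp
      show "integrable ?M (\<lambda>y. (u y)\<^sup>2 * (exp (2 * lam * b) * heat b (y - x0)))" using i1 a ab by simp
      fix y
      have "(u y)\<^sup>2 * (exp (2 * lam * b) * heat b (y - x0)) \<ge> (u y)\<^sup>2 *
        (exp (2 * lam * a) * heat a (y - x0) + (b - a) * q y - (b - a)\<^sup>2 * E)"
        unfolding q_def E_def by (intro mult_left_mono heat_increment a ab lam) auto
      then show "(u y)\<^sup>2 * (exp (2 * lam * a) * heat a (y - x0)) + (b - a) * ((u y)\<^sup>2 * q y) - ((b - a)\<^sup>2 * E) * (u y)\<^sup>2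
        \<le> (u y)\<^sup>2 * (exp (2 * lam * b) * heat b (y - x0))"
        by (simp add: algebra_simps)
    qed
    finally show "H a - C * (b - a)\<^sup>2 \<le> H b" .
  qed
  moreover have "H a = exp (2 * lam * a) * (\<integral>y. (u y)\<^sup>2 * heat a (y - x0) \<partial>?M)" for a
    unfolding H_def by (subst integral_mult_right_zero[symmetric]) (simp add: mult_ac)
  ultimately show ?thesis by simp
qed

text \<open>In one variable the integrand is \<open>sqrt (4 * pi)\<close> times the normal density
  of variance 2; in general it factors over the coordinates.\<close>

lemma nn_integral_gauss:
  "(\<integral>\<^sup>+z. ennreal (exp (- ((norm z)\<^sup>2 / 4))) \<partial>(lborel :: 'b::euclidean_space measure)) = ennreal (sqrt (4 * pi) ^ DIM('b))"
proof -
  have eq: "exp (- (x\<^sup>2 / 4)) = sqrt (4 * pi) * normal_density 0 (sqrt 2) x" for x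
    by (simp add: normal_density_def)
  have 1: "(\<integral>\<^sup>+x. ennreal (exp (- (x\<^sup>2 / 4))) \<partial>lborel) = ennreal (sqrt (4 * pi))"
    unfolding eq using integrable_normal_density[of "sqrt 2" 0] integral_normal_density[of "sqrt 2" 0]
    by (subst nn_integral_eq_integral) auto
  have "exp (- ((norm z)\<^sup>2 / 4)) = (\<Prod>b\<in>Basis. exp (- ((z \<bullet> b)\<^sup>2 / 4)))" for z :: 'b
    unfolding exp_sum[OF finite_Basis, symmetric] power2_norm_eq_inner
    by (subst euclidean_inner) (simp add: power2_eq_square sum_negf sum_divide_distrib)
  then have "(\<integral>\<^sup>+z. ennreal (exp (- ((norm (z::'b))\<^sup>2 / 4))) \<partial>lborel) = (\<integral>\<^sup>+z. (\<Prod>b\<in>Basis. ennreal (exp (- (((z::'b) \<bullet> b)\<^sup>2 / 4)))) \<partial>lborel)"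
    by (simp add: prod_ennreal)
  also have "\<dots> = (\<Prod>b\<in>(Basis::'b set). \<integral>\<^sup>+x. ennreal (exp (- (x\<^sup>2 / 4))) \<partial>lborel)"
    by (rule nn_integral_lborel_prod) auto
  also have "\<dots> = ennreal (sqrt (4 * pi) ^ DIM('b))"
    unfolding 1 by (simp add: ennreal_power)
  finally show ?thesis .
qed

text \<open>After exchanging the integrals, \<open>x = y + sqrt s *\<^sub>R z\<close> makes the
  Gaussian independent of \<open>s\<close>: the time survives only inside the indicator, where the
  limit \<open>s\<close> to 0 can be read off.\<close>

lemma heat_tonelli:
  fixes w :: "'b::euclidean_space \<Rightarrow> real"
  assumes [measurable]: "w \<in> borel_measurable borel" "U \<in> sets borel" and s: "s > 0"
  shows "(\<integral>\<^sup>+x. indicator U x * (\<integral>\<^sup>+y. ennreal (w y) * heat s (y - x) \<partial>lborel) \<partial>lborel) =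
    (\<integral>\<^sup>+y. (\<integral>\<^sup>+z. ennreal (w y) * (indicator U (y + sqrt s *\<^sub>R z) * ennreal (exp (- ((norm z)\<^sup>2 / 4)))) \<partial>lborel) \<partial>lborel)"
proof -
  have J: "(\<integral>\<^sup>+x. indicator U x * ennreal (heat s (y - x)) \<partial>lborel) =
    (\<integral>\<^sup>+z. indicator U (y + sqrt s *\<^sub>R z) * ennreal (exp (- ((norm z)\<^sup>2 / 4))) \<partial>lborel)" for y :: 'b
  proof -
    have "(\<integral>\<^sup>+x. indicator U x * ennreal (heat s (y - x)) \<partial>lborel) =
      (\<integral>\<^sup>+x. indicator U x * ennreal (heat s (y - x)) \<partial>density (distr lborel borel (\<lambda>z. y + sqrt s *\<^sub>R z)) (\<lambda>_. \<bar>sqrt s\<bar> ^ DIM('b)))"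
      using s by (subst lborel_affine[of "sqrt s" y, symmetric]) auto
    also have "\<dots> = (\<integral>\<^sup>+z. ennreal (sqrt s ^ DIM('b)) * (indicator U (y + sqrt s *\<^sub>R z) * ennreal (heat s (sqrt s *\<^sub>R z))) \<partial>lborel)"
      using s by (simp add: nn_integral_density nn_integral_distr heat_def)
    also have "\<dots> = (\<integral>\<^sup>+z. indicator U (y + sqrt s *\<^sub>R z) * ennreal (exp (- ((norm z)\<^sup>2 / 4))) \<partial>lborel)"
    proof (intro nn_integral_cong)
      fix z :: 'b
      have "sqrt s ^ DIM('b) * heat s (sqrt s *\<^sub>R z) = exp (- ((norm z)\<^sup>2 / 4))"
        using s by (simp add: heat_def power_mult_distrib powr_minus powr_half_sqrt[symmetric] powr_powr powr_realpow[symmetric])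
      then show "ennreal (sqrt s ^ DIM('b)) * (indicator U (y + sqrt s *\<^sub>R z) * ennreal (heat s (sqrt s *\<^sub>R z))) =
        indicator U (y + sqrt s *\<^sub>R z) * ennreal (exp (- ((norm z)\<^sup>2 / 4)))"
        using s heat_pos[OF s, of "sqrt s *\<^sub>R z"] by (simp add: ennreal_mult'[symmetric] mult.left_commute[of "ennreal _" "indicator _ _"])
    qed
    finally show ?thesis .
  qed
  have "(\<integral>\<^sup>+x. indicator U x * (\<integral>\<^sup>+y. ennreal (w y) * heat s (y - x) \<partial>lborel) \<partial>lborel) =
    (\<integral>\<^sup>+x. \<integral>\<^sup>+y. indicator U x * (ennreal (w y) * heat s (y - x)) \<partial>lborel \<partial>lborel)"
    by (intro nn_integral_cong nn_integral_cmult[symmetric]) measurable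
  also have "\<dots> = (\<integral>\<^sup>+y. \<integral>\<^sup>+x. indicator U x * (ennreal (w y) * heat s (y - x)) \<partial>lborel \<partial>lborel)"
    by (rule lborel_pair.Fubini') measurable
  also have "\<dots> = (\<integral>\<^sup>+y. ennreal (w y) * (\<integral>\<^sup>+x. indicator U x * ennreal (heat s (y - x)) \<partial>lborel) \<partial>lborel)"
    by (intro nn_integral_cong, subst nn_integral_cmult[symmetric]) (measurable, simp add: mult_ac)
  also have "\<dots> = (\<integral>\<^sup>+y. (\<integral>\<^sup>+z. ennreal (w y) * (indicator U (y + sqrt s *\<^sub>R z) * ennreal (exp (- ((norm z)\<^sup>2 / 4)))) \<partial>lborel) \<partial>lborel)"
    unfolding J by (intro nn_integral_cong nn_integral_cmult[symmetric]) measurable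
  finally show ?thesis .
qed

text \<open>The integrals of both sides over every open set are compared by Fatou's lemma as \<open>s\<close> tends to 0.\<close>

lemma heat_initial_value_le:
  fixes w :: "'b::euclidean_space \<Rightarrow> real"
  assumes w[measurable]: "w \<in> borel_measurable borel" and w0: "\<And>x. 0 \<le> w x" and iw: "integrable lborel w"
    and B0: "\<And>x. 0 \<le> B x" and iB: "integrable lborel B" and t: "t > 0"
    and le: "\<And>s x. 0 < s \<Longrightarrow> s \<le> t \<Longrightarrow> (\<integral>\<^sup>+y. ennreal (w y) * heat s (y - x) \<partial>lborel) \<le> ennreal (B x)"
  shows "AE x in lebesgue. sqrt (4 * pi) ^ DIM('b) * w x \<le> B x"
proof -
  define I where "I = sqrt (4 * pi) ^ DIM('b)"
  have I: "I \<ge> 0" by (simp add: I_def)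
  have Bm[measurable]: "B \<in> borel_measurable borel" using borel_measurable_integrable[OF iB] by simp
  have fi: "integrable lborel (\<lambda>x. B x - I * w x)" using iw iB by simp
  then have fl: "integrable lebesgue (\<lambda>x. B x - I * w x)"
    by (subst integrable_completion) (use borel_measurable_integrable[OF fi] in auto)
  have "AE x in lebesgue. 0 \<le> B x - I * w x"
  proof (rule AE_nonneg_if_integral_open_nonneg[OF fl])
    fix U :: "'b set" assume U: "open U"
    then have [measurable]: "U \<in> sets borel" by simp
    define s where "s n = t / real (Suc n)" for n
    have s: "s n > 0" "s n \<le> t" for n using t by (auto simp: s_def field_simps)
    have s0: "s \<longlonglongrightarrow> 0"
      using tendsto_mult[OF tendsto_const[of t] LIMSEQ_inverse_real_of_nat] by (simp add: s_def[abs_def] divide_inverse)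
    define J where "J n y = (\<integral>\<^sup>+z. ennreal (w y) * (indicator U (y + sqrt (s n) *\<^sub>R z) * ennreal (exp (- ((norm z)\<^sup>2 / 4)))) \<partial>lborel)" for n y
    have [measurable]: "J n \<in> borel_measurable borel" for n unfolding J_def[abs_def] by measurable
    have J: "ennreal I * (ennreal (w y) * indicator U y) \<le> liminf (\<lambda>n. J n y)" for y
    proof (cases "y \<in> U")
      case True
      have "ennreal I * (ennreal (w y) * indicator U y) = (\<integral>\<^sup>+z. ennreal (w y) * ennreal (exp (- ((norm z)\<^sup>2 / 4))) \<partial>(lborel :: 'b measure))"
        using True nn_integral_gauss[where 'b='b] by (subst nn_integral_cmult) (auto simp: I_def mult.commute)
      also have "\<dots> \<le> (\<integral>\<^sup>+z. liminf (\<lambda>n. ennreal (w y) * (indicator U (y + sqrt (s n) *\<^sub>R z) * ennreal (exp (- ((norm z)\<^sup>2 / 4))))) \<partial>lborel)"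
      proof (intro nn_integral_mono)
        fix z :: 'b
        have "(\<lambda>n. y + sqrt (s n) *\<^sub>R z) \<longlonglongrightarrow> y + sqrt 0 *\<^sub>R z" by (intro tendsto_intros s0)
        \<comment> \<open>For fixed \<open>z\<close> the shift tends to 0, so by openness of
          \<open>U\<close> the indicator is eventually 1 and the whole Gaussian mass is recovered in
          the limit.\<close>
        then have "\<forall>\<^sub>F n in sequentially. y + sqrt (s n) *\<^sub>R z \<in> U"
          using topological_tendstoD[OF _ U] True by simp
        then have "\<forall>\<^sub>F n in sequentially. ennreal (w y) * ennreal (exp (- ((norm z)\<^sup>2 / 4))) \<le>
           ennreal (w y) * (indicator U (y + sqrt (s n) *\<^sub>R z) * ennreal (exp (- ((norm z)\<^sup>2 / 4))))"
          by eventually_elim simp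
        then show "ennreal (w y) * ennreal (exp (- ((norm z)\<^sup>2 / 4))) \<le>
          liminf (\<lambda>n. ennreal (w y) * (indicator U (y + sqrt (s n) *\<^sub>R z) * ennreal (exp (- ((norm z)\<^sup>2 / 4)))))"
          by (rule Liminf_bounded)
      qed
      also have "\<dots> \<le> liminf (\<lambda>n. J n y)" unfolding J_def by (intro nn_integral_liminf) measurable
      finally show ?thesis .
    qed simp
    have "ennreal I * (\<integral>\<^sup>+y. ennreal (w y) * indicator U y \<partial>lborel) = (\<integral>\<^sup>+y. ennreal I * (ennreal (w y) * indicator U y) \<partial>lborel)"
      by (intro nn_integral_cmult[symmetric]) measurable
    also have "\<dots> \<le> (\<integral>\<^sup>+y. liminf (\<lambda>n. J n y) \<partial>lborel)" by (intro nn_integral_mono J)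
    also have "\<dots> \<le> liminf (\<lambda>n. \<integral>\<^sup>+y. J n y \<partial>lborel)" by (intro nn_integral_liminf) measurable
    also have "\<dots> \<le> liminf (\<lambda>n. \<integral>\<^sup>+x. indicator U x * ennreal (B x) \<partial>lborel)"
    proof (intro Liminf_mono always_eventually allI)
      fix n
      have "(\<integral>\<^sup>+y. J n y \<partial>lborel) = (\<integral>\<^sup>+x. indicator U x * (\<integral>\<^sup>+y. ennreal (w y) * heat (s n) (y - x) \<partial>lborel) \<partial>lborel)"
        unfolding J_def by (rule heat_tonelli[symmetric]) (use s in auto)
      also have "\<dots> \<le> (\<integral>\<^sup>+x. indicator U x * ennreal (B x) \<partial>lborel)"
        by (intro nn_integral_mono mult_left_mono le s) auto
      finally show "(\<integral>\<^sup>+y. J n y \<partial>lborel) \<le> (\<integral>\<^sup>+x. indicator U x * ennreal (B x) \<partial>lborel)" .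
    qed
    also have "\<dots> = (\<integral>\<^sup>+x. indicator U x * ennreal (B x) \<partial>lborel)" by (simp add: Liminf_const)
    finally have nnle: "ennreal I * (\<integral>\<^sup>+y. ennreal (w y) * indicator U y \<partial>lborel) \<le> (\<integral>\<^sup>+x. indicator U x * ennreal (B x) \<partial>lborel)" .
    have i: "integrable lborel (\<lambda>x. indicator U x * w x)" "integrable lborel (\<lambda>x. indicator U x * B x)"
      using integrable_mult_indicator[OF _ iw, of U] integrable_mult_indicator[OF _ iB, of U] by auto
    have "(\<integral>\<^sup>+y. ennreal (w y) * indicator U y \<partial>lborel) = (\<integral>\<^sup>+y. ennreal (indicator U y * w y) \<partial>lborel)"
      by (intro nn_integral_cong) (auto simp: indicator_def)
    also have "\<dots> = ennreal (\<integral>y. indicator U y * w y \<partial>lborel)"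
      by (rule nn_integral_eq_integral[OF i(1)]) (use w0 in auto)
    finally have e1: "(\<integral>\<^sup>+y. ennreal (w y) * indicator U y \<partial>lborel) = ennreal (\<integral>y. indicator U y * w y \<partial>lborel)" .
    have "(\<integral>\<^sup>+y. indicator U y * ennreal (B y) \<partial>lborel) = (\<integral>\<^sup>+y. ennreal (indicator U y * B y) \<partial>lborel)"
      by (intro nn_integral_cong) (auto simp: indicator_def)
    also have "\<dots> = ennreal (\<integral>y. indicator U y * B y \<partial>lborel)"
      by (rule nn_integral_eq_integral[OF i(2)]) (use B0 in auto)
    finally have e2: "(\<integral>\<^sup>+y. indicator U y * ennreal (B y) \<partial>lborel) = ennreal (\<integral>y. indicator U y * B y \<partial>lborel)" .
    have nn: "0 \<le> (\<integral>y. indicator U y * w y \<partial>lborel)" "0 \<le> (\<integral>y. indicator U y * B y \<partial>lborel)"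
      using w0 B0 by (auto intro!: Bochner_Integration.integral_nonneg)
    have "I * (\<integral>y. indicator U y * w y \<partial>lborel) \<le> (\<integral>y. indicator U y * B y \<partial>lborel)"
      using nnle nn I unfolding e1 e2 by (simp add: ennreal_mult'[symmetric])
    then have "0 \<le> (\<integral>x. indicator U x * B x - I * (indicator U x * w x) \<partial>lborel)" using i by simp
    also have "\<dots> = (\<integral>x. indicator U x * (B x - I * w x) \<partial>lborel)" by (simp add: algebra_simps)
    also have "\<dots> = (\<integral>x. indicator U x * (B x - I * w x) \<partial>lebesgue)"
      by (intro integral_completion[symmetric]) measurable
    finally show "0 \<le> (\<integral>x. indicator U x * (B x - I * w x) \<partial>lebesgue)" .
  qed
  then show ?thesis unfolding I_def by eventually_elim simp
qed

lemma eigenfunction_heat_bound: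
  fixes A :: "'b::euclidean_space set"
  assumes A: "open A" and u: "eigenfunction A lam u" and t: "0 < t"
  shows "AE x in lebesgue. x \<in> A \<longrightarrow> sqrt (4 * pi) ^ DIM('b) * (u x)\<^sup>2
       \<le> exp (2 * lam * t) * (\<integral>y. (u y)\<^sup>2 * heat t (y - x) \<partial>lebesgue_on A)"
proof -
  note Am = open_sets_lebesgue[OF A]
  note sq = W0_sqi(1)[OF A eigenfunction_W0[OF u]]
  have iu: "integrable lebesgue (\<lambda>x. indicator A x * (u x)\<^sup>2)"
    using sqi_power2[OF sq] Am by (simp add: integrable_restrict_space)
  note um[measurable] = borel_measurable_integrable[OF iu]
  \<comment> \<open>\<open>u\<close> is only Lebesgue measurable, whereas the exchange of integrals
    over \<open>lborel\<close> asks for Borel functions; \<open>w\<close> will be a nonnegative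
    Borel version of the zero extension of \<open>u\<^sup>2\<close>.\<close>
  obtain w' where w'[measurable]: "w' \<in> borel_measurable lborel" and ae': "AE x in lborel. indicator A x * (u x)\<^sup>2 = w' x"
    using completion_ex_borel_measurable_real[OF um] by blast
  define w where "w x = max 0 (w' x)" for x
  have wm[measurable]: "w \<in> borel_measurable borel" using w' unfolding w_def[abs_def] by measurable
  have w0: "0 \<le> w x" for x by (simp add: w_def)
  have "AE x in lborel. indicator A x * (u x)\<^sup>2 = w x"
    using ae'
  proof eventually_elim
    case (elim x)
    have "0 \<le> indicator A x * (u x)\<^sup>2" by simp
    then show ?case unfolding elim w_def by simp
  qed
  then have ae: "AE x in lebesgue. indicator A x * (u x)\<^sup>2 = w x" by (rule AE_completion)
  have eq: "(\<integral>y. (u y)\<^sup>2 * f y \<partial>lebesgue_on A) = (\<integral>y. w y * f y \<partial>lborel)" if [measurable]: "f \<in> borel_measurable borel" for f :: "'b \<Rightarrow> real"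
  proof -
    have [measurable]: "f \<in> borel_measurable lebesgue" "w \<in> borel_measurable lebesgue" by (auto intro: measurable_completion)
    have "(\<integral>y. (u y)\<^sup>2 * f y \<partial>lebesgue_on A) = (\<integral>y. indicator A y * (u y)\<^sup>2 * f y \<partial>lebesgue)"
      using Am by (simp add: integral_restrict_space mult.assoc)
    also have "\<dots> = (\<integral>y. w y * f y \<partial>lebesgue)"
      by (rule integral_cong_AE) (use ae in \<open>auto\<close>)
    also have "\<dots> = (\<integral>y. w y * f y \<partial>lborel)" by (rule integral_completion) measurable
    finally show ?thesis .
  qed
  have "integrable lebesgue w"
    by (rule integrable_cong_AE_imp[OF iu]) (use ae in \<open>auto intro: measurable_completion\<close>)
  then have iw: "integrable lborel w" by (simp add: integrable_completion)
  have ihw: "integrable lborel (\<lambda>y. w y * heat s (y - x))" if s: "s > 0" for s and x :: 'b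
  proof (rule Bochner_Integration.integrable_bound)
    show "integrable lborel (\<lambda>y. s powr (- (DIM('b) / 2)) * w y)" using iw by simp
    show "AE y in lborel. norm (w y * heat s (y - x)) \<le> norm (s powr (- (DIM('b) / 2)) * w y)"
    proof (rule AE_I2)
      fix y
      show "norm (w y * heat s (y - x)) \<le> norm (s powr (- (DIM('b) / 2)) * w y)"
        using mult_left_mono[OF heat_le[OF s, of "y - x"] w0[of y]] heat_pos[OF s, of "y - x"] w0[of y]
        by (simp add: abs_mult mult.commute)
    qed
  qed measurable
  have nn_eq: "(\<integral>\<^sup>+y. ennreal (w y) * heat s (y - x) \<partial>lborel) = ennreal (\<integral>y. w y * heat s (y - x) \<partial>lborel)"
    if s: "s > 0" for s and x :: 'b
  proof -
    show ?thesis
      using w0 by (subst nn_integral_eq_integral[OF ihw[OF s], symmetric])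
        (auto intro!: AE_I2 mult_nonneg_nonneg nn_integral_cong simp: ennreal_mult')
  qed
  define B where "B x = exp (2 * lam * t) * (\<integral>y. w y * heat t (y - x) \<partial>lborel)" for x
  have B0: "0 \<le> B x" for x unfolding B_def using w0
    by (intro mult_nonneg_nonneg Bochner_Integration.integral_nonneg) auto
  have Bm[measurable]: "B \<in> borel_measurable borel" unfolding B_def[abs_def] by measurable
  \<comment> \<open>By the exchange of integrals with \<open>U = UNIV\<close>, the total integral of
    \<open>B\<close> is that of \<open>w\<close> up to a constant factor.\<close>
  have "(\<integral>\<^sup>+x. ennreal (B x) \<partial>lborel) = (\<integral>\<^sup>+x. ennreal (exp (2 * lam * t)) * (indicator UNIV x * (\<integral>\<^sup>+y. ennreal (w y) * heat t (y - x) \<partial>lborel)) \<partial>lborel)"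
    unfolding B_def nn_eq[OF t] by (intro nn_integral_cong) (simp add: ennreal_mult')
  also have "\<dots> = ennreal (exp (2 * lam * t)) * (\<integral>\<^sup>+x. indicator UNIV x * (\<integral>\<^sup>+y. ennreal (w y) * heat t (y - x) \<partial>lborel) \<partial>lborel)"
    by (intro nn_integral_cmult) measurable
  also have "\<dots> = ennreal (exp (2 * lam * t)) * (\<integral>\<^sup>+y. ennreal (w y) * ennreal (sqrt (4 * pi) ^ DIM('b)) \<partial>lborel)"
    by (subst heat_tonelli[OF wm _ t]) (auto simp: nn_integral_cmult nn_integral_gauss)
  also have "\<dots> < \<infinity>"
    using iw w0 by (simp add: nn_integral_multc nn_integral_eq_integral ennreal_mult_less_top)
  finally have iB: "integrable lborel B"
    using B0 by (intro integrableI_nonneg) auto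
  have "AE x in lebesgue. sqrt (4 * pi) ^ DIM('b) * w x \<le> B x"
  proof (rule heat_initial_value_le[OF wm w0 iw B0 iB t])
    fix s and x :: 'b assume s: "0 < s" "s \<le> t"
    \<comment> \<open>As the eigenvalue is nonnegative, the weight \<open>exp (2 * lam * s)\<close>
      is at least 1 and may be inserted before monotonicity in time is applied.\<close>
    have "1 * (\<integral>y. w y * heat s (y - x) \<partial>lborel) \<le> exp (2 * lam * s) * (\<integral>y. w y * heat s (y - x) \<partial>lborel)"
      using s eigenvalue_nonneg[OF A u] w0
      by (intro mult_right_mono Bochner_Integration.integral_nonneg) auto
    also have "\<dots> \<le> B x"
      unfolding B_def using eigenfunction_heat_mono[OF A u s, of x] by (simp add: eq)
    finally show "(\<integral>\<^sup>+y. ennreal (w y) * heat s (y - x) \<partial>lborel) \<le> ennreal (B x)"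
      unfolding nn_eq[OF s(1)] by (intro ennreal_leI) simp
  qed
  with ae show ?thesis
  proof eventually_elim
    case (elim x)
    show ?case
    proof
      assume "x \<in> A"
      then show "sqrt (4 * pi) ^ DIM('b) * (u x)\<^sup>2 \<le> exp (2 * lam * t) * (\<integral>y. (u y)\<^sup>2 * heat t (y - x) \<partial>lebesgue_on A)"
        using elim by (simp add: eq B_def)
    qed
  qed
qed

lemma integral_heat_le:
  fixes A :: "'b::euclidean_space set"
  assumes A: "open A" and sq: "sqi (lebesgue_on A) u" and t: "t > 0"
  shows "(\<integral>y. (u y)\<^sup>2 * heat t (y - x) \<partial>lebesgue_on A) \<le> t powr (- (DIM('b) / 2)) * (\<integral>y. (u y)\<^sup>2 \<partial>lebesgue_on A)"
    "integrable (lebesgue_on A) (\<lambda>y. (u y)\<^sup>2 * heat t (y - x))"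
proof -
  have m: "(\<lambda>y. heat t (y - x)) \<in> borel_measurable (lebesgue_on A)"
    by (rule borel_measurable_lebesgue_on) measurable
  have K: "\<bar>heat t (y - x)\<bar> \<le> t powr (- (DIM('b) / 2))" for y
    using heat_le[OF t, of "y - x"] heat_pos[OF t, of "y - x"] by simp
  show i: "integrable (lebesgue_on A) (\<lambda>y. (u y)\<^sup>2 * heat t (y - x))"
    using sqi_mult[OF sq sqi_scale[OF m K sq]] by (simp add: power2_eq_square mult_ac)
  have "(\<integral>y. (u y)\<^sup>2 * heat t (y - x) \<partial>lebesgue_on A) \<le> (\<integral>y. t powr (- (DIM('b) / 2)) * (u y)\<^sup>2 \<partial>lebesgue_on A)"
  proof (rule integral_mono[OF i])
    show "integrable (lebesgue_on A) (\<lambda>y. t powr (- (DIM('b) / 2)) * (u y)\<^sup>2)" using sqi_power2[OF sq] by simp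
    show "(u y)\<^sup>2 * heat t (y - x) \<le> t powr (- (DIM('b) / 2)) * (u y)\<^sup>2" for y
      using mult_left_mono[OF heat_le[OF t, of "y - x"], of "(u y)\<^sup>2"] by (simp add: mult.commute)
  qed
  then show "(\<integral>y. (u y)\<^sup>2 * heat t (y - x) \<partial>lebesgue_on A) \<le> t powr (- (DIM('b) / 2)) * (\<integral>y. (u y)\<^sup>2 \<partial>lebesgue_on A)"
    by simp
qed

text \<open>For \<open>lam = 0\<close> the weight is 1 at all times, while the kernel is bounded by
  a negative power of the time; large times would force \<open>u = 0\<close>. Positivity is what
  makes \<open>1 / lam\<close> an admissible time.\<close>

lemma eigenvalue_pos:
  fixes A :: "'b::euclidean_space set"
  assumes A: "open A" and u: "eigenfunction A lam u"
  shows "lam > 0"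
proof (rule ccontr)
  assume "\<not> lam > 0"
  then have lam: "lam = 0" using eigenvalue_nonneg[OF A u] by simp
  note Am = open_sets_lebesgue[OF A]
  note sq = W0_sqi(1)[OF A eigenfunction_W0[OF u]]
  define n where "n = (\<integral>y. (u y)\<^sup>2 \<partial>lebesgue_on A)"
  define I where "I = sqrt (4 * pi) ^ DIM('b)"
  have I: "I > 0" by (simp add: I_def)
  have "AE x in lebesgue. x \<in> A \<longrightarrow> I * (u x)\<^sup>2 \<le> real (Suc m) powr (- (DIM('b) / 2)) * n" for m
    using eigenfunction_heat_bound[OF A u, of "real (Suc m)"]
    by (rule AE_mp) (use integral_heat_le(1)[OF A sq, of "real (Suc m)"] lam in
        \<open>auto simp: n_def I_def intro!: AE_I2 elim: order_trans\<close>)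
  then have "AE x in lebesgue. \<forall>m. x \<in> A \<longrightarrow> I * (u x)\<^sup>2 \<le> real (Suc m) powr (- (DIM('b) / 2)) * n"
    by (subst AE_all_countable) blast
  then have "AE x in lebesgue. x \<in> A \<longrightarrow> u x = 0"
  proof eventually_elim
    case (elim x)
    have "(\<lambda>m. real (Suc m) powr (- (DIM('b) / 2))) \<longlonglongrightarrow> 0"
      by (rule tendsto_neg_powr) (use filterlim_compose[OF filterlim_real_sequentially filterlim_Suc] in simp_all)
    then have lim: "(\<lambda>m. real (Suc m) powr (- (DIM('b) / 2)) * n) \<longlonglongrightarrow> 0" by (rule tendsto_mult_left_zero)
    show ?case
    proof
      assume "x \<in> A"
      then have "I * (u x)\<^sup>2 \<le> 0" using elim by (intro LIMSEQ_le_const[OF lim]) auto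
      then show "u x = 0" using I by (simp add: mult_le_0_iff)
    qed
  qed
  then show False using u by (simp add: eigenfunction_def)
qed

section \<open>The bound of the maximum\<close>

lemma L2norm_eq: "open A \<Longrightarrow> L2norm A u = sqrt (\<integral>x. (u x)\<^sup>2 \<partial>lebesgue_on A)"
  unfolding L2norm_def by (simp add: LINT_lebesgue_on[OF open_sets_lebesgue])

text \<open>At time \<open>1 / lam\<close> the weight is \<open>exp 2\<close> and the kernel is at
  most \<open>lam powr (N / 2)\<close>, with \<open>N\<close> the dimension. The square root yields
  \<open>exp 1\<close> and the exponent \<open>N / 4\<close>, and the mass of \<open>heat\<close>
  goes into the denominator.\<close>

lemma eigenfunction_sup_bound:
  fixes A :: "'b::euclidean_space set"
  assumes A: "open A" and u: "eigenfunction A lam u"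
  shows "AE x in lebesgue. x \<in> A \<longrightarrow> \<bar>u x\<bar> \<le> exp 1 / sqrt (sqrt (4 * pi) ^ DIM('b)) * lam powr (real DIM('b) / 4) * L2norm A u"
proof -
  note lam = eigenvalue_pos[OF A u]
  note sq = W0_sqi(1)[OF A eigenfunction_W0[OF u]]
  define n where "n = (\<integral>y. (u y)\<^sup>2 \<partial>lebesgue_on A)"
  define I where "I = sqrt (4 * pi) ^ DIM('b)"
  have I: "I > 0" by (simp add: I_def)
  have t: "1 / lam > 0" using lam by simp
  have lp: "(1 / lam) powr (- (DIM('b) / 2)) = (lam powr (DIM('b) / 4))\<^sup>2"
    using lam by (simp add: powr_minus powr_divide powr_realpow[symmetric] powr_powr)
  show ?thesis
    using eigenfunction_heat_bound[OF A u t]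
  proof eventually_elim
    case (elim x)
    show ?case
    proof
      assume "x \<in> A"
      then have "I * (u x)\<^sup>2 \<le> exp (2 * lam * (1 / lam)) * (\<integral>y. (u y)\<^sup>2 * heat (1 / lam) (y - x) \<partial>lebesgue_on A)"
        using elim by (simp add: I_def)
      also have "\<dots> \<le> exp (2 * lam * (1 / lam)) * ((lam powr (DIM('b) / 4))\<^sup>2 * n)"
        using integral_heat_le(1)[OF A sq t, of x] unfolding lp n_def by (intro mult_left_mono) auto
      also have "\<dots> = (exp 1 * lam powr (DIM('b) / 4))\<^sup>2 * n"
        using lam by (simp add: power_mult_distrib exp_double[symmetric])
      finally have "(u x)\<^sup>2 \<le> (exp 1 * lam powr (DIM('b) / 4))\<^sup>2 * n / I" using I by (simp add: field_simps)
      then have "sqrt ((u x)\<^sup>2) \<le> sqrt ((exp 1 * lam powr (DIM('b) / 4))\<^sup>2 * n / I)" by (rule real_sqrt_le_mono)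
      also have "\<dots> = exp 1 * lam powr (DIM('b) / 4) * sqrt n / sqrt I"
        by (simp add: real_sqrt_mult real_sqrt_divide abs_mult)
      finally show "\<bar>u x\<bar> \<le> exp 1 / sqrt (sqrt (4 * pi) ^ DIM('b)) * lam powr (real DIM('b) / 4) * L2norm A u"
        unfolding L2norm_eq[OF A] n_def[symmetric] I_def[symmetric] by simp
    qed
  qed
qed

subsection \<open>Rotation invariance and the Poincare inequality on half-cylinders\<close>

lemma nn_integral_lborel_translate:
  fixes f :: "'b::euclidean_space \<Rightarrow> ennreal"
  assumes [measurable]: "f \<in> borel_measurable borel"
  shows "(\<integral>\<^sup>+x. f (x + c) \<partial>lborel) = (\<integral>\<^sup>+x. f x \<partial>lborel)"
proof -
  have "(\<integral>\<^sup>+x. f x \<partial>lborel) = (\<integral>\<^sup>+x. f x \<partial>distr lborel borel ((+) c))" by (simp add: lborel_distr_plus)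
  also have "\<dots> = (\<integral>\<^sup>+x. f (c + x) \<partial>lborel)" by (subst nn_integral_distr) auto
  finally show ?thesis by (simp add: add.commute)
qed

text \<open>Both sides are multiplied by the measure of a rotation invariant ball and compared by Tonelli's
  theorem, using only translation invariance.\<close>

lemma nn_integral_orthogonal_transformation:
  fixes f :: "'b::euclidean_space \<Rightarrow> ennreal" and T :: "'b \<Rightarrow> 'b"
  assumes T: "orthogonal_transformation T" and f[measurable]: "f \<in> borel_measurable borel"
  shows "(\<integral>\<^sup>+x. f (T x) \<partial>lborel) = (\<integral>\<^sup>+x. f x \<partial>lborel)"
proof -
  have lin: "linear T" by (rule orthogonal_transformation_linear[OF T])
  have [measurable]: "T \<in> borel_measurable borel"
    using lin by (intro borel_measurable_continuous_onI linear_continuous_on linear_conv_bounded_linear[THEN iffD1])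
  have nT: "norm (T x) = norm x" for x using orthogonal_transformation_norm[OF T] .
  define B where "B = ball (0::'b) 1"
  have [measurable]: "B \<in> sets borel" by (simp add: B_def)
  have "(\<integral>\<^sup>+x. f (T x) \<partial>lborel) * emeasure lborel B = (\<integral>\<^sup>+x. f (T x) * emeasure lborel B \<partial>lborel)"
    by (rule nn_integral_multc[symmetric]) measurable
  also have "\<dots> = (\<integral>\<^sup>+x. \<integral>\<^sup>+y. f (T x) * indicator B (y - T x) \<partial>lborel \<partial>lborel)"
  proof (rule nn_integral_cong)
    fix x
    have "(\<integral>\<^sup>+y. f (T x) * indicator B (y - T x) \<partial>lborel) = f (T x) * (\<integral>\<^sup>+y. indicator B (y - T x) \<partial>lborel)"
      by (rule nn_integral_cmult) measurable
    also have "(\<integral>\<^sup>+y. indicator B (y - T x) \<partial>lborel) = (\<integral>\<^sup>+y. indicator B y \<partial>lborel)"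
      using nn_integral_lborel_translate[of "indicator B" "- T x"] by simp
    finally show "f (T x) * emeasure lborel B = (\<integral>\<^sup>+y. f (T x) * indicator B (y - T x) \<partial>lborel)" by simp
  qed
  also have "\<dots> = (\<integral>\<^sup>+y. \<integral>\<^sup>+x. f (T x) * indicator B (y - T x) \<partial>lborel \<partial>lborel)"
    by (rule lborel_pair.Fubini') measurable
  also have "\<dots> = (\<integral>\<^sup>+y. \<integral>\<^sup>+x. f (y + T x) * indicator B x \<partial>lborel \<partial>lborel)"
  proof (rule nn_integral_cong)
    fix y :: 'b
    \<comment> \<open>Shifting \<open>x\<close> by the preimage \<open>z\<close> turns
      \<open>y - T x\<close> into \<open>- T x\<close>, which has the norm of \<open>x\<close>, so
      the indicator of the ball no longer sees \<open>T\<close>.\<close>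
    obtain z where z: "T z = y" using orthogonal_transformation_surj[OF T] by (metis surjD)
    have "(\<integral>\<^sup>+x. f (T x) * indicator B (y - T x) \<partial>lborel) = (\<integral>\<^sup>+x. f (T (x + z)) * indicator B (y - T (x + z)) \<partial>lborel)"
      by (rule nn_integral_lborel_translate[symmetric, where f="\<lambda>x. f (T x) * indicator B (y - T x)"]) measurable
    also have "\<dots> = (\<integral>\<^sup>+x. f (y + T x) * indicator B x \<partial>lborel)"
      by (intro nn_integral_cong) (simp add: linear_add[OF lin] z add.commute B_def indicator_def nT)
    finally show "(\<integral>\<^sup>+x. f (T x) * indicator B (y - T x) \<partial>lborel) = (\<integral>\<^sup>+x. f (y + T x) * indicator B x \<partial>lborel)" .
  qed
  also have "\<dots> = (\<integral>\<^sup>+x. \<integral>\<^sup>+y. f (y + T x) * indicator B x \<partial>lborel \<partial>lborel)"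
    by (rule lborel_pair.Fubini') measurable
  also have "\<dots> = (\<integral>\<^sup>+x. (\<integral>\<^sup>+y. f y \<partial>lborel) * indicator B x \<partial>lborel)"
    by (rule nn_integral_cong, subst nn_integral_multc) (auto simp: nn_integral_lborel_translate)
  also have "\<dots> = (\<integral>\<^sup>+y. f y \<partial>lborel) * emeasure lborel B"
    by (subst nn_integral_cmult) auto
  finally have "(\<integral>\<^sup>+x. f (T x) \<partial>lborel) * emeasure lborel B = (\<integral>\<^sup>+y. f y \<partial>lborel) * emeasure lborel B" .
  moreover have "emeasure lborel B \<noteq> \<infinity>" unfolding B_def using emeasure_lborel_ball_finite[of "0::'b" 1] by simp
  moreover have "emeasure lborel B \<noteq> 0"
    unfolding B_def using open_not_negligible[of "ball (0::'b) 1"]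
    by (auto simp: negligible_iff_emeasure0)
  ultimately show ?thesis by (metis ennreal_mult_cancel_left mult.commute infinity_ennreal_def)
qed

lemma lborel_distr_rigid_motion:
  fixes T :: "'b::euclidean_space \<Rightarrow> 'b"
  assumes T: "orthogonal_transformation T"
  shows "distr lborel borel (\<lambda>x. T x + c) = lborel"
proof (rule measure_eqI)
  have [measurable]: "T \<in> borel_measurable borel"
    using orthogonal_transformation_linear[OF T]
    by (intro borel_measurable_continuous_onI linear_continuous_on linear_conv_bounded_linear[THEN iffD1])
  fix S assume "S \<in> sets (distr lborel borel (\<lambda>x. T x + c))"
  then have [measurable]: "S \<in> sets borel" by simp
  have "emeasure (distr lborel borel (\<lambda>x. T x + c)) S = (\<integral>\<^sup>+x. indicator S x \<partial>distr lborel borel (\<lambda>x. T x + c))" by simp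
  also have "\<dots> = (\<integral>\<^sup>+x. indicator S (T x + c) \<partial>lborel)" by (subst nn_integral_distr) auto
  also have "\<dots> = (\<integral>\<^sup>+x. indicator S (x + c) \<partial>lborel)"
    by (rule nn_integral_orthogonal_transformation[OF T, where f="\<lambda>x. indicator S (x + c)"]) measurable
  also have "\<dots> = emeasure lborel S" by (subst nn_integral_lborel_translate) auto
  finally show "emeasure (distr lborel borel (\<lambda>x. T x + c)) S = emeasure lborel S" .
qed simp

text \<open>The gradient of the section is the first component of the full gradient pulled back by
  \<open>Rot\<close>; dropping the axial component can only decrease the norm.\<close>

lemma orthogonal_transformation_grad_section:
  fixes Rot :: "('a::euclidean_space \<times> real) \<Rightarrow> ('a \<times> real)"
  assumes Rot: "orthogonal_transformation Rot" and d: "\<psi> differentiable at (Rot (x, s) + t)"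
  shows "norm (grad (\<lambda>x. \<psi> (Rot (x, s) + t)) x) \<le> norm (grad \<psi> (Rot (x, s) + t))"
proof -
  have lin: "linear Rot" by (rule orthogonal_transformation_linear[OF Rot])
  then have bl: "bounded_linear Rot" by (simp add: linear_conv_bounded_linear)
  let ?v = "grad \<psi> (Rot (x, s) + t)"
  obtain w where w: "Rot w = ?v" using orthogonal_transformation_surj[OF Rot] by (metis surjD)
  have "((\<lambda>x. \<psi> (Rot (x, s) + t)) has_derivative (\<lambda>h. ?v \<bullet> Rot (h, 0))) (at x)"
  proof (rule has_derivative_compose[where f="\<lambda>x. Rot (x, s) + t" and g=\<psi> and g'="\<lambda>h. ?v \<bullet> h"])
    show "(\<psi> has_derivative (\<lambda>h. ?v \<bullet> h)) (at (Rot (x, s) + t))" by (rule has_derivative_grad[OF d])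
    have "((\<lambda>x. (x, s)) has_derivative (\<lambda>h. (h, 0))) (at x)"
      by (auto intro!: derivative_eq_intros)
    from bounded_linear.has_derivative[OF bl this]
    show "((\<lambda>x. Rot (x, s) + t) has_derivative (\<lambda>h. Rot (h, 0))) (at x)"
      by (auto intro!: derivative_eq_intros)
  qed
  moreover have "?v \<bullet> Rot (h, 0) = fst w \<bullet> h" for h
  proof -
    have "Rot w \<bullet> Rot (h, 0) = w \<bullet> (h, 0)" using Rot unfolding orthogonal_transformation_def by blast
    then show ?thesis unfolding w by (simp add: inner_prod_def)
  qed
  ultimately have "grad (\<lambda>x. \<psi> (Rot (x, s) + t)) x = fst w" by (intro grad_eqI) simp
  then show ?thesis using norm_fst_le[of "fst w" "snd w"] orthogonal_transformation_norm[OF Rot, of w] w by simp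
qed

lemma compact_section:
  fixes Rot :: "('a::euclidean_space \<times> real) \<Rightarrow> ('a \<times> real)"
  assumes Rot: "orthogonal_transformation Rot" and K: "compact K"
  shows "compact ((\<lambda>x. Rot (x, s) + t) -` K)"
proof -
  have bl: "bounded_linear Rot"
    using orthogonal_transformation_linear[OF Rot] by (simp add: linear_conv_bounded_linear)
  have "continuous_on UNIV (\<lambda>x. Rot (x, s) + t)"
    by (intro continuous_intros bounded_linear.continuous_on[OF bl])
  then have "closed ((\<lambda>x. Rot (x, s) + t) -` K)"
    using compact_imp_closed[OF K] by (intro closed_vimage) (auto simp: continuous_on_eq_continuous_at)
  moreover have "bounded ((\<lambda>x. Rot (x, s) + t) -` K)"
  proof -
    obtain r where r: "\<And>x. x \<in> K \<Longrightarrow> norm x \<le> r" using compact_imp_bounded[OF K] unfolding bounded_iff by auto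
    have "norm x \<le> r + norm t" if "Rot (x, s) + t \<in> K" for x
    proof -
      have "norm x \<le> norm (x, s)" by (rule norm_fst_le)
      also have "\<dots> = norm (Rot (x, s))" using orthogonal_transformation_norm[OF Rot] by simp
      also have "\<dots> \<le> norm (Rot (x, s) + t) + norm t"
        using norm_triangle_ineq4[of "Rot (x, s) + t" t] by simp
      also have "\<dots> \<le> r + norm t" using r that by auto
      finally show ?thesis .
    qed
    then show ?thesis unfolding bounded_iff by blast
  qed
  ultimately show ?thesis by (simp add: compact_eq_bounded_closed)
qed

text \<open>For \<open>s \<le> 0\<close> the section is identically zero, which is a test function
  too; hence every height is covered.\<close>

lemma test_fun_section:
  fixes Rot :: "('a::euclidean_space \<times> real) \<Rightarrow> ('a \<times> real)"
  assumes Rot: "orthogonal_transformation Rot" and p: "test_fun (cyl Rot t E) \<psi>"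
  shows "test_fun E (\<lambda>x. \<psi> (Rot (x, s) + t))"
proof -
  have lin: "linear Rot" by (rule orthogonal_transformation_linear[OF Rot])
  then have bl: "bounded_linear Rot" by (simp add: linear_conv_bounded_linear)
  \<comment> \<open>The section map is affine in \<open>x\<close>: its linear part is
    \<open>Rot (x, 0)\<close>, and \<open>Rot (0, s) + t\<close> is the translation.\<close>
  have eq: "Rot (x, s) + t = Rot (x, 0) + (Rot (0, s) + t)" for x
    using linear_add[OF lin, of "(x, 0)" "(0, s)"] by simp
  have fe: "(\<lambda>x. \<psi> (Rot (x, s) + t)) = (\<lambda>x. \<psi> (Rot (x, 0) + (Rot (0, s) + t)))"
    by (rule ext, subst eq, rule refl)
  obtain K where K: "compact K" "K \<subseteq> cyl Rot t E" "\<And>x. x \<notin> K \<Longrightarrow> \<psi> x = 0" using test_funE[OF p] by metis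
  let ?L = "(\<lambda>x. Rot (x, s) + t) -` K"
  have "compact ?L" by (rule compact_section[OF Rot K(1)])
  moreover have "?L \<subseteq> E"
  proof
    fix x assume "x \<in> ?L"
    then obtain y where y: "y \<in> E \<times> {0<..}" "Rot (x, s) + t = Rot y + t" using K(2) by (auto simp: cyl_def)
    then have "(x, s) = y" using orthogonal_transformation_inj[OF Rot] by (simp add: inj_eq)
    then show "x \<in> E" using y by auto
  qed
  moreover have "smooth (\<lambda>x. \<psi> (Rot (x, s) + t))"
    unfolding fe
  proof (rule smooth_compose_affine[OF _ test_fun_smooth[OF p]])
    show "linear (\<lambda>x. Rot (x, 0))"
      by (rule linearI) (use linear_add[OF lin, of "(_, 0)" "(_, 0)"] linear_cmul[OF lin, of _ "(_, 0)"] in auto)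
  qed
  ultimately show ?thesis using K(3) by (intro test_funI[where K="?L"]) auto
qed

text \<open>Fubini in rotated coordinates: every slice orthogonal to the axis is a test function on
  the cross section, where \<open>dir_eig_1_le\<close> applies, and the axial derivative is
  discarded.\<close>

lemma cyl_Poincare:
  fixes Rot :: "('a::euclidean_space \<times> real) \<Rightarrow> ('a \<times> real)"
  assumes Rot: "orthogonal_transformation Rot" and E: "open E" and p: "test_fun (cyl Rot t E) \<psi>"
  shows "dir_eig 1 E * (\<integral>x. (\<psi> x)\<^sup>2 \<partial>lborel) \<le> (\<integral>x. (norm (grad \<psi> x))\<^sup>2 \<partial>lborel)"
proof -
  have bl: "bounded_linear Rot"
    using orthogonal_transformation_linear[OF Rot] by (simp add: linear_conv_bounded_linear)
  note Em = open_sets_lebesgue[OF E]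
  obtain K where K: "compact K" "\<And>x. x \<notin> K \<Longrightarrow> \<psi> x = 0" "\<And>x. x \<notin> K \<Longrightarrow> grad \<psi> x = 0" using test_funE[OF p] by metis
  note sm = test_fun_smooth[OF p]
  have c1: "continuous_on UNIV (\<lambda>x. (\<psi> x)\<^sup>2)" by (intro continuous_intros smooth_continuous sm)
  have c2: "continuous_on UNIV (\<lambda>x. (norm (grad \<psi> x))\<^sup>2)" by (intro continuous_intros continuous_grad sm)
  have i1: "integrable lborel (\<lambda>x. (\<psi> x)\<^sup>2)" by (rule integrable_compact_support(1)[OF c1 K(1)]) (simp add: K)
  have i2: "integrable lborel (\<lambda>x. (norm (grad \<psi> x))\<^sup>2)" by (rule integrable_compact_support(1)[OF c2 K(1)]) (simp add: K)
  have Tm[measurable]: "(\<lambda>y. Rot y + t) \<in> borel_measurable borel"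
    by (intro borel_measurable_continuous_onI continuous_intros bounded_linear.continuous_on[OF bl])
  have swap: "integrable (lborel \<Otimes>\<^sub>M lborel) (\<lambda>(x, s). f (Rot (x, s) + t))"
    "(\<integral>x. f x \<partial>lborel) = (\<integral>s. (\<integral>x. f (Rot (x, s) + t) \<partial>lborel) \<partial>lborel)"
    if i: "integrable lborel f" for f :: "'a \<times> real \<Rightarrow> real"
  proof -
    have "integrable (distr lborel borel (\<lambda>y. Rot y + t)) f" using i by (simp add: lborel_distr_rigid_motion[OF Rot])
    then have "integrable lborel (\<lambda>y. f (Rot y + t))"
      using borel_measurable_integrable[OF i] by (subst (asm) integrable_distr_eq) auto
    then show ip: "integrable (lborel \<Otimes>\<^sub>M lborel) (\<lambda>(x, s). f (Rot (x, s) + t))"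
      by (simp add: lborel_prod case_prod_unfold)
    have "(\<integral>x. f x \<partial>lborel) = (\<integral>x. f x \<partial>distr lborel borel (\<lambda>y. Rot y + t))"
      by (simp add: lborel_distr_rigid_motion[OF Rot])
    also have "\<dots> = (\<integral>y. f (Rot y + t) \<partial>lborel)"
      using borel_measurable_integrable[OF i] by (subst integral_distr) auto
    also have "\<dots> = (\<integral>(x, s). f (Rot (x, s) + t) \<partial>(lborel \<Otimes>\<^sub>M lborel))"
      by (simp add: lborel_prod case_prod_unfold)
    also have "\<dots> = (\<integral>s. (\<integral>x. f (Rot (x, s) + t) \<partial>lborel) \<partial>lborel)"
      by (rule lborel_pair.integral_snd[OF ip, symmetric])
    finally show "(\<integral>x. f x \<partial>lborel) = (\<integral>s. (\<integral>x. f (Rot (x, s) + t) \<partial>lborel) \<partial>lborel)" .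
  qed
  have int_s: "integrable lborel (\<lambda>s. \<integral>x. f (Rot (x, s) + t) \<partial>lborel)" if "integrable lborel f" for f :: "'a \<times> real \<Rightarrow> real"
    using lborel_pair.integrable_snd[OF swap(1)[OF that]] .
  have sec: "dir_eig 1 E * (\<integral>x. (\<psi> (Rot (x, s) + t))\<^sup>2 \<partial>lborel) \<le> (\<integral>x. (norm (grad \<psi> (Rot (x, s) + t)))\<^sup>2 \<partial>lborel)" for s
  proof -
    let ?\<phi> = "\<lambda>x. \<psi> (Rot (x, s) + t)"
    have ps: "test_fun E ?\<phi>" by (rule test_fun_section[OF Rot p])
    obtain L where L: "compact L" "L \<subseteq> E" "\<And>x. x \<notin> L \<Longrightarrow> ?\<phi> x = 0" "\<And>x. x \<notin> L \<Longrightarrow> grad ?\<phi> x = 0"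
      using test_funE[OF ps] by metis
    note sms = test_fun_smooth[OF ps]
    have m1: "(\<lambda>x. (?\<phi> x)\<^sup>2) \<in> borel_measurable borel"
      by (intro borel_measurable_continuous_onI continuous_intros smooth_continuous[OF sms])
    have cg: "continuous_on UNIV (\<lambda>x. (norm (grad ?\<phi> x))\<^sup>2)" by (intro continuous_intros continuous_grad[OF sms])
    have m2: "(\<lambda>x. (norm (grad ?\<phi> x))\<^sup>2) \<in> borel_measurable borel"
      by (rule borel_measurable_continuous_onI[OF cg])
    have "dir_eig 1 E * (\<integral>x. (?\<phi> x)\<^sup>2 \<partial>lborel) = dir_eig 1 E * (\<integral>x. (?\<phi> x)\<^sup>2 \<partial>lebesgue_on E)"
      using L(2,3) by (subst integral_lebesgue_on_eq_lborel[OF m1 _ Em]) auto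
    also have "\<dots> \<le> (\<integral>x. (norm (grad ?\<phi> x))\<^sup>2 \<partial>lebesgue_on E)" by (rule dir_eig_1_le[OF E ps])
    also have "\<dots> = (\<integral>x. (norm (grad ?\<phi> x))\<^sup>2 \<partial>lborel)"
      using L(2,4) by (subst integral_lebesgue_on_eq_lborel[OF m2 _ Em]) auto
    also have "\<dots> \<le> (\<integral>x. (norm (grad \<psi> (Rot (x, s) + t)))\<^sup>2 \<partial>lborel)"
    proof (rule integral_mono)
      show "integrable lborel (\<lambda>x. (norm (grad ?\<phi> x))\<^sup>2)"
        by (rule integrable_compact_support(1)[OF cg L(1)]) (simp add: L)
      let ?M = "(\<lambda>x. Rot (x, s) + t) -` K"
      have cont: "continuous_on UNIV (\<lambda>x. Rot (x, s) + t)"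
        by (intro continuous_intros bounded_linear.continuous_on[OF bl])
      have "compact ?M" by (rule compact_section[OF Rot K(1)])
      then show "integrable lborel (\<lambda>x. (norm (grad \<psi> (Rot (x, s) + t)))\<^sup>2)"
        using K(3) by (intro integrable_compact_support(1)[where K="?M"] continuous_on_compose2[OF c2 cont]) auto
      show "(norm (grad ?\<phi> x))\<^sup>2 \<le> (norm (grad \<psi> (Rot (x, s) + t)))\<^sup>2" for x
        by (intro power_mono orthogonal_transformation_grad_section[OF Rot] smooth_differentiable[OF sm]) auto
    qed
    finally show ?thesis .
  qed
  have "dir_eig 1 E * (\<integral>x. (\<psi> x)\<^sup>2 \<partial>lborel) = (\<integral>s. dir_eig 1 E * (\<integral>x. (\<psi> (Rot (x, s) + t))\<^sup>2 \<partial>lborel) \<partial>lborel)"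
    unfolding swap(2)[OF i1] by simp
  also have "\<dots> \<le> (\<integral>s. (\<integral>x. (norm (grad \<psi> (Rot (x, s) + t)))\<^sup>2 \<partial>lborel) \<partial>lborel)"
    by (intro integral_mono sec int_s[OF i2] integrable_mult_right int_s[OF i1])
  also have "\<dots> = (\<integral>x. (norm (grad \<psi> x))\<^sup>2 \<partial>lborel)" by (rule swap(2)[OF i2, symmetric])
  finally show ?thesis .
qed

subsection \<open>Cut-off along a cylinder and exponential decay\<close>

text \<open>\<open>\<eta>\<close> is a primitive of a bump \<open>p\<close> carried by the unit
  interval, divided by its increment \<open>D\<close>. The mean value theorem supplies
  \<open>D > 0\<close>, monotonicity and constancy outside the interval; \<open>p \<le> 1\<close>
  gives \<open>M = 1 / D\<close>.\<close>

lemma ex_cutoff: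
  obtains \<eta> \<eta>' :: "real \<Rightarrow> real" and M
  where "smooth \<eta>" "smooth \<eta>'" "\<And>s. (\<eta> has_real_derivative \<eta>' s) (at s)" "\<And>s. 0 \<le> \<eta> s" "\<And>s. \<eta> s \<le> 1"
    "\<And>s. s \<le> 0 \<Longrightarrow> \<eta> s = 0" "\<And>s. s \<ge> 1 \<Longrightarrow> \<eta> s = 1"
    "M > 0" "\<And>s. \<bar>\<eta>' s\<bar> \<le> M" "\<And>s. s \<le> 0 \<or> s \<ge> 1 \<Longrightarrow> \<eta>' s = 0"
proof -
  define p where "p s = ebump 0 s * ebump 0 (1 - s)" for s :: real
  have "smooth (\<lambda>s::real. 1 - s)" using smooth_diff[OF smooth_const smooth_inner[of "1::real"], of 1] by simp
  then have sp: "smooth p" unfolding p_def[abs_def]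
    by (intro smooth_mult smooth_ebump smooth_compose_real[OF smooth_ebump])
  have p0: "0 \<le> p s" "p s \<le> 1" for s
    unfolding p_def by (auto intro!: mult_nonneg_nonneg mult_le_one ebump0_bounds)
  have pz: "p s = 0" if "s \<le> 0 \<or> s \<ge> 1" for s using that by (auto simp: p_def ebump_def)
  have pp: "p s > 0" if "0 < s" "s < 1" for s unfolding p_def using that by (intro mult_pos_pos) (auto simp: ebump0_bounds)
  have "\<exists>g. \<forall>x. -\<infinity> < ereal x \<longrightarrow> ereal x < \<infinity> \<longrightarrow> (g has_vector_derivative p x) (at x)"
    by (rule einterval_antiderivative)
       (use smooth_continuous[OF sp, of UNIV] in \<open>auto simp: continuous_on_eq_continuous_at\<close>)
  then obtain g where g: "\<And>x. (g has_real_derivative p x) (at x)"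
    by (auto simp: has_real_derivative_iff_has_vector_derivative)
  have mvt: "\<exists>z. a < z \<and> z < b \<and> g b - g a = (b - a) * p z" if "a < b" for a b
    using MVT2[OF that, of g p] g by blast
  have mono: "g a \<le> g b" if "a \<le> b" for a b
  proof (cases "a = b")
    case False
    then have "a < b" using \<open>a \<le> b\<close> by simp
    from mvt[OF this] obtain z where "g b - g a = (b - a) * p z" by blast
    moreover have "(b - a) * p z \<ge> 0" using that p0 by (intro mult_nonneg_nonneg) auto
    ultimately show ?thesis by linarith
  qed simp
  have low: "g s = g 0" if "s \<le> 0" for s
  proof (cases "s = 0")
    case False
    then obtain z where "s < z" "z < 0" "g 0 - g s = (0 - s) * p z" using mvt[of s 0] \<open>s \<le> 0\<close> by auto
    then show ?thesis using pz[of z] by simp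
  qed simp
  have high: "g s = g 1" if "s \<ge> 1" for s
  proof (cases "s = 1")
    case False
    then obtain z where "1 < z" "z < s" "g s - g 1 = (s - 1) * p z" using mvt[of 1 s] \<open>s \<ge> 1\<close> by auto
    then show ?thesis using pz[of z] by simp
  qed simp
  define D where "D = g 1 - g 0"
  obtain z where z: "0 < z" "z < 1" "D = p z" using mvt[of 0 1] by (auto simp: D_def)
  have D: "D > 0" using pp[OF z(1,2)] z(3) by simp
  have der: "((\<lambda>s. (g s - g 0) * (1 / D)) has_real_derivative p s * (1 / D)) (at s)" for s
    using D by (auto intro!: derivative_eq_intros g)
  have sp': "smooth (\<lambda>s. p s * (1 / D))" by (intro smooth_mult sp smooth_const)
  show ?thesis
  proof (rule that[of "\<lambda>s. (g s - g 0) * (1 / D)" "\<lambda>s. p s * (1 / D)" "1 / D"])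
    show "smooth (\<lambda>s. (g s - g 0) * (1 / D))" by (rule smooth_real_antiderivative[OF der sp'])
    show "0 \<le> (g s - g 0) * (1 / D)" for s
      using D mono[of 0 s] low[of s] by (cases "s \<le> 0") auto
    have "g s \<le> g 1" for s using mono[of s 1] high[of s] by (cases "s \<le> 1") auto
    then show "(g s - g 0) * (1 / D) \<le> 1" for s
      using D by (simp add: D_def)
    show "\<bar>p s * (1 / D)\<bar> \<le> 1 / D" for s using p0[of s] D by (simp add: divide_right_mono)
    show "(g s - g 0) * (1 / D) = 0" if "s \<le> 0" for s using low[OF that] by simp
    show "(g s - g 0) * (1 / D) = 1" if "s \<ge> 1" for s using high[OF that] D by (simp add: D_def)
    show "p s * (1 / D) = 0" if "s \<le> 0 \<or> s \<ge> 1" for s using pz[OF that] by simp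
    show "smooth (\<lambda>s. p s * (1 / D))" by (rule sp')
    show "((\<lambda>s. (g s - g 0) * (1 / D)) has_real_derivative p s * (1 / D)) (at s)" for s by (rule der)
    show "1 / D > 0" using D by simp
  qed
qed

section \<open>Restricting a smooth function to one of two disjoint open pieces\<close>

lemma has_derivative_zero_off_closed:
  fixes f :: "'b::euclidean_space \<Rightarrow> real"
  assumes "closed K" "\<And>x. x \<notin> K \<Longrightarrow> f x = 0" "x \<notin> K"
  shows "(f has_derivative (\<lambda>h. 0)) (at x)"
proof (rule has_derivative_transform_within_open[OF has_derivative_const])
  show "open (- K)" using assms(1) by (rule open_Compl)
  show "x \<in> - K" using assms(3) by simp
  show "0 = f y" if "y \<in> - K" for y using assms(2)[of y] that by simp
qed

text \<open>The set \<open>K\<close> carrying \<open>f\<close> is covered by the disjoint open sets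
  \<open>U\<close> and \<open>V\<close>, so the indicator of \<open>U\<close> is locally constant
  near its points; off \<open>K\<close> the product vanishes.\<close>

lemma has_derivative_indicator_mult:
  fixes f :: "'b::euclidean_space \<Rightarrow> real"
  assumes K: "closed K" "\<And>x. x \<notin> K \<Longrightarrow> f x = 0" "K \<subseteq> U \<union> V" and UV: "open U" "open V" "U \<inter> V = {}"
    and d: "f differentiable at x"
  shows "((\<lambda>x. indicator U x * f x) has_derivative (\<lambda>h. indicator U x * frechet_derivative f (at x) h)) (at x)"
proof -
  consider "x \<in> U" | "x \<notin> U" "x \<notin> K" | "x \<notin> U" "x \<in> V" using K(3) by blast
  then show ?thesis
  proof cases
    case 1
    have "((\<lambda>x. indicator U x * f x) has_derivative frechet_derivative f (at x)) (at x)"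
      by (rule has_derivative_transform_within_open[OF frechet_derivative_works[THEN iffD1, OF d] UV(1) 1]) simp
    then show ?thesis using 1 by simp
  next
    case 2
    have "((\<lambda>x. indicator U x * f x) has_derivative (\<lambda>h. 0)) (at x)"
      by (rule has_derivative_zero_off_closed[OF K(1) _ 2(2)]) (simp add: K(2))
    then show ?thesis using 2 by simp
  next
    case 3
    have "((\<lambda>x. indicator U x * f x) has_derivative (\<lambda>h. 0)) (at x)"
    proof (rule has_derivative_zero_off_closed[of "- V"])
      show "closed (- V)" using UV(2) by (simp add: closed_Compl)
      show "indicator U y * f y = 0" if "y \<notin> - V" for y using that UV(3) by (auto simp: indicator_def)
    qed (use 3 in auto)
    then show ?thesis using 3 by simp
  qed
qed

text \<open>The derivatives of \<open>f\<close> vanish off the closed set \<open>K\<close> as well,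
  so the hypotheses pass to them and the induction closes.\<close>

lemma Ck_indicator_mult:
  fixes f :: "'b::euclidean_space \<Rightarrow> real"
  assumes K: "closed K" "K \<subseteq> U \<union> V" and UV: "open U" "open V" "U \<inter> V = {}"
  shows "Ck n f \<Longrightarrow> (\<And>x. x \<notin> K \<Longrightarrow> f x = 0) \<Longrightarrow> Ck n (\<lambda>x. indicator U x * f x)"
proof (induction n arbitrary: f)
  case 0
  show ?case
    by (rule Ck_0I[OF has_derivative_indicator_mult[OF K(1) 0(2) K(2) UV]]) (use 0 in auto)
next
  case (Suc n)
  show ?case
  proof (rule Ck_SucI[OF has_derivative_indicator_mult[OF K(1) Suc.prems(2) K(2) UV]])
    show "f differentiable at x" for x using Suc.prems(1) by simp
    fix b :: 'b assume b: "b \<in> Basis"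
    show "Ck n (\<lambda>x. indicator U x * frechet_derivative f (at x) b)"
    proof (rule Suc.IH[OF Ck_SucE(2)[OF Suc.prems(1) b]])
      fix x assume "x \<notin> K"
      have "frechet_derivative f (at x) = (\<lambda>h. 0)"
        by (rule frechet_derivative_at[symmetric, OF has_derivative_zero_off_closed[OF K(1) Suc.prems(2) \<open>x \<notin> K\<close>]])
      then show "frechet_derivative f (at x) b = 0" by simp
    qed
  qed
qed

text \<open>The cylinder \<open>C\<close> and the remainder \<open>V\<close> overlap only up to
  height \<open>R0 < R\<close>. Above it they are disjoint open sets, so a test function of
  \<open>C \<union> V\<close> that has been cut off below height \<open>R\<close> falls into two
  smooth pieces, of which the indicator keeps the one in \<open>C\<close>.\<close>

lemma multiplier_cutoff:
  fixes C V :: "'b::euclidean_space set" and \<nu> c :: 'b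
  defines "s \<equiv> (\<lambda>x. (x - c) \<bullet> \<nu>)"
  assumes C: "open C" and V: "open V" and CV: "\<And>x. x \<in> C \<Longrightarrow> x \<in> V \<Longrightarrow> s x \<le> R0" and R: "R0 < R"
    and chi: "smooth \<eta>" "smooth \<eta>'" "\<And>s. (\<eta> has_real_derivative \<eta>' s) (at s)" "\<And>s. 0 \<le> \<eta> s" "\<And>s. \<eta> s \<le> 1"
      "\<And>s. s \<le> 0 \<Longrightarrow> \<eta> s = 0" "\<And>s. \<bar>\<eta>' s\<bar> \<le> M" "\<And>s. s \<le> 0 \<Longrightarrow> \<eta>' s = 0"
  shows "multiplier (C \<union> V) C (\<lambda>x. indicator C x * \<eta> (s x - R)) (\<lambda>x. (indicator C x * \<eta>' (s x - R)) *\<^sub>R \<nu>)"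
proof -
  define h where "h x = \<eta> (s x - R)" for x
  have s_eq: "s x - R = x \<bullet> \<nu> + (- (c \<bullet> \<nu>) - R)" for x by (simp add: s_def inner_diff_left)
  have sms: "smooth (\<lambda>x. s x - R)" unfolding s_eq by (intro smooth_add smooth_inner smooth_const)
  have smh: "smooth h" unfolding h_def[abs_def] by (rule smooth_compose_real[OF chi(1) sms])
  have gh: "grad h x = \<eta>' (s x - R) *\<^sub>R \<nu>" for x
  proof (rule grad_eqI)
    have "((\<lambda>x. s x - R) has_derivative (\<lambda>h. h \<bullet> \<nu>)) (at x)"
      unfolding s_def by (auto intro!: derivative_eq_intros)
    from has_derivative_compose[OF this, of \<eta> "\<lambda>y. \<eta>' (s x - R) * y"] chi(3)[of "s x - R"]
    show "(h has_derivative (\<lambda>h. \<eta>' (s x - R) *\<^sub>R \<nu> \<bullet> h)) (at x)"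
      by (simp add: h_def[abs_def] has_field_derivative_def inner_commute)
  qed
  have cs: "continuous_on UNIV (\<lambda>x. s x - R)" by (rule smooth_continuous[OF sms])
  have ms[measurable]: "s \<in> borel_measurable borel" unfolding s_def by measurable
  have mchi[measurable]: "\<eta> \<in> borel_measurable borel" "\<eta>' \<in> borel_measurable borel"
    using chi(1,2) by (auto intro!: borel_measurable_continuous_onI smooth_continuous)
  have Cm[measurable]: "C \<in> sets borel" using C by simp
  have M: "M \<ge> 0" using chi(7)[of 0] by linarith
  show ?thesis
    unfolding multiplier_def
  proof (intro conjI allI impI exI)
    show "(\<lambda>x. indicator C x * \<eta> (s x - R)) \<in> borel_measurable borel" by measurable
    show "(\<lambda>x. (indicator C x * \<eta>' (s x - R)) *\<^sub>R \<nu>) \<in> borel_measurable borel" by measurable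
    show "\<bar>indicator C x * \<eta> (s x - R)\<bar> \<le> 1 + M * norm \<nu>" for x
      using chi(4,5)[of "s x - R"] mult_nonneg_nonneg[OF M norm_ge_zero[of \<nu>]]
      by (cases "x \<in> C") (simp_all, linarith?)
    show "norm ((indicator C x * \<eta>' (s x - R)) *\<^sub>R \<nu>) \<le> 1 + M * norm \<nu>" for x
      using mult_right_mono[OF chi(7)[of "s x - R"] norm_ge_zero[of \<nu>]] mult_nonneg_nonneg[OF M norm_ge_zero[of \<nu>]]
      by (simp add: indicator_def)
    fix \<phi> assume p: "test_fun (C \<union> V) \<phi>"
    obtain K where K: "compact K" "K \<subseteq> C \<union> V" "\<And>x. x \<notin> K \<Longrightarrow> \<phi> x = 0" using test_funE[OF p] by metis
    define f where "f x = h x * \<phi> x" for x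
    have smf: "smooth f" unfolding f_def[abs_def] by (intro smooth_mult smh test_fun_smooth[OF p])
    define K' where "K' = K \<inter> {x. R \<le> s x}"
    have cl: "closed {x. R \<le> s x}" using closed_Collect_le[OF continuous_on_const cs, of 0] by simp
    have K': "compact K'" unfolding K'_def by (rule compact_Int_closed[OF K(1) cl])
    have f0: "f x = 0" if "x \<notin> K'" for x
      using that K(3)[of x] chi(6)[of "s x - R"] by (auto simp: K'_def f_def h_def)
    have op: "open {x. R0 < s x}" using open_Collect_less[OF continuous_on_const cs, of "R0 - R"] by simp
    define U W where "U = C \<inter> {x. R0 < s x}" and "W = V \<inter> {x. R0 < s x}"
    have UW: "open U" "open W" "U \<inter> W = {}" using C V op CV by (force simp: U_def W_def)+
    have KUW: "K' \<subseteq> U \<union> W" using K(2) R by (auto simp: K'_def U_def W_def)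
    have eq: "(\<lambda>x. indicator C x * \<eta> (s x - R) * \<phi> x) = (\<lambda>x. indicator U x * f x)"
      using R chi(6) by (auto simp: fun_eq_iff indicator_def U_def f_def h_def)
    have df: "f differentiable at x" for x by (rule smooth_differentiable[OF smf])
    show "test_fun C (\<lambda>x. indicator C x * \<eta> (s x - R) * \<phi> x)"
      unfolding eq
    \<comment> \<open>Removing the open set \<open>W\<close> from the compact set \<open>K'\<close>
      leaves the part in \<open>U\<close> and preserves compactness.\<close>
    proof (rule test_funI[where K="K' \<inter> - W"])
      show "smooth (\<lambda>x. indicator U x * f x)"
        using smf f0 unfolding smooth_iff_Ck
        by (auto intro!: Ck_indicator_mult[OF compact_imp_closed[OF K'] KUW UW])
      show "compact (K' \<inter> - W)" using K' UW(2) by (intro compact_Int_closed closed_Compl)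
      show "K' \<inter> - W \<subseteq> C" using KUW by (auto simp: U_def)
      show "indicator U x * f x = 0" if "x \<notin> K' \<inter> - W" for x
        using that f0[of x] UW(3) by (auto simp: indicator_def)
    qed
    fix x
    have "grad (\<lambda>x. indicator U x * f x) x = indicator U x *\<^sub>R grad f x"
      using has_derivative_indicator_mult[OF compact_imp_closed[OF K'] f0 KUW UW df]
      by (intro grad_eqI) (simp add: frechet_eq_grad[OF df])
    also have "grad f x = h x *\<^sub>R grad \<phi> x + \<phi> x *\<^sub>R (\<eta>' (s x - R) *\<^sub>R \<nu>)"
      unfolding f_def[abs_def] gh[symmetric]
      by (rule grad_mult[OF smooth_differentiable[OF smh] test_fun_differentiable[OF p]])
    also have "indicator U x *\<^sub>R (h x *\<^sub>R grad \<phi> x + \<phi> x *\<^sub>R (\<eta>' (s x - R) *\<^sub>R \<nu>)) =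
      (indicator C x * \<eta> (s x - R)) *\<^sub>R grad \<phi> x + \<phi> x *\<^sub>R ((indicator C x * \<eta>' (s x - R)) *\<^sub>R \<nu>)"
      using R chi(6)[of "s x - R"] chi(8)[of "s x - R"] by (auto simp: indicator_def U_def h_def)
    finally show "grad (\<lambda>x. indicator C x * \<eta> (s x - R) * \<phi> x) x =
      (indicator C x * \<eta> (s x - R)) *\<^sub>R grad \<phi> x + \<phi> x *\<^sub>R ((indicator C x * \<eta>' (s x - R)) *\<^sub>R \<nu>)"
      unfolding eq .
  qed
qed

text \<open>Prepares the test function \<open>\<zeta> x * \<zeta> x * u x\<close> of the energy
  identity. \<open>\<zeta>\<close> is applied twice, and \<open>B \<subseteq> A\<close> makes the
  outcome of the first application a test function on \<open>A\<close> again.\<close>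

lemma multiplier_square:
  assumes m: "multiplier A B \<zeta> \<gamma>" and B: "B \<subseteq> A"
  shows "multiplier A B (\<lambda>x. \<zeta> x * \<zeta> x) (\<lambda>x. (2 * \<zeta> x) *\<^sub>R \<gamma> x)"
  unfolding multiplier_def
proof (intro conjI allI impI)
  have [measurable]: "\<zeta> \<in> borel_measurable borel" "\<gamma> \<in> borel_measurable borel" using m by (auto simp: multiplier_def)
  show "(\<lambda>x. \<zeta> x * \<zeta> x) \<in> borel_measurable borel" "(\<lambda>x. (2 * \<zeta> x) *\<^sub>R \<gamma> x) \<in> borel_measurable borel" by measurable
  obtain K where K: "\<And>x. \<bar>\<zeta> x\<bar> \<le> K" "\<And>x. norm (\<gamma> x) \<le> K" using m unfolding multiplier_def by blast
  have K0: "K \<ge> 0" using K(1)[of undefined] by linarith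
  show "\<exists>K. (\<forall>x. \<bar>\<zeta> x * \<zeta> x\<bar> \<le> K) \<and> (\<forall>x. norm ((2 * \<zeta> x) *\<^sub>R \<gamma> x) \<le> K)"
  proof (intro exI[of _ "2 * (K * K)"] conjI allI)
    show "\<bar>\<zeta> x * \<zeta> x\<bar> \<le> 2 * (K * K)" for x
    proof -
      have "\<bar>\<zeta> x\<bar> * \<bar>\<zeta> x\<bar> \<le> K * K" by (intro mult_mono K K0) auto
      then show ?thesis using mult_nonneg_nonneg[OF K0 K0] unfolding abs_mult by linarith
    qed
    show "norm ((2 * \<zeta> x) *\<^sub>R \<gamma> x) \<le> 2 * (K * K)" for x
      using mult_mono[OF K(1)[of x] K(2)[of x] K0] by (simp add: abs_mult)
  qed
  fix \<phi> assume p: "test_fun A \<phi>"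
  have 1: "test_fun B (\<lambda>x. \<zeta> x * \<phi> x)" "\<And>x. grad (\<lambda>x. \<zeta> x * \<phi> x) x = \<zeta> x *\<^sub>R grad \<phi> x + \<phi> x *\<^sub>R \<gamma> x"
    using m p unfolding multiplier_def by blast+
  have 2: "test_fun B (\<lambda>x. \<zeta> x * (\<zeta> x * \<phi> x))"
    "\<And>x. grad (\<lambda>x. \<zeta> x * (\<zeta> x * \<phi> x)) x = \<zeta> x *\<^sub>R grad (\<lambda>x. \<zeta> x * \<phi> x) x + (\<zeta> x * \<phi> x) *\<^sub>R \<gamma> x"
    using m test_fun_mono[OF 1(1) B] unfolding multiplier_def by blast+
  show "test_fun B (\<lambda>x. \<zeta> x * \<zeta> x * \<phi> x)" using 2(1) by (simp add: mult.assoc)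
  show "grad (\<lambda>x. \<zeta> x * \<zeta> x * \<phi> x) x = (\<zeta> x * \<zeta> x) *\<^sub>R grad \<phi> x + \<phi> x *\<^sub>R ((2 * \<zeta> x) *\<^sub>R \<gamma> x)" for x
  proof -
    have "\<phi> x *\<^sub>R ((2 * \<zeta> x) *\<^sub>R \<gamma> x) = (\<zeta> x * \<phi> x) *\<^sub>R \<gamma> x + (\<zeta> x * \<phi> x) *\<^sub>R \<gamma> x"
      unfolding scaleR_left_distrib[symmetric] scaleR_scaleR
      by (rule arg_cong[where f="\<lambda>r. r *\<^sub>R \<gamma> x"]) simp
    then show ?thesis using 2(2)[of x] unfolding 1(2)
      by (simp add: mult.assoc scaleR_add_right)
  qed
qed

text \<open>Testing with \<open>\<zeta> x * \<zeta> x * u x\<close> and completing the square gives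
  an exact identity: the energy of \<open>\<zeta> u\<close> is \<open>lam\<close> times its squared
  norm plus the integral of \<open>(norm (u x *\<^sub>R \<gamma> x))\<^sup>2\<close>. The Poincare
  inequality on \<open>C\<close>, passed to the limit along the approximants, bounds the same energy
  from below.\<close>

lemma multiplier_Caccioppoli:
  fixes A C :: "'b::euclidean_space set"
  assumes A: "open A" and CA: "C \<subseteq> A" and u: "eigenfunction A lam u" and m: "multiplier A C \<zeta> \<gamma>"
    and P: "\<And>\<psi>. test_fun C \<psi> \<Longrightarrow> \<Lambda> * (\<integral>x. (\<psi> x)\<^sup>2 \<partial>lborel) \<le> (\<integral>x. (norm (grad \<psi> x))\<^sup>2 \<partial>lborel)"
  shows "(\<Lambda> - lam) * (\<integral>x. (\<zeta> x * u x)\<^sup>2 \<partial>lebesgue_on A) \<le> (\<integral>x. (norm (u x *\<^sub>R \<gamma> x))\<^sup>2 \<partial>lebesgue_on A)"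
proof -
  let ?M = "lebesgue_on A"
  let ?g = "wgrad A u"
  note Am = open_sets_lebesgue[OF A]
  note W = eigenfunction_W0[OF u]
  note s = W0_sqi[OF A W]
  obtain K where K: "\<And>x. \<bar>\<zeta> x\<bar> \<le> K" "\<And>x. norm (\<gamma> x) \<le> K" using m unfolding multiplier_def by blast
  have meas: "\<zeta> \<in> borel_measurable ?M" "\<gamma> \<in> borel_measurable ?M"
    using m by (auto simp: multiplier_def intro: borel_measurable_lebesgue_on)
  have zg: "sqi ?M (\<lambda>x. \<zeta> x *\<^sub>R ?g x)" by (rule sqi_scale[OF meas(1) K(1) s(2)])
  have ug: "sqi ?M (\<lambda>x. u x *\<^sub>R \<gamma> x)" by (rule sqi_vec[OF meas(2) K(2) s(1)])
  let ?G = "\<lambda>x. \<zeta> x *\<^sub>R ?g x + u x *\<^sub>R \<gamma> x"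
  have sG: "sqi ?M ?G" by (rule sqi_add[OF zg ug])
  obtain \<psi>s where p: "\<And>n. test_fun C (\<psi>s n)" "L2conv ?M \<psi>s (\<lambda>x. \<zeta> x * u x)" "L2conv ?M (\<lambda>n. grad (\<psi>s n)) ?G"
    using multiplier_W0_approx[OF A m W] by metis
  have "\<Lambda> * (\<integral>x. (\<zeta> x * u x)\<^sup>2 \<partial>?M) \<le> (\<integral>x. (norm (?G x))\<^sup>2 \<partial>?M)"
  proof (rule LIMSEQ_le[OF tendsto_mult_left[OF L2conv_power2[OF p(2)]] L2conv_norm[OF p(3)]], intro exI allI impI)
    fix n :: nat
    obtain L where L: "L \<subseteq> C" "\<And>x. x \<notin> L \<Longrightarrow> \<psi>s n x = 0" "\<And>x. x \<notin> L \<Longrightarrow> grad (\<psi>s n) x = 0"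
      using test_funE[OF p(1)[of n]] by metis
    note sm = test_fun_smooth[OF p(1)[of n]]
    have [measurable]: "\<psi>s n \<in> borel_measurable borel" "grad (\<psi>s n) \<in> borel_measurable borel"
      using sm by (auto intro!: borel_measurable_continuous_onI smooth_continuous continuous_grad)
    have "(\<integral>x. (\<psi>s n x)\<^sup>2 \<partial>?M) = (\<integral>x. (\<psi>s n x)\<^sup>2 \<partial>lborel)"
      by (intro integral_lebesgue_on_eq_lborel Am) (use L CA in auto)
    moreover have "(\<integral>x. (norm (grad (\<psi>s n) x))\<^sup>2 \<partial>?M) = (\<integral>x. (norm (grad (\<psi>s n) x))\<^sup>2 \<partial>lborel)"
      by (intro integral_lebesgue_on_eq_lborel Am) (use L CA in auto)
    ultimately show "\<Lambda> * (\<integral>x. (\<psi>s n x)\<^sup>2 \<partial>?M) \<le> (\<integral>x. (norm (grad (\<psi>s n) x))\<^sup>2 \<partial>?M)"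
      using P[OF p(1)[of n]] by simp
  qed
  moreover have "(\<integral>x. (norm (?G x))\<^sup>2 \<partial>?M) = lam * (\<integral>x. (\<zeta> x * u x)\<^sup>2 \<partial>?M) + (\<integral>x. (norm (u x *\<^sub>R \<gamma> x))\<^sup>2 \<partial>?M)"
  proof -
    note m2 = multiplier_W0[OF A multiplier_square[OF m CA] CA W]
    have "lam * (\<integral>x. (\<zeta> x * u x)\<^sup>2 \<partial>?M) = lam * (\<integral>x. u x * (\<zeta> x * \<zeta> x * u x) \<partial>?M)"
      by (simp add: power2_eq_square mult_ac)
    also have "\<dots> = (\<integral>x. ?g x \<bullet> ((\<zeta> x * \<zeta> x) *\<^sub>R ?g x + u x *\<^sub>R ((2 * \<zeta> x) *\<^sub>R \<gamma> x)) \<partial>?M)"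
      by (rule eigenfunction_test[OF A u m2, symmetric])
    also have "\<dots> = (\<integral>x. (norm (?G x))\<^sup>2 - (norm (u x *\<^sub>R \<gamma> x))\<^sup>2 \<partial>?M)"
    proof (intro Bochner_Integration.integral_cong refl)
      fix x
      have "(norm (?G x))\<^sup>2 = (\<zeta> x *\<^sub>R ?g x) \<bullet> (\<zeta> x *\<^sub>R ?g x) + 2 * ((\<zeta> x *\<^sub>R ?g x) \<bullet> (u x *\<^sub>R \<gamma> x)) + (norm (u x *\<^sub>R \<gamma> x))\<^sup>2"
        unfolding power2_norm_eq_inner by (simp add: inner_add_left inner_add_right inner_commute algebra_simps)
      then show "?g x \<bullet> ((\<zeta> x * \<zeta> x) *\<^sub>R ?g x + u x *\<^sub>R ((2 * \<zeta> x) *\<^sub>R \<gamma> x)) = (norm (?G x))\<^sup>2 - (norm (u x *\<^sub>R \<gamma> x))\<^sup>2"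
        by (simp add: inner_add_right algebra_simps)
    qed
    also have "\<dots> = (\<integral>x. (norm (?G x))\<^sup>2 \<partial>?M) - (\<integral>x. (norm (u x *\<^sub>R \<gamma> x))\<^sup>2 \<partial>?M)"
      using sG ug by (intro Bochner_Integration.integral_diff) (auto simp: sqi_def)
    finally show ?thesis by simp
  qed
  ultimately show ?thesis by (simp add: algebra_simps)
qed

section \<open>Mass beyond a given height in one cylinder\<close>

lemma integrable_indicator_power2:
  assumes S: "S \<in> sets borel" and u: "sqi (lebesgue_on A) u"
  shows "integrable (lebesgue_on A) (\<lambda>x. indicator S x * (u x)\<^sup>2 :: real)"
proof -
  have "(indicator S :: _ \<Rightarrow> real) \<in> borel_measurable borel" using S by simp
  note m = borel_measurable_lebesgue_on[OF this]
  have "\<bar>indicator S x :: real\<bar> \<le> 1" for x by (simp add: indicator_def)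
  from sqi_mult[OF u sqi_scale[OF m this u]] show ?thesis by (simp add: power2_eq_square mult_ac)
qed

definition tail :: "'b::euclidean_space set \<Rightarrow> ('b \<Rightarrow> real) \<Rightarrow> 'b set \<Rightarrow> ('b \<Rightarrow> real) \<Rightarrow> real \<Rightarrow> real" where
  "tail A u C s R = (\<integral>x. indicator {x \<in> C. R \<le> s x} x * (u x)\<^sup>2 \<partial>lebesgue_on A)"

text \<open>\<open>\<zeta>\<close> equals 1 on \<open>C\<close> from height \<open>R + 1\<close> on,
  and \<open>\<gamma>\<close> lives between the heights \<open>R\<close> and \<open>R + 1\<close>,
  where its norm is at most \<open>M\<close>. The far mass is thus bounded by the mass of a slab, a
  difference of two tails; this is the form for hole filling, in which the farther tail is moved to
  the left.\<close>

lemma tail_step: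
  fixes C V :: "'b::euclidean_space set" and \<nu> c :: 'b
  defines "s \<equiv> (\<lambda>x. (x - c) \<bullet> \<nu>)"
  assumes C: "open C" and V: "open V" and CV: "\<And>x. x \<in> C \<Longrightarrow> x \<in> V \<Longrightarrow> s x \<le> R0" and R: "R0 < R"
    and chi: "smooth \<eta>" "smooth \<eta>'" "\<And>s. (\<eta> has_real_derivative \<eta>' s) (at s)" "\<And>s. 0 \<le> \<eta> s" "\<And>s. \<eta> s \<le> 1"
      "\<And>s. s \<le> 0 \<Longrightarrow> \<eta> s = 0" "\<And>s. s \<ge> 1 \<Longrightarrow> \<eta> s = 1" "\<And>s. \<bar>\<eta>' s\<bar> \<le> M" "\<And>s. s \<le> 0 \<or> s \<ge> 1 \<Longrightarrow> \<eta>' s = 0"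
    and nu: "norm \<nu> = 1" and u: "eigenfunction (C \<union> V) lam u" and lam: "lam < \<Lambda>"
    and P: "\<And>\<psi>. test_fun C \<psi> \<Longrightarrow> \<Lambda> * (\<integral>x. (\<psi> x)\<^sup>2 \<partial>lborel) \<le> (\<integral>x. (norm (grad \<psi> x))\<^sup>2 \<partial>lborel)"
  shows "(\<Lambda> - lam) * tail (C \<union> V) u C s (R + 1) \<le> M\<^sup>2 * (tail (C \<union> V) u C s R - tail (C \<union> V) u C s (R + 1))"
proof -
  let ?M = "lebesgue_on (C \<union> V)"
  have A: "open (C \<union> V)" using C V by blast
  define \<zeta> where "\<zeta> x = indicator C x * \<eta> (s x - R)" for x
  define \<gamma> where "\<gamma> x = (indicator C x * \<eta>' (s x - R)) *\<^sub>R \<nu>" for x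
  have m: "multiplier (C \<union> V) C \<zeta> \<gamma>"
    using multiplier_cutoff[OF C V, of c \<nu> R0 R \<eta> \<eta>' M] CV R chi unfolding \<zeta>_def[abs_def] \<gamma>_def[abs_def] s_def by blast
  note sq = W0_sqi(1)[OF A eigenfunction_W0[OF u]]
  have [measurable]: "C \<in> sets borel" "s \<in> borel_measurable borel" using C by (auto simp: s_def)
  have ii: "integrable ?M (\<lambda>x. indicator {x \<in> C. R \<le> s x} x * (u x)\<^sup>2)" for R
    by (rule integrable_indicator_power2[OF _ sq]) measurable
  obtain K where K: "\<And>x. \<bar>\<zeta> x\<bar> \<le> K" "\<And>x. norm (\<gamma> x) \<le> K" using m unfolding multiplier_def by blast
  have meas: "\<zeta> \<in> borel_measurable ?M" "\<gamma> \<in> borel_measurable ?M"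
    using m by (auto simp: multiplier_def intro: borel_measurable_lebesgue_on)
  have i1: "integrable ?M (\<lambda>x. (\<zeta> x * u x)\<^sup>2)" using sqi_scale[OF meas(1) K(1) sq] by (simp add: sqi_def)
  have i2: "integrable ?M (\<lambda>x. (norm (u x *\<^sub>R \<gamma> x))\<^sup>2)" using sqi_vec[OF meas(2) K(2) sq] by (simp add: sqi_def)
  have "(\<Lambda> - lam) * tail (C \<union> V) u C s (R + 1) \<le> (\<Lambda> - lam) * (\<integral>x. (\<zeta> x * u x)\<^sup>2 \<partial>?M)"
    unfolding tail_def
  proof (intro mult_left_mono integral_mono ii i1)
    show "indicator {x \<in> C. R + 1 \<le> s x} x * (u x)\<^sup>2 \<le> (\<zeta> x * u x)\<^sup>2" for x
      using chi(7)[of "s x - R"] by (auto simp: \<zeta>_def indicator_def)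
  qed (use lam in simp)
  also have "\<dots> \<le> (\<integral>x. (norm (u x *\<^sub>R \<gamma> x))\<^sup>2 \<partial>?M)"
    by (rule multiplier_Caccioppoli[OF A _ u m P]) auto
  also have "\<dots> \<le> (\<integral>x. M\<^sup>2 * (indicator {x \<in> C. R \<le> s x} x * (u x)\<^sup>2 - indicator {x \<in> C. R + 1 \<le> s x} x * (u x)\<^sup>2) \<partial>?M)"
  proof (intro integral_mono i2)
    show "integrable ?M (\<lambda>x. M\<^sup>2 * (indicator {x \<in> C. R \<le> s x} x * (u x)\<^sup>2 - indicator {x \<in> C. R + 1 \<le> s x} x * (u x)\<^sup>2))"
      by (intro integrable_mult_right Bochner_Integration.integrable_diff ii)
    fix x
    have "(\<eta>' (s x - R))\<^sup>2 \<le> M\<^sup>2" using chi(8)[of "s x - R"] by (metis abs_ge_zero power2_abs power_mono)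
    then have "(u x)\<^sup>2 * (\<eta>' (s x - R))\<^sup>2 \<le> M\<^sup>2 * (u x)\<^sup>2" by (metis mult.commute mult_left_mono zero_le_power2)
    then show "(norm (u x *\<^sub>R \<gamma> x))\<^sup>2 \<le> M\<^sup>2 * (indicator {x \<in> C. R \<le> s x} x * (u x)\<^sup>2 - indicator {x \<in> C. R + 1 \<le> s x} x * (u x)\<^sup>2)"
      using nu chi(9)[of "s x - R"] by (auto simp: \<gamma>_def indicator_def power_mult_distrib)
  qed
  also have "\<dots> = M\<^sup>2 * (tail (C \<union> V) u C s R - tail (C \<union> V) u C s (R + 1))"
    unfolding tail_def using ii by simp
  finally show ?thesis .
qed

text \<open>For \<open>R \<le> R0 + 1\<close> the factor in front of \<open>n\<close> is at least 1
  and the trivial bound suffices. Beyond, the step is iterated from a height still above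
  \<open>R0\<close>; rounding to whole steps costs at most one factor \<open>\<theta>\<close>, hence
  the \<open>- 1\<close> in the exponent.\<close>

lemma geometric_decay:
  fixes m :: "real \<Rightarrow> real"
  assumes \<theta>: "0 < \<theta>" "\<theta> < 1" and n: "\<And>R. m R \<le> n" "n \<ge> 0"
    and step: "\<And>R. R > R0 \<Longrightarrow> m (R + 1) \<le> \<theta> * m R"
  shows "m R \<le> \<theta> powr (- R0 - 1) * n * \<theta> powr R"
proof -
  have e: "\<theta> powr (- R0 - 1) * n * \<theta> powr R = n * \<theta> powr (R - R0 - 1)"
  proof -
    have "R - R0 - 1 = R + (- R0 - 1)" by simp
    then show ?thesis by (simp only: powr_add mult_ac)
  qed
  show ?thesis
  proof (cases "R \<le> R0 + 1")
    case True
    have "1 \<le> \<theta> powr (R - R0 - 1)" using \<theta> True powr_mono'[of "R - R0 - 1" 0 \<theta>] by simp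
    then have "n * 1 \<le> n * \<theta> powr (R - R0 - 1)" using n(2) by (intro mult_left_mono)
    then show ?thesis using n(1)[of R] unfolding e by simp
  next
    case False
    have it: "m (S + real k) \<le> \<theta> ^ k * m S" if "S > R0" for S k
    proof (induction k)
      case (Suc k)
      have "m (S + real k + 1) \<le> \<theta> * m (S + real k)" using that by (intro step) auto
      also have "\<dots> \<le> \<theta> * (\<theta> ^ k * m S)" using Suc \<theta> by (intro mult_left_mono) auto
      finally show ?case by (simp add: mult.assoc add_ac)
    qed simp
    \<comment> \<open>The largest \<open>k\<close> with \<open>R - k > R0\<close>: ceiling minus 1
      instead of floor, because \<open>step\<close> demands a strict inequality.\<close>
    define k where "k = nat (\<lceil>R - R0\<rceil> - 1)"
    have k: "real k = real_of_int \<lceil>R - R0\<rceil> - 1" using False by (simp add: k_def)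
    have kk: "real k < R - R0" "R - R0 - 1 \<le> real k" unfolding k by linarith+
    have "m R = m ((R - real k) + real k)" by simp
    also have "\<dots> \<le> \<theta> ^ k * m (R - real k)" using kk by (intro it) auto
    also have "\<dots> \<le> \<theta> ^ k * n" using \<theta> n by (intro mult_left_mono) auto
    also have "\<dots> \<le> \<theta> powr (R - R0 - 1) * n"
      using \<theta> kk n(2) by (intro mult_right_mono) (auto simp: powr_realpow[symmetric] intro!: powr_mono')
    finally show ?thesis unfolding e by (simp add: mult.commute)
  qed
qed

subsection \<open>Domains with cylindrical ends\<close>

lemma open_rigid_image:
  fixes Rot :: "'b::euclidean_space \<Rightarrow> 'b"
  assumes Rot: "orthogonal_transformation Rot" and S: "open S"
  shows "open ((\<lambda>x. Rot x + t) ` S)"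
proof -
  have "open (Rot ` S)"
    by (rule open_surjective_linear_image[OF S orthogonal_transformation_linear[OF Rot] orthogonal_transformation_surj[OF Rot]])
  then have "open ((+) t ` (Rot ` S))" by (rule open_translation)
  then show ?thesis by (simp add: image_image add.commute)
qed

lemma open_cube: "open (cube r)"
proof -
  have "cube r = (\<Inter>b\<in>Basis. {x. \<bar>x \<bullet> b\<bar> < r})" by (auto simp: cube_def)
  also have "open \<dots>" by (intro open_INT finite_Basis ballI open_Collect_less continuous_intros)
  finally show ?thesis .
qed

text \<open>\<open>Rot (0, 1)\<close> is the unit vector of the axis, so the height above the base
  is an inner product and avoids the inverse of \<open>Rot\<close>.\<close>

lemma cyl_heightE:
  fixes Rot :: "('a::euclidean_space \<times> real) \<Rightarrow> ('a \<times> real)"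
  assumes Rot: "orthogonal_transformation Rot" and x: "x \<in> cyl Rot t E"
  obtains y where "x = Rot y + t" "fst y \<in> E" "0 < snd y" "(x - t) \<bullet> Rot (0, 1) = snd y"
proof -
  obtain y where y: "x = Rot y + t" "fst y \<in> E" "0 < snd y" using x by (auto simp: cyl_def)
  have "Rot y \<bullet> Rot (0, 1) = y \<bullet> (0, 1)" using Rot unfolding orthogonal_transformation_def by blast
  then have "(x - t) \<bullet> Rot (0, 1) = snd y" by (simp add: y inner_prod_def)
  then show ?thesis using that y by blast
qed

text \<open>Collects the geometry, with constants that do not depend on \<open>u\<close>. The last
  conclusion is phrased for an arbitrary Borel set lying high up in the cylinders, since it is
  applied to the complement of a truncation as well as to the exterior of a ball.\<close>

lemma waveguide_decay:
  fixes \<Omega>0 :: "('a::euclidean_space \<times> real) set" and E :: "nat \<Rightarrow> 'a set"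
    and Rot :: "nat \<Rightarrow> ('a \<times> real) \<Rightarrow> ('a \<times> real)" and t :: "nat \<Rightarrow> 'a \<times> real" and k :: nat
  defines "\<Omega> \<equiv> \<Omega>_set \<Omega>0 k Rot t E"
  assumes k: "k \<ge> 1" and O0: "open \<Omega>0" "bounded \<Omega>0"
    and E: "\<And>i. i \<in> {1..k} \<Longrightarrow> open (E i)" "\<And>i. i \<in> {1..k} \<Longrightarrow> bounded (E i)"
    and Rot: "\<And>i. i \<in> {1..k} \<Longrightarrow> orthogonal_transformation (Rot i)"
    and disj: "\<And>i j. i \<in> {1..k} \<Longrightarrow> j \<in> {1..k} \<Longrightarrow> i \<noteq> j \<Longrightarrow>
        (cyl (Rot i) (t i) (E i) \<inter> cyl (Rot j) (t j) (E j)) - ball 0 \<rho>0 = {}"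
    and lam: "lam < Min ((\<lambda>i. dir_eig 1 (E i)) ` {1..k})"
  obtains \<theta> B r where "0 < \<theta>" "\<theta> < 1" "B > 0" "r > 0" "open \<Omega>"
    "\<And>x R. R > r \<Longrightarrow> x \<in> \<Omega> - \<Omega>_trunc \<Omega>0 k Rot t E R \<Longrightarrow>
      \<exists>i\<in>{1..k}. x \<in> cyl (Rot i) (t i) (E i) \<and> R \<le> (x - t i) \<bullet> Rot i (0, 1)"
    "\<And>x. x \<in> \<Omega> \<Longrightarrow> norm x > r \<Longrightarrow>
      \<exists>i\<in>{1..k}. x \<in> cyl (Rot i) (t i) (E i) \<and> norm x - 2 * r \<le> (x - t i) \<bullet> Rot i (0, 1)"
    "\<And>u R S. eigenfunction \<Omega> lam u \<Longrightarrow> S \<in> sets borel \<Longrightarrow>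
      (\<And>x. x \<in> S \<Longrightarrow> \<exists>i\<in>{1..k}. x \<in> cyl (Rot i) (t i) (E i) \<and> R \<le> (x - t i) \<bullet> Rot i (0, 1)) \<Longrightarrow>
      (\<integral>x. indicator S x * (u x)\<^sup>2 \<partial>lebesgue_on \<Omega>) \<le> B * (\<integral>x. (u x)\<^sup>2 \<partial>lebesgue_on \<Omega>) * \<theta> powr R"
proof -
  let ?I = "{1..k}"
  define C where "C i = cyl (Rot i) (t i) (E i)" for i
  define s where "s i x = (x - t i) \<bullet> Rot i (0, 1)" for i x
  \<comment> \<open>Everything but the \<open>i\<close>-th cylinder:
    \<open>\<Omega> = C i \<union> V i\<close> is the splitting on which \<open>tail_step\<close>
    works.\<close>
  define V where "V i = \<Omega>0 \<union> (\<Union>j\<in>?I - {i}. C j)" for i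
  have \<Omega>_eq: "\<Omega> = \<Omega>0 \<union> (\<Union>i\<in>?I. C i)" by (simp add: \<Omega>_def \<Omega>_set_def C_def)
  have oC: "open (C i)" if "i \<in> ?I" for i
    unfolding C_def cyl_def by (intro open_rigid_image Rot that open_Times E(1) open_greaterThan)
  have oV: "open (V i)" if "i \<in> ?I" for i unfolding V_def by (intro open_Un O0(1) open_UN ballI oC) auto
  have CV: "\<Omega> = C i \<union> V i" if "i \<in> ?I" for i using that by (auto simp: \<Omega>_eq V_def)
  have o\<Omega>: "open \<Omega>" unfolding \<Omega>_eq by (intro open_Un O0(1) open_UN ballI oC)
  have "bounded (\<Union>i\<in>?I. E i)" using E(2) by auto
  then obtain r1 where "\<forall>x\<in>(\<Union>i\<in>?I. E i). norm x \<le> r1" unfolding bounded_iff by blast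
  then have r1: "\<And>i x. i \<in> ?I \<Longrightarrow> x \<in> E i \<Longrightarrow> norm x \<le> r1" by blast
  have "bounded (\<Omega>0 \<union> t ` ?I)" using O0(2) by (simp add: finite_imp_bounded)
  then obtain r2 where "\<forall>x\<in>\<Omega>0 \<union> t ` ?I. norm x \<le> r2" unfolding bounded_iff by blast
  then have r2: "\<And>x. x \<in> \<Omega>0 \<Longrightarrow> norm x \<le> r2" "\<And>i. i \<in> ?I \<Longrightarrow> norm (t i) \<le> r2" by blast+
  define r where "r = 1 + \<bar>r1\<bar> + \<bar>r2\<bar> + \<bar>\<rho>0\<bar>"
  have r: "r > 0" "r1 \<le> r" "r2 \<le> r" "\<rho>0 \<le> r" by (auto simp: r_def)
  have nu: "norm (Rot i (0, 1)) = 1" if "i \<in> ?I" for i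
    using orthogonal_transformation_norm[OF Rot[OF that], of "(0, 1)"] by simp
  have s_le: "s i x \<le> norm x + r" if "i \<in> ?I" for i x
  proof -
    have "s i x \<le> norm (x - t i) * norm (Rot i (0, 1))" unfolding s_def by (rule norm_cauchy_schwarz)
    also have "\<dots> \<le> norm x + norm (t i)" using nu[OF that] by (simp add: norm_triangle_ineq4)
    also have "\<dots> \<le> norm x + r" using r2(2)[OF that] r by simp
    finally show ?thesis .
  qed
  have s_ge: "norm x - 2 * r \<le> s i x" if i: "i \<in> ?I" and x: "x \<in> C i" for i x
  proof -
    obtain y where y: "x = Rot i y + t i" "fst y \<in> E i" "0 < snd y" "s i x = snd y"
      using cyl_heightE[OF Rot[OF i] x[unfolded C_def]] unfolding s_def by metis
    have "norm x \<le> norm (Rot i y) + norm (t i)" unfolding y(1) by (rule norm_triangle_ineq)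
    also have "norm (Rot i y) = norm y" by (rule orthogonal_transformation_norm[OF Rot[OF i]])
    also have "norm y \<le> norm (fst y) + norm (snd y)" using norm_Pair_le[of "fst y" "snd y"] by simp
    finally show ?thesis using y r1[OF i y(2)] r2(2)[OF i] r by simp
  qed
  \<comment> \<open>A point that \<open>C i\<close> shares with \<open>\<Omega>0\<close> or with
    another cylinder has norm at most \<open>r\<close>, and a height exceeds the norm by at most
    \<open>r\<close>.\<close>
  have overlap: "s i x \<le> 2 * r" if i: "i \<in> ?I" and x: "x \<in> C i" "x \<in> V i" for i x
  proof -
    have "norm x \<le> r"
    proof (cases "x \<in> \<Omega>0")
      case True then show ?thesis using r2(1)[OF True] r by linarith
    next
      case False
      then have "x \<in> (\<Union>j\<in>?I - {i}. C j)" using x(2) unfolding V_def by blast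
      then obtain j where j: "j \<in> ?I" "j \<noteq> i" "x \<in> C j" by blast
      then have "x \<in> ball 0 \<rho>0" using disj[OF i j(1)] x(1) unfolding C_def by blast
      then show ?thesis using r by simp
    qed
    then show ?thesis using s_le[OF i, of x] by simp
  qed
  define \<Lambda> where "\<Lambda> = Min ((\<lambda>i. dir_eig 1 (E i)) ` ?I)"
  have Poin: "\<Lambda> * (\<integral>x. (\<psi> x)\<^sup>2 \<partial>lborel) \<le> (\<integral>x. (norm (grad \<psi> x))\<^sup>2 \<partial>lborel)"
    if i: "i \<in> ?I" and p: "test_fun (C i) \<psi>" for i \<psi>
  proof -
    have "\<Lambda> \<le> dir_eig 1 (E i)" unfolding \<Lambda>_def using i by (intro Min_le) auto
    then have "\<Lambda> * (\<integral>x. (\<psi> x)\<^sup>2 \<partial>lborel) \<le> dir_eig 1 (E i) * (\<integral>x. (\<psi> x)\<^sup>2 \<partial>lborel)"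
      by (intro mult_right_mono Bochner_Integration.integral_nonneg) auto
    also have "\<dots> \<le> (\<integral>x. (norm (grad \<psi> x))\<^sup>2 \<partial>lborel)"
      by (rule cyl_Poincare[OF Rot[OF i] E(1)[OF i] p[unfolded C_def]])
    finally show ?thesis .
  qed
  obtain \<eta> \<eta>' :: "real \<Rightarrow> real" and M where eta: "smooth \<eta>" "smooth \<eta>'"
    "\<And>s. (\<eta> has_real_derivative \<eta>' s) (at s)" "\<And>s. 0 \<le> \<eta> s" "\<And>s. \<eta> s \<le> 1"
    "\<And>s. s \<le> 0 \<Longrightarrow> \<eta> s = 0" "\<And>s. s \<ge> 1 \<Longrightarrow> \<eta> s = 1" and M: "M > 0"
    and eta': "\<And>s. \<bar>\<eta>' s\<bar> \<le> M" "\<And>s. s \<le> 0 \<or> s \<ge> 1 \<Longrightarrow> \<eta>' s = 0"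
    using ex_cutoff by metis
  define \<delta> where "\<delta> = \<Lambda> - lam"
  have \<delta>: "\<delta> > 0" using lam by (simp add: \<delta>_def \<Lambda>_def)
  \<comment> \<open>Hole filling: \<open>\<delta> * T' \<le> M\<^sup>2 * (T - T')\<close> for two
    consecutive tails \<open>T\<close> and \<open>T'\<close> becomes
    \<open>(M\<^sup>2 + \<delta>) * T' \<le> M\<^sup>2 * T\<close>, and \<open>\<delta> > 0\<close>
    makes the quotient smaller than 1.\<close>
  define \<theta> where "\<theta> = M\<^sup>2 / (M\<^sup>2 + \<delta>)"
  have M2: "M\<^sup>2 > 0" using M by simp
  have M\<delta>: "M\<^sup>2 + \<delta> > 0" using M2 \<delta> by linarith
  have \<theta>: "0 < \<theta>" "\<theta> < 1"
    unfolding \<theta>_def using divide_pos_pos[OF M2 M\<delta>] pos_divide_less_eq[OF M\<delta>] \<delta> by auto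
  define A where "A = \<theta> powr (- (2 * r) - 1)"
  have tail: "tail \<Omega> u (C i) (s i) R \<le> A * (\<integral>x. (u x)\<^sup>2 \<partial>lebesgue_on \<Omega>) * \<theta> powr R"
    if u: "eigenfunction \<Omega> lam u" and i: "i \<in> ?I" for u i R
    unfolding A_def
  proof (rule geometric_decay[OF \<theta>])
    note sq = W0_sqi(1)[OF o\<Omega> eigenfunction_W0[OF u]]
    show "0 \<le> (\<integral>x. (u x)\<^sup>2 \<partial>lebesgue_on \<Omega>)" by (intro Bochner_Integration.integral_nonneg) auto
    show "tail \<Omega> u (C i) (s i) R \<le> (\<integral>x. (u x)\<^sup>2 \<partial>lebesgue_on \<Omega>)" for R
      unfolding tail_def using sqi_power2[OF sq] by (intro integral_mono') (auto simp: indicator_def)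
    fix R :: real assume R: "2 * r < R"
    have "(\<Lambda> - lam) * tail (C i \<union> V i) u (C i) (\<lambda>x. (x - t i) \<bullet> Rot i (0, 1)) (R + 1) \<le> M\<^sup>2 *
      (tail (C i \<union> V i) u (C i) (\<lambda>x. (x - t i) \<bullet> Rot i (0, 1)) R - tail (C i \<union> V i) u (C i) (\<lambda>x. (x - t i) \<bullet> Rot i (0, 1)) (R + 1))"
      by (rule tail_step[OF oC[OF i] oV[OF i] overlap[OF i, unfolded s_def] R eta eta' nu[OF i] _ _ Poin[OF i]])
         (use u lam in \<open>simp_all add: CV[OF i, symmetric] \<Lambda>_def\<close>)
    then have "\<delta> * tail \<Omega> u (C i) (s i) (R + 1) \<le> M\<^sup>2 * (tail \<Omega> u (C i) (s i) R - tail \<Omega> u (C i) (s i) (R + 1))"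
      unfolding CV[OF i, symmetric] \<delta>_def s_def[abs_def] .
    then have "(M\<^sup>2 + \<delta>) * tail \<Omega> u (C i) (s i) (R + 1) \<le> M\<^sup>2 * tail \<Omega> u (C i) (s i) R"
      by (simp add: algebra_simps)
    then show "tail \<Omega> u (C i) (s i) (R + 1) \<le> \<theta> * tail \<Omega> u (C i) (s i) R"
      unfolding \<theta>_def times_divide_eq_left pos_le_divide_eq[OF M\<delta>] by (simp only: mult.commute)
  qed
  show ?thesis
  \<comment> \<open>The tails of all cylinders are added up, which brings in the factor
    \<open>k\<close>.\<close>
  proof (rule that[of \<theta> "real k * A" r, OF \<theta> _ r(1) o\<Omega>])
    show "real k * A > 0" using k \<theta> by (simp add: A_def)
    fix x R assume R: "R > r" and x: "x \<in> \<Omega> - \<Omega>_trunc \<Omega>0 k Rot t E R"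
    have "x \<notin> \<Omega>0" using x k by (auto simp: \<Omega>_trunc_def)
    then obtain i where i: "i \<in> ?I" "x \<in> C i" using x by (auto simp: \<Omega>_eq)
    obtain y where y: "x = Rot i y + t i" "fst y \<in> E i" "0 < snd y" "s i x = snd y"
      using cyl_heightE[OF Rot[OF i(1)] i(2)[unfolded C_def]] unfolding s_def by metis
    have "x \<notin> cubeQ (Rot i) (t i) R" using x i by (auto simp: \<Omega>_trunc_def C_def)
    then have "y \<notin> cube R" unfolding cubeQ_def y(1) by blast
    \<comment> \<open>Some coordinate of \<open>y\<close> has size at least \<open>R\<close>. Those
      of the cross section are at most \<open>r < R\<close>, so it is the height.\<close>
    then obtain b where b: "b \<in> Basis" "R \<le> \<bar>y \<bullet> b\<bar>" by (auto simp: cube_def not_less)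
    have "R \<le> snd y"
      using b(1) unfolding Basis_prod_def
    proof (elim UnE imageE)
      fix c :: 'a assume c: "b = (c, 0)" "c \<in> Basis"
      have "\<bar>y \<bullet> b\<bar> \<le> norm (fst y)" using Basis_le_norm[OF c(2), of "fst y"] by (simp add: c(1) inner_prod_def)
      then show ?thesis using b(2) r1[OF i(1) y(2)] r R by linarith
    next
      fix c :: real assume "b = (0, c)" "c \<in> Basis"
      then show ?thesis using b(2) y(3) by (simp add: inner_prod_def)
    qed
    then show "\<exists>i\<in>?I. x \<in> cyl (Rot i) (t i) (E i) \<and> R \<le> (x - t i) \<bullet> Rot i (0, 1)"
      using i y(4) unfolding C_def s_def by auto
  next
    fix x assume x: "x \<in> \<Omega>" "norm x > r"
    then have "x \<notin> \<Omega>0" using r2(1)[of x] r by force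
    then obtain i where i: "i \<in> ?I" "x \<in> C i" using x by (auto simp: \<Omega>_eq)
    then show "\<exists>i\<in>?I. x \<in> cyl (Rot i) (t i) (E i) \<and> norm x - 2 * r \<le> (x - t i) \<bullet> Rot i (0, 1)"
      using s_ge[OF i] unfolding C_def s_def by auto
  next
    fix u R and S :: "('a \<times> real) set"
    assume u: "eigenfunction \<Omega> lam u" and S: "S \<in> sets borel"
      and cov: "\<And>x. x \<in> S \<Longrightarrow> \<exists>i\<in>?I. x \<in> cyl (Rot i) (t i) (E i) \<and> R \<le> (x - t i) \<bullet> Rot i (0, 1)"
    note sq = W0_sqi(1)[OF o\<Omega> eigenfunction_W0[OF u]]
    note ii = integrable_indicator_power2[OF _ sq]
    have Tm: "{x \<in> C i. R \<le> s i x} \<in> sets borel" if "i \<in> ?I" for i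
    proof -
      have [measurable]: "C i \<in> sets borel" "s i \<in> borel_measurable borel" using oC[OF that] unfolding s_def[abs_def] by measurable
      show ?thesis by measurable
    qed
    have "(\<integral>x. indicator S x * (u x)\<^sup>2 \<partial>lebesgue_on \<Omega>) \<le>
      (\<integral>x. (\<Sum>i\<in>?I. indicator {x \<in> C i. R \<le> s i x} x * (u x)\<^sup>2) \<partial>lebesgue_on \<Omega>)"
    proof (intro integral_mono ii S Bochner_Integration.integrable_sum Tm)
      fix x
      show "indicator S x * (u x)\<^sup>2 \<le> (\<Sum>i\<in>?I. indicator {x \<in> C i. R \<le> s i x} x * (u x)\<^sup>2)"
      proof (cases "x \<in> S")
        case True
        then obtain i where i: "i \<in> ?I" "x \<in> C i" "R \<le> s i x" using cov unfolding C_def s_def by blast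
        have "indicator {x \<in> C i. R \<le> s i x} x * (u x)\<^sup>2 \<le> (\<Sum>i\<in>?I. indicator {x \<in> C i. R \<le> s i x} x * (u x)\<^sup>2)"
          by (rule member_le_sum[OF i(1)]) auto
        then show ?thesis using True i by simp
      qed (simp add: sum_nonneg)
    qed auto
    also have "\<dots> = (\<Sum>i\<in>?I. tail \<Omega> u (C i) (s i) R)"
      unfolding tail_def by (intro Bochner_Integration.integral_sum ii Tm)
    also have "\<dots> \<le> (\<Sum>i\<in>?I. A * (\<integral>x. (u x)\<^sup>2 \<partial>lebesgue_on \<Omega>) * \<theta> powr R)"
      by (intro sum_mono tail[OF u])
    also have "\<dots> = real k * A * (\<integral>x. (u x)\<^sup>2 \<partial>lebesgue_on \<Omega>) * \<theta> powr R" by simp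
    finally show "(\<integral>x. indicator S x * (u x)\<^sup>2 \<partial>lebesgue_on \<Omega>) \<le> real k * A * (\<integral>x. (u x)\<^sup>2 \<partial>lebesgue_on \<Omega>) * \<theta> powr R" .
  qed
qed

text \<open>For \<open>R\<close> up to a fixed \<open>r\<close> an exponential decay estimate is
  only a matter of the constant.\<close>

lemma le_mult_powr_diff:
  assumes "0 < \<theta>" "\<theta> \<le> 1" "0 \<le> n" "R \<le> (r::real)"
  shows "n \<le> \<theta> powr (- r) * n * \<theta> powr R"
proof -
  have "1 \<le> \<theta> powr (R - r)" using assms powr_mono'[of "R - r" 0 \<theta>] by simp
  then have "n * 1 \<le> n * \<theta> powr (R - r)" using assms by (intro mult_left_mono)
  also have "\<theta> powr (R - r) = \<theta> powr (- r) * \<theta> powr R" by (simp add: powr_add[symmetric])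
  finally show ?thesis by (simp add: mult_ac)
qed

lemma waveguide_eigenfunction_decay:
  fixes \<Omega>0 :: "('a::euclidean_space \<times> real) set" and E :: "nat \<Rightarrow> 'a set"
    and Rot :: "nat \<Rightarrow> ('a \<times> real) \<Rightarrow> ('a \<times> real)" and t :: "nat \<Rightarrow> 'a \<times> real" and k :: nat
  defines "\<Omega> \<equiv> \<Omega>_set \<Omega>0 k Rot t E"
  assumes k: "k \<ge> 1" and O0: "open \<Omega>0" "bounded \<Omega>0"
    and E: "\<And>i. i \<in> {1..k} \<Longrightarrow> open (E i)" "\<And>i. i \<in> {1..k} \<Longrightarrow> bounded (E i)"
    and Rot: "\<And>i. i \<in> {1..k} \<Longrightarrow> orthogonal_transformation (Rot i)"
    and disj: "\<And>i j. i \<in> {1..k} \<Longrightarrow> j \<in> {1..k} \<Longrightarrow> i \<noteq> j \<Longrightarrow>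
        (cyl (Rot i) (t i) (E i) \<inter> cyl (Rot j) (t j) (E j)) - ball 0 \<rho>0 = {}"
    and lam: "lam < Min ((\<lambda>i. dir_eig 1 (E i)) ` {1..k})"
  shows "\<exists>\<beta> C1 C2. 0 < \<beta> \<and> \<beta> < 1 \<and> C1 > 0 \<and> C2 > 0 \<and> (\<forall>u. eigenfunction \<Omega> lam u \<longrightarrow>
     (\<forall>R>0. L2norm (\<Omega> - \<Omega>_trunc \<Omega>0 k Rot t E R) u \<le> C1 * L2norm \<Omega> u * \<beta> powr R) \<and>
     (\<forall>R>0. AE x in lebesgue. x \<in> \<Omega> \<and> norm x > R \<longrightarrow> \<bar>u x\<bar> \<le> C2 * L2norm \<Omega> u * \<beta> powr R))"
proof (rule waveguide_decay[of k \<Omega>0 E Rot t \<rho>0 lam, OF k O0 E Rot disj lam, folded \<Omega>_def])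
  fix \<theta> B r :: real
  assume \<theta>: "0 < \<theta>" "\<theta> < 1" and B: "B > 0" and r: "r > 0" and o\<Omega>: "open \<Omega>"
    and far: "\<And>x R. R > r \<Longrightarrow> x \<in> \<Omega> - \<Omega>_trunc \<Omega>0 k Rot t E R \<Longrightarrow>
      \<exists>i\<in>{1..k}. x \<in> cyl (Rot i) (t i) (E i) \<and> R \<le> (x - t i) \<bullet> Rot i (0, 1)"
    and big: "\<And>x. x \<in> \<Omega> \<Longrightarrow> norm x > r \<Longrightarrow>
      \<exists>i\<in>{1..k}. x \<in> cyl (Rot i) (t i) (E i) \<and> norm x - 2 * r \<le> (x - t i) \<bullet> Rot i (0, 1)"
    and decay: "\<And>u R S. eigenfunction \<Omega> lam u \<Longrightarrow> S \<in> sets borel \<Longrightarrow>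
      (\<And>x. x \<in> S \<Longrightarrow> \<exists>i\<in>{1..k}. x \<in> cyl (Rot i) (t i) (E i) \<and> R \<le> (x - t i) \<bullet> Rot i (0, 1)) \<Longrightarrow>
      (\<integral>x. indicator S x * (u x)\<^sup>2 \<partial>lebesgue_on \<Omega>) \<le> B * (\<integral>x. (u x)\<^sup>2 \<partial>lebesgue_on \<Omega>) * \<theta> powr R"
  note \<Omega>m = open_sets_lebesgue[OF o\<Omega>]
  \<comment> \<open>One rate for both estimates. The L2 bound alone would allow the exponent
    \<open>1 / 2\<close>; the pointwise bound uses the mass beyond \<open>R / 2\<close> and then
    takes a square root.\<close>
  define \<beta> where "\<beta> = \<theta> powr (1 / 4)"
  define B1 where "B1 = B + \<theta> powr (- r)"
  \<comment> \<open>Chosen so that \<open>4 * a\<^sup>2\<close> is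
    \<open>(ln \<theta>)\<^sup>2\<close>, the constant left over when the Gaussian is compared with
    an exponential.\<close>
  define a where "a = - ln \<theta> / 2"
  define I where "I = sqrt (4 * pi) ^ DIM('a \<times> real)"
  \<comment> \<open>The three summands stem from the mass beyond radius \<open>R / 2\<close>, from
    the Gaussian factor at distance \<open>R / 2\<close>, and from the range
    \<open>R \<le> 2 * r\<close>; \<open>exp (2 * lam) / I\<close> comes from the heat bound at time
    1.\<close>
  define B2 where "B2 = exp (2 * lam) * (B * \<theta> powr (- (2 * r)) + exp (4 * a\<^sup>2) + \<theta> powr (- r)) / I"
  have I: "I > 0" by (simp add: I_def)
  have B1: "B1 > 0" unfolding B1_def using B \<theta> by (intro add_pos_pos) auto
  have B2: "B2 > 0" unfolding B2_def using B \<theta> I by (intro divide_pos_pos mult_pos_pos add_pos_pos) auto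
  have \<beta>: "0 < \<beta>" "\<beta> < 1" unfolding \<beta>_def using \<theta> powr_less_mono2[of "1/4" \<theta> 1] by auto
  have \<beta>R: "\<beta> powr R = \<theta> powr (R / 4)" for R by (simp add: \<beta>_def powr_powr)
  have otr: "open (\<Omega>_trunc \<Omega>0 k Rot t E R)" for R
    unfolding \<Omega>_trunc_def cubeQ_def cyl_def using O0(1)
    by (intro open_UN ballI open_Un open_Int open_rigid_image Rot open_cube open_Times E(1) open_greaterThan)
  have main: "L2norm (\<Omega> - \<Omega>_trunc \<Omega>0 k Rot t E R) u \<le> sqrt B1 * L2norm \<Omega> u * \<beta> powr R"
    if u: "eigenfunction \<Omega> lam u" and R: "R > 0" for u R
  proof -
    note sq = W0_sqi(1)[OF o\<Omega> eigenfunction_W0[OF u]]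
    define n where "n = (\<integral>x. (u x)\<^sup>2 \<partial>lebesgue_on \<Omega>)"
    have n: "n \<ge> 0" unfolding n_def by (intro Bochner_Integration.integral_nonneg) auto
    define S where "S = \<Omega> - \<Omega>_trunc \<Omega>0 k Rot t E R"
    have S: "S \<in> sets borel" using o\<Omega> otr by (auto simp: S_def)
    have "(LINT x:S|lebesgue. (u x)\<^sup>2) = (\<integral>x. indicator \<Omega> x *\<^sub>R (indicator S x * (u x)\<^sup>2) \<partial>lebesgue)"
      unfolding set_lebesgue_integral_def by (intro Bochner_Integration.integral_cong) (auto simp: S_def indicator_def)
    also have "\<dots> = (\<integral>x. indicator S x * (u x)\<^sup>2 \<partial>lebesgue_on \<Omega>)"
      using \<Omega>m by (simp add: integral_restrict_space)
    also have "\<dots> \<le> B1 * n * \<theta> powr R"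
    proof (cases "R > r")
      case True
      have "(\<integral>x. indicator S x * (u x)\<^sup>2 \<partial>lebesgue_on \<Omega>) \<le> B * n * \<theta> powr R"
        unfolding n_def by (rule decay[OF u S]) (use far[OF True] in \<open>simp add: S_def\<close>)
      also have "\<dots> \<le> B1 * n * \<theta> powr R" unfolding B1_def using n by (intro mult_right_mono) auto
      finally show ?thesis .
    next
      case False
      have "(\<integral>x. indicator S x * (u x)\<^sup>2 \<partial>lebesgue_on \<Omega>) \<le> n"
        unfolding n_def using sqi_power2[OF sq] by (intro integral_mono') (auto simp: indicator_def)
      also have "\<dots> \<le> \<theta> powr (- r) * n * \<theta> powr R" using \<theta> n False by (intro le_mult_powr_diff) auto
      also have "\<dots> \<le> B1 * n * \<theta> powr R" unfolding B1_def using n B by (intro mult_right_mono) auto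
      finally show ?thesis .
    qed
    finally have "L2norm S u \<le> sqrt (B1 * n * \<theta> powr R)" unfolding L2norm_def by (rule real_sqrt_le_mono)
    also have "\<dots> = sqrt B1 * sqrt n * \<theta> powr (R / 2)"
      using \<theta> by (simp add: real_sqrt_mult powr_half_sqrt[symmetric] powr_powr)
    \<comment> \<open>The exponent is weakened only to share \<open>\<beta>\<close> with the
      pointwise bound.\<close>
    also have "\<dots> \<le> sqrt B1 * sqrt n * \<theta> powr (R / 4)"
      using \<theta> R n B1 by (intro mult_left_mono powr_mono') auto
    finally show ?thesis unfolding S_def n_def L2norm_eq[OF o\<Omega>] \<beta>R .
  qed
  have main2: "AE x in lebesgue. x \<in> \<Omega> \<and> norm x > R \<longrightarrow> \<bar>u x\<bar> \<le> sqrt B2 * L2norm \<Omega> u * \<beta> powr R"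
    if u: "eigenfunction \<Omega> lam u" and R: "R > 0" for u R
  proof -
    note sq = W0_sqi(1)[OF o\<Omega> eigenfunction_W0[OF u]]
    define n where "n = (\<integral>x. (u x)\<^sup>2 \<partial>lebesgue_on \<Omega>)"
    have n: "n \<ge> 0" unfolding n_def by (intro Bochner_Integration.integral_nonneg) auto
    have heat: "(\<integral>y. (u y)\<^sup>2 * heat 1 (y - x) \<partial>lebesgue_on \<Omega>) \<le>
        (B * \<theta> powr (- (2 * r)) + exp (4 * a\<^sup>2) + \<theta> powr (- r)) * n * \<theta> powr (R / 2)" (is "_ \<le> ?D * n * _")
      if x: "norm x > R" for x
    proof (cases "R > 2 * r")
      case True
      \<comment> \<open>The domain is split at radius \<open>R / 2\<close>. On \<open>S\<close> the
        kernel is at most 1 and the mass is small; \<open>R > 2 * r\<close> puts \<open>S\<close>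
        into the cylinders. Off \<open>S\<close> the distance to \<open>x\<close> is at least
        \<open>R / 2\<close>, so the kernel is at most
        \<open>exp (- (R\<^sup>2 / 16))\<close>.\<close>
      define S where "S = {y \<in> \<Omega>. R / 2 \<le> norm y}"
      have [measurable]: "\<Omega> \<in> sets borel" using o\<Omega> by simp
      have S: "S \<in> sets borel" unfolding S_def by measurable
      note iS = integrable_indicator_power2[OF S sq]
      have "(\<integral>y. (u y)\<^sup>2 * heat 1 (y - x) \<partial>lebesgue_on \<Omega>) \<le> (\<integral>y. indicator S y * (u y)\<^sup>2 + exp (- (R\<^sup>2 / 16)) * (u y)\<^sup>2 \<partial>lebesgue_on \<Omega>)"
      proof (rule integral_mono)
        show "integrable (lebesgue_on \<Omega>) (\<lambda>y. (u y)\<^sup>2 * heat 1 (y - x))" by (rule integral_heat_le(2)[OF o\<Omega> sq]) simp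
        show "integrable (lebesgue_on \<Omega>) (\<lambda>y. indicator S y * (u y)\<^sup>2 + exp (- (R\<^sup>2 / 16)) * (u y)\<^sup>2)"
          using iS sqi_power2[OF sq] by simp
        fix y assume "y \<in> space (lebesgue_on \<Omega>)"
        then have y: "y \<in> \<Omega>" by simp
        show "(u y)\<^sup>2 * heat 1 (y - x) \<le> indicator S y * (u y)\<^sup>2 + exp (- (R\<^sup>2 / 16)) * (u y)\<^sup>2"
        proof (cases "y \<in> S")
          case True
          have "(u y)\<^sup>2 * heat 1 (y - x) \<le> (u y)\<^sup>2 * 1"
            by (intro mult_left_mono) (auto simp: heat_def)
          also have "\<dots> \<le> indicator S y * (u y)\<^sup>2 + exp (- (R\<^sup>2 / 16)) * (u y)\<^sup>2" using True by simp
          finally show ?thesis .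
        next
          case False
          then have "norm y < R / 2" using y by (auto simp: S_def)
          then have "R / 2 \<le> norm (y - x)" using x norm_triangle_ineq2[of x y] by (simp add: norm_minus_commute)
          then have "(R / 2)\<^sup>2 \<le> (norm (y - x))\<^sup>2" using R by (intro power_mono) auto
          then have "heat 1 (y - x) \<le> exp (- (R\<^sup>2 / 16))" by (simp add: heat_def power_divide)
          then have "(u y)\<^sup>2 * heat 1 (y - x) \<le> (u y)\<^sup>2 * exp (- (R\<^sup>2 / 16))" by (rule mult_left_mono) simp
          then show ?thesis using False by (simp add: mult.commute)
        qed
      qed
      also have "\<dots> = (\<integral>y. indicator S y * (u y)\<^sup>2 \<partial>lebesgue_on \<Omega>) + exp (- (R\<^sup>2 / 16)) * n"
        unfolding n_def using iS sqi_power2[OF sq] by simp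
      also have "(\<integral>y. indicator S y * (u y)\<^sup>2 \<partial>lebesgue_on \<Omega>) \<le> B * n * \<theta> powr (R / 2 - 2 * r)"
        unfolding n_def
      proof (rule decay[OF u S])
        fix y assume "y \<in> S"
        then have y: "y \<in> \<Omega>" "R / 2 \<le> norm y" by (auto simp: S_def)
        then have "norm y > r" using \<open>R > 2 * r\<close> by simp
        from big[OF y(1) this] y(2)
        show "\<exists>i\<in>{1..k}. y \<in> cyl (Rot i) (t i) (E i) \<and> R / 2 - 2 * r \<le> (y - t i) \<bullet> Rot i (0, 1)" by force
      qed
      also have "exp (- (R\<^sup>2 / 16)) \<le> exp (4 * a\<^sup>2) * \<theta> powr (R / 2)"
      proof -
        \<comment> \<open>Expanding this square bounds \<open>- (R\<^sup>2 / 16)\<close> by an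
          expression linear in \<open>R\<close> with slope \<open>ln \<theta> / 2\<close>, that is,
          by the exponent of \<open>\<theta> powr (R / 2)\<close> up to a constant.\<close>
        have "0 \<le> (R / 4 + ln \<theta>)\<^sup>2" by simp
        also have "\<dots> = R\<^sup>2 / 16 + (4 * a\<^sup>2 + R / 2 * ln \<theta>)" by (simp add: a_def power2_sum power_divide)
        finally have "- (R\<^sup>2 / 16) \<le> 4 * a\<^sup>2 + R / 2 * ln \<theta>" by linarith
        then have "exp (- (R\<^sup>2 / 16)) \<le> exp (4 * a\<^sup>2 + R / 2 * ln \<theta>)" by simp
        then show ?thesis using \<theta> by (simp add: powr_def exp_add)
      qed
      finally have "(\<integral>y. (u y)\<^sup>2 * heat 1 (y - x) \<partial>lebesgue_on \<Omega>) \<le>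
         B * n * \<theta> powr (R / 2 - 2 * r) + exp (4 * a\<^sup>2) * \<theta> powr (R / 2) * n" using n by (simp add: mult_right_mono)
      also have "\<theta> powr (R / 2 - 2 * r) = \<theta> powr (- (2 * r)) * \<theta> powr (R / 2)" by (simp add: powr_add[symmetric])
      also have "B * n * (\<theta> powr (- (2 * r)) * \<theta> powr (R / 2)) + exp (4 * a\<^sup>2) * \<theta> powr (R / 2) * n
        = (B * \<theta> powr (- (2 * r)) + exp (4 * a\<^sup>2)) * n * \<theta> powr (R / 2)" by (simp add: algebra_simps)
      also have "\<dots> \<le> ?D * n * \<theta> powr (R / 2)" using n by (intro mult_right_mono) auto
      finally show ?thesis .
    next
      case False
      have "(\<integral>y. (u y)\<^sup>2 * heat 1 (y - x) \<partial>lebesgue_on \<Omega>) \<le> n"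
        using integral_heat_le(1)[OF o\<Omega> sq, of 1 x] by (simp add: n_def)
      also have "\<dots> \<le> \<theta> powr (- r) * n * \<theta> powr (R / 2)" using \<theta> n False by (intro le_mult_powr_diff) auto
      also have "\<dots> \<le> ?D * n * \<theta> powr (R / 2)" using n B by (intro mult_right_mono) auto
      finally show ?thesis .
    qed
    show ?thesis
      using eigenfunction_heat_bound[OF o\<Omega> u zero_less_one]
    proof eventually_elim
      case (elim x)
      show ?case
      proof
        assume x: "x \<in> \<Omega> \<and> norm x > R"
        then have "I * (u x)\<^sup>2 \<le> exp (2 * lam) * (\<integral>y. (u y)\<^sup>2 * heat 1 (y - x) \<partial>lebesgue_on \<Omega>)"
          using elim by (simp add: I_def)
        also have "\<dots> \<le> exp (2 * lam) * ((B * \<theta> powr (- (2 * r)) + exp (4 * a\<^sup>2) + \<theta> powr (- r)) * n * \<theta> powr (R / 2))"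
          using heat x by (intro mult_left_mono) auto
        finally have "(u x)\<^sup>2 \<le> B2 * n * \<theta> powr (R / 2)" using I by (simp add: B2_def field_simps)
        then have "sqrt ((u x)\<^sup>2) \<le> sqrt (B2 * n * \<theta> powr (R / 2))" by (rule real_sqrt_le_mono)
        also have "\<dots> = sqrt B2 * sqrt n * \<theta> powr (R / 4)"
          using \<theta> by (simp add: real_sqrt_mult powr_half_sqrt[symmetric] powr_powr)
        finally show "\<bar>u x\<bar> \<le> sqrt B2 * L2norm \<Omega> u * \<beta> powr R" unfolding n_def L2norm_eq[OF o\<Omega>] \<beta>R by simp
      qed
    qed
  qed
  show ?thesis
    by (rule exI[of _ \<beta>], rule exI[of _ "sqrt B1"], rule exI[of _ "sqrt B2"])
       (use \<beta> B1 B2 main main2 in auto)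
qed

theorem mainTheorem6:
  "\<exists>C3>0. \<forall>(k::nat) (\<Omega>0 :: ('a::euclidean_space \<times> real) set) (E :: nat \<Rightarrow> 'a set)
      (Rot :: nat \<Rightarrow> ('a \<times> real) \<Rightarrow> ('a \<times> real)) (t :: nat \<Rightarrow> 'a \<times> real) (\<rho>0::real) (l::nat).
    DIM('a) \<ge> 1 \<and> k \<ge> 1 \<and> open \<Omega>0 \<and> bounded \<Omega>0 \<and>
    (\<forall>i\<in>{1..k}. open (E i) \<and> bounded (E i) \<and> connected (E i) \<and> E i \<noteq> {} \<and>
                 orthogonal_transformation (Rot i)) \<and>
    \<rho>0 > 0 \<and>
    (\<forall>i\<in>{1..k}. \<forall>j\<in>{1..k}. i \<noteq> j \<longrightarrow>
        (cyl (Rot i) (t i) (E i) \<inter> cyl (Rot j) (t j) (E j)) - ball 0 \<rho>0 = {}) \<and>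
    l \<ge> 1 \<and>
    dir_eig l (\<Omega>_set \<Omega>0 k Rot t E)
      < Min ((\<lambda>i. dir_eig 1 (E i)) ` {1..k})
    \<longrightarrow>
    (\<forall>j\<in>{1..l}. \<exists>\<beta> C1 C2. 0 < \<beta> \<and> \<beta> < 1 \<and> C1 > 0 \<and> C2 > 0 \<and>
       (\<forall>u. eigenfunction (\<Omega>_set \<Omega>0 k Rot t E)
              (dir_eig j (\<Omega>_set \<Omega>0 k Rot t E)) u \<longrightarrow>
         (\<forall>R>0. L2norm ((\<Omega>_set \<Omega>0 k Rot t E)
                          - (\<Omega>_trunc \<Omega>0 k Rot t E R)) u
                 \<le> C1 * L2norm (\<Omega>_set \<Omega>0 k Rot t E) u * \<beta> powr R) \<and>
         (\<forall>R>0. AE x in lebesgue. x \<in> (\<Omega>_set \<Omega>0 k Rot t E) \<and> norm x > R \<longrightarrow>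
                 \<bar>u x\<bar> \<le> C2 * L2norm (\<Omega>_set \<Omega>0 k Rot t E) u * \<beta> powr R) \<and>
         (AE x in lebesgue. x \<in> (\<Omega>_set \<Omega>0 k Rot t E) \<longrightarrow>
                 \<bar>u x\<bar> \<le> C3 * dir_eig j (\<Omega>_set \<Omega>0 k Rot t E) powr (real DIM('a \<times> real) / 4)
                          * L2norm (\<Omega>_set \<Omega>0 k Rot t E) u)))"
proof -
  \<comment> \<open>Fixed before any domain is introduced: only the dimension enters.\<close>
  define C3 where "C3 = exp 1 / sqrt (sqrt (4 * pi) ^ DIM('a \<times> real))"
  have C3: "C3 > 0" by (simp add: C3_def)
  show ?thesis
  proof (rule exI[of _ C3], rule conjI[OF C3], intro allI impI ballI)
    fix k l j :: nat and \<Omega>0 :: "('a \<times> real) set" and E :: "nat \<Rightarrow> 'a set"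
      and Rot :: "nat \<Rightarrow> ('a \<times> real) \<Rightarrow> ('a \<times> real)" and t :: "nat \<Rightarrow> 'a \<times> real" and \<rho>0 :: real
    let ?\<Omega> = "\<Omega>_set \<Omega>0 k Rot t E"
    assume H: "DIM('a) \<ge> 1 \<and> k \<ge> 1 \<and> open \<Omega>0 \<and> bounded \<Omega>0 \<and>
      (\<forall>i\<in>{1..k}. open (E i) \<and> bounded (E i) \<and> connected (E i) \<and> E i \<noteq> {} \<and> orthogonal_transformation (Rot i)) \<and>
      \<rho>0 > 0 \<and>
      (\<forall>i\<in>{1..k}. \<forall>j\<in>{1..k}. i \<noteq> j \<longrightarrow> (cyl (Rot i) (t i) (E i) \<inter> cyl (Rot j) (t j) (E j)) - ball 0 \<rho>0 = {}) \<and>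
      l \<ge> 1 \<and> dir_eig l ?\<Omega> < Min ((\<lambda>i. dir_eig 1 (E i)) ` {1..k})"
      and j: "j \<in> {1..l}"
    have o\<Omega>: "open ?\<Omega>"
      unfolding \<Omega>_set_def cyl_def using H
      by (intro open_Un open_UN ballI open_rigid_image open_Times open_greaterThan) auto
    \<comment> \<open>A point of height 1 over the cross section \<open>E 1\<close> lies in the
      domain; a nonempty open domain has trial spaces of every dimension, as monotonicity of the
      eigenvalues requires.\<close>
    have "?\<Omega> \<noteq> {}"
    proof -
      have "1 \<in> {1..k}" using H by simp
      moreover obtain x where "x \<in> E 1" using H \<open>1 \<in> {1..k}\<close> by blast
      ultimately have "Rot 1 (x, 1) + t 1 \<in> ?\<Omega>" unfolding \<Omega>_set_def cyl_def by force
      then show ?thesis by blast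
    qed
    then have "dir_eig j ?\<Omega> \<le> dir_eig l ?\<Omega>"
      using j by (intro dir_eig_mono o\<Omega> subspaces_dim_nonempty) auto
    then have lam: "dir_eig j ?\<Omega> < Min ((\<lambda>i. dir_eig 1 (E i)) ` {1..k})" using H by linarith
    have "\<exists>\<beta> C1 C2. 0 < \<beta> \<and> \<beta> < 1 \<and> C1 > 0 \<and> C2 > 0 \<and> (\<forall>u. eigenfunction ?\<Omega> (dir_eig j ?\<Omega>) u \<longrightarrow>
       (\<forall>R>0. L2norm (?\<Omega> - \<Omega>_trunc \<Omega>0 k Rot t E R) u \<le> C1 * L2norm ?\<Omega> u * \<beta> powr R) \<and>
       (\<forall>R>0. AE x in lebesgue. x \<in> ?\<Omega> \<and> norm x > R \<longrightarrow> \<bar>u x\<bar> \<le> C2 * L2norm ?\<Omega> u * \<beta> powr R))"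
      by (rule waveguide_eigenfunction_decay[of k \<Omega>0 E Rot t \<rho>0 "dir_eig j ?\<Omega>", OF _ _ _ _ _ _ _ lam]) (use H in auto)
    then obtain \<beta> C1 C2 where c: "0 < \<beta>" "\<beta> < 1" "C1 > 0" "C2 > 0" and
      d: "\<And>u. eigenfunction ?\<Omega> (dir_eig j ?\<Omega>) u \<Longrightarrow>
       (\<forall>R>0. L2norm (?\<Omega> - \<Omega>_trunc \<Omega>0 k Rot t E R) u \<le> C1 * L2norm ?\<Omega> u * \<beta> powr R) \<and>
       (\<forall>R>0. AE x in lebesgue. x \<in> ?\<Omega> \<and> norm x > R \<longrightarrow> \<bar>u x\<bar> \<le> C2 * L2norm ?\<Omega> u * \<beta> powr R)"
      by blast
    show "\<exists>\<beta> C1 C2. 0 < \<beta> \<and> \<beta> < 1 \<and> C1 > 0 \<and> C2 > 0 \<and>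
       (\<forall>u. eigenfunction ?\<Omega> (dir_eig j ?\<Omega>) u \<longrightarrow>
         (\<forall>R>0. L2norm (?\<Omega> - \<Omega>_trunc \<Omega>0 k Rot t E R) u \<le> C1 * L2norm ?\<Omega> u * \<beta> powr R) \<and>
         (\<forall>R>0. AE x in lebesgue. x \<in> ?\<Omega> \<and> norm x > R \<longrightarrow> \<bar>u x\<bar> \<le> C2 * L2norm ?\<Omega> u * \<beta> powr R) \<and>
         (AE x in lebesgue. x \<in> ?\<Omega> \<longrightarrow>
            \<bar>u x\<bar> \<le> C3 * dir_eig j ?\<Omega> powr (real DIM('a \<times> real) / 4) * L2norm ?\<Omega> u))"
    proof (rule exI[of _ \<beta>], rule exI[of _ C1], rule exI[of _ C2], intro conjI c allI impI)
      fix u assume u: "eigenfunction ?\<Omega> (dir_eig j ?\<Omega>) u"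
      show "L2norm (?\<Omega> - \<Omega>_trunc \<Omega>0 k Rot t E R) u \<le> C1 * L2norm ?\<Omega> u * \<beta> powr R" if "R > 0" for R
        using d[OF u] that by simp
      show "AE x in lebesgue. x \<in> ?\<Omega> \<and> norm x > R \<longrightarrow> \<bar>u x\<bar> \<le> C2 * L2norm ?\<Omega> u * \<beta> powr R" if "R > 0" for R
        using d[OF u] that by simp
      show "AE x in lebesgue. x \<in> ?\<Omega> \<longrightarrow>
            \<bar>u x\<bar> \<le> C3 * dir_eig j ?\<Omega> powr (real DIM('a \<times> real) / 4) * L2norm ?\<Omega> u"
        unfolding C3_def by (rule eigenfunction_sup_bound[OF o\<Omega> u])
    qed
  qed
qed

end
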